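(* Let $\Bbbk$ be a unital commutative ring. The Koszul dual algebra of the coalgebra $\mathsf{L}$ of linear orders is the free commutative algebra $S(s^{-1}\mathsf{Lie})$ over the desuspension of $\mathsf{Lie}$. In particular, for each $p,q\in\mathbb{N}$, $$H^{p-q}(\Omega^*(\mathsf{L})[p])=S(s^{-1}\mathsf{Lie})[p]^{p-q}$$ has a basis in correspondence with the permutations of $[p]$ with $p-q$ disjoint cycles, and hence $$\dim_\Bbbk S(s^{-1}\mathsf{Lie})[p]^{p-q}=\genfrac{[}{]}{0pt}{}{p}{p-q},$$ an unsigned Stirling number of the first kind.
   Context: A (linear) species is a functor from finite sets and bijections to (graded) $\Bbbk$-modules; $\mathsf{X}[p]$ is its value on $[p]=\{1,\ldots,p\}$. The Cauchy product is $(\mathsf{X}\cdot\mathsf{Y})[I]=\bigoplus_{(S,T)}\mathsf{X}[S]\otimes\mathsf{Y}[T]$ over ordered pairs of disjoint, possibly empty, $S,T$ with union $I$; (co)algebras in species are taken with respect to it. $\mathsf{L}[I]$ is free on the linear orders on $I$, and is a cocommutative coalgebra with components $\mathsf{L}[I]\to\mathsf{L}[S]\otimes\mathsf{L}[T]$, $\ell\mapsto\ell|_S\otimes\ell|_T$. Its cobar construction $\Omega^*(\mathsf{L})$ is the dg algebra with $\Omega^m(\mathsf{L})[I]=\bigoplus\mathsf{L}[F_1]\otimes\cdots\otimes\mathsf{L}[F_m]$, the sum over compositions $(F_1,\ldots,F_m)$ of $I$ (disjoint nonempty blocks with union $I$), in cohomological degree $m$, with concatenation product and differential $\sum_{i=1}^m(-1)^id_i$,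 where $d_i$ replaces the $i$-th factor $\ell\in\mathsf{L}[F_i]$ by $\sum\ell|_A\otimes\ell|_B$ over ordered pairs $(A,B)$ of disjoint nonempty sets with $A\cup B=F_i$. The Koszul dual algebra of $\mathsf{L}$ is the cohomology algebra $H^*(\Omega^*(\mathsf{L}))$. $\mathsf{Lie}$ is the species underlying the free Lie algebra functor: $\mathsf{Lie}[I]$ is the multilinear part of the free Lie algebra on the set $I$ (with $\mathsf{Lie}[\varnothing]=0$). $s^{-1}\mathsf{Lie}$ is $\mathsf{Lie}$ placed in cohomological degree $1$, and $S(s^{-1}\mathsf{Lie})$ is the free graded commutative algebra (with Koszul signs) on it with respect to the Cauchy product; $S(s^{-1}\mathsf{Lie})[I]^m$ is spanned by products $z_1\odot\cdots\odot z_m$ with $z_i\in\mathsf{Lie}[F_i]$, $\{F_1,\ldots,F_m\}$ a partition of $I$. Fixed points count as cycles. *)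

theory Defs
  imports
    "HOL-Library.Poly_Mapping"
    "HOL-Library.Disjoint_Sets"
    "HOL-Combinatorics.Multiset_Permutations"
    "HOL-Combinatorics.Orbits"
    "HOL-Combinatorics.Stirling"
    "Jordan_Normal_Form.VS_Connect"
begin

section \<open>Free modules, quotients and bases\<close>

text \<open>The free \<open>'k\<close>-module on \<open>'x\<close> is the type \<open>'x \<Rightarrow>\<^sub>0 'k\<close>; the free module on a subset \<open>X\<close>
  is its submodule \<open>free_on X\<close>.\<close>

definition pm_scale :: "'k::comm_ring_1 \<Rightarrow> ('x \<Rightarrow>\<^sub>0 'k) \<Rightarrow> ('x \<Rightarrow>\<^sub>0 'k)" where
  "pm_scale c p = Poly_Mapping.map ((*) c) p"

lemma lookup_pm_scale [simp]:
  "Poly_Mapping.lookup (pm_scale c p) x = c * Poly_Mapping.lookup p x"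
  by (simp add: pm_scale_def Poly_Mapping.map.rep_eq when_def)

interpretation free_mod: Modules.module "pm_scale :: 'k::comm_ring_1 \<Rightarrow> ('x \<Rightarrow>\<^sub>0 'k) \<Rightarrow> _"
  by unfold_locales (auto intro!: poly_mapping_eqI simp: lookup_add algebra_simps)

definition free_on :: "'x set \<Rightarrow> ('x \<Rightarrow>\<^sub>0 'k::comm_ring_1) set" where
  "free_on X = {p. Poly_Mapping.keys p \<subseteq> X}"

definition lin_ext :: "('x \<Rightarrow> ('y \<Rightarrow>\<^sub>0 'k)) \<Rightarrow> ('x \<Rightarrow>\<^sub>0 'k::comm_ring_1) \<Rightarrow> ('y \<Rightarrow>\<^sub>0 'k)" where
  "lin_ext f p = (\<Sum>x\<in>Poly_Mapping.keys p. pm_scale (Poly_Mapping.lookup p x) (f x))"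

definition bilin_ext ::
  "('x \<Rightarrow> 'y \<Rightarrow> 'z) \<Rightarrow> ('x \<Rightarrow>\<^sub>0 'k) \<Rightarrow> ('y \<Rightarrow>\<^sub>0 'k) \<Rightarrow> ('z \<Rightarrow>\<^sub>0 'k::comm_ring_1)" where
  "bilin_ext f p q = (\<Sum>x\<in>Poly_Mapping.keys p. \<Sum>y\<in>Poly_Mapping.keys q.
     Poly_Mapping.single (f x y) (Poly_Mapping.lookup p x * Poly_Mapping.lookup q y))"

definition residue_class :: "('x \<Rightarrow>\<^sub>0 'k::comm_ring_1) set \<Rightarrow> ('x \<Rightarrow>\<^sub>0 'k) \<Rightarrow> ('x \<Rightarrow>\<^sub>0 'k) set" where
  "residue_class N x = {y. y - x \<in> N}"

text \<open>Maps into a quotient by \<open>N\<close> that are computed on representatives. If \<open>f\<close> does not depend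
  on the representative modulo \<open>N\<close>, the union is the single residue class of any \<open>f x\<close>.\<close>

definition on_classes ::
  "('y \<Rightarrow>\<^sub>0 'k::comm_ring_1) set \<Rightarrow> ('x \<Rightarrow> ('y \<Rightarrow>\<^sub>0 'k)) \<Rightarrow> 'x set \<Rightarrow> ('y \<Rightarrow>\<^sub>0 'k) set" where
  "on_classes N f X = (\<Union>x\<in>X. residue_class N (f x))"

definition on_classes2 ::
  "('z \<Rightarrow>\<^sub>0 'k::comm_ring_1) set \<Rightarrow> ('x \<Rightarrow> 'y \<Rightarrow> ('z \<Rightarrow>\<^sub>0 'k)) \<Rightarrow> 'x set \<Rightarrow> 'y set \<Rightarrow> ('z \<Rightarrow>\<^sub>0 'k) set"
  where "on_classes2 N f X Y = (\<Union>x\<in>X. \<Union>y\<in>Y. residue_class N (f x y))"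

text \<open>The image of the submodule \<open>M\<close> in the quotient by the submodule \<open>N\<close>; this is
  the quotient \<open>M / N\<close> when \<open>N \<subseteq> M\<close>. The ring fields of the module record are irrelevant.\<close>

definition quotient_module ::
  "('x \<Rightarrow>\<^sub>0 'k::comm_ring_1) set \<Rightarrow> ('x \<Rightarrow>\<^sub>0 'k) set \<Rightarrow> ('k, ('x \<Rightarrow>\<^sub>0 'k) set) module" where
  "quotient_module M N =
     \<lparr>carrier = residue_class N ` M, mult = undefined, one = undefined, zero = N,
      add = on_classes2 N (+), smult = (\<lambda>c. on_classes N (pm_scale c))\<rparr>"

definition module_basis :: "('k::comm_ring_1, 'v) module \<Rightarrow> 'v set \<Rightarrow> bool" where
  "module_basis M B \<longleftrightarrow> B \<subseteq> carrier M
     \<and> \<not> LinearCombinations.module.lin_dep class_ring M B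
     \<and> LinearCombinations.module.span class_ring M B = carrier M"

text \<open>The dimension (rank) of a free module; it has no meaning for modules without a basis.\<close>

definition module_dim :: "('k::comm_ring_1, 'v) module \<Rightarrow> nat" where
  "module_dim M = card (SOME B. module_basis M B)"

definition module_iso ::
  "('k::comm_ring_1, 'v) module \<Rightarrow> ('k, 'w) module \<Rightarrow> ('v \<Rightarrow> 'w) \<Rightarrow> bool" where
  "module_iso M N f \<longleftrightarrow> mod_hom class_ring M N f \<and> bij_betw f (carrier M) (carrier N)"


section \<open>Species and graded algebras in species\<close>

text \<open>A species is given on the finite subsets of a fixed type \<open>'a\<close>: its value on \<open>I\<close>,
  and the map \<open>sp_map V \<sigma> I\<close> from the value on \<open>I\<close> to the value on \<open>\<sigma> ` I\<close> induced by the
  bijection that \<open>\<sigma>\<close> restricts to, for \<open>\<sigma>\<close> injective on \<open>I\<close>.\<close>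

record ('a, 'k, 'v) species =
  sp_val :: "'a set \<Rightarrow> ('k, 'v) module"
  sp_map :: "('a \<Rightarrow> 'a) \<Rightarrow> 'a set \<Rightarrow> 'v \<Rightarrow> 'v"

text \<open>Graded algebras for the Cauchy product. The product consists of its components
  \<open>X[A]\<^sup>m \<otimes> X[B]\<^sup>n \<rightarrow> X[A \<union> B]\<^sup>m\<^sup>+\<^sup>n\<close> for disjoint \<open>A\<close> and \<open>B\<close>, and the unit
  is an element of \<open>X[{}]\<^sup>0\<close>.\<close>

record ('a, 'k, 'v) graded_species_algebra =
  gr_val :: "'a set \<Rightarrow> int \<Rightarrow> ('k, 'v) module"
  gr_map :: "('a \<Rightarrow> 'a) \<Rightarrow> 'a set \<Rightarrow> int \<Rightarrow> 'v \<Rightarrow> 'v"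
  gr_mult :: "'a set \<Rightarrow> int \<Rightarrow> 'a set \<Rightarrow> int \<Rightarrow> 'v \<Rightarrow> 'v \<Rightarrow> 'v"
  gr_unit :: 'v

definition graded_species_algebra_iso ::
  "('a, 'k::comm_ring_1, 'v) graded_species_algebra \<Rightarrow> ('a, 'k, 'w) graded_species_algebra \<Rightarrow>
   ('a set \<Rightarrow> int \<Rightarrow> 'v \<Rightarrow> 'w) \<Rightarrow> bool" where
  "graded_species_algebra_iso X Y \<Phi> \<longleftrightarrow>
     (\<forall>I n. finite I \<longrightarrow> module_iso (gr_val X I n) (gr_val Y I n) (\<Phi> I n)) \<and>
     (\<forall>I n \<sigma>. finite I \<and> inj_on \<sigma> I \<longrightarrow>
        (\<forall>x\<in>carrier (gr_val X I n).
           \<Phi> (\<sigma> ` I) n (gr_map X \<sigma> I n x) = gr_map Y \<sigma> I n (\<Phi> I n x))) \<and>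
     (\<forall>A m B n. finite A \<and> finite B \<and> A \<inter> B = {} \<longrightarrow>
        (\<forall>x\<in>carrier (gr_val X A m). \<forall>y\<in>carrier (gr_val X B n).
           \<Phi> (A \<union> B) (m + n) (gr_mult X A m B n x y)
             = gr_mult Y A m B n (\<Phi> A m x) (\<Phi> B n y))) \<and>
     \<Phi> {} 0 (gr_unit X) = gr_unit Y"

definition compositions :: "'a set \<Rightarrow> 'a set list set" where
  "compositions I = {Fs. distinct Fs \<and> partition_on I (set Fs)}"


section \<open>The cobar construction of the coalgebra of linear orders\<close>

text \<open>A linear order on \<open>F\<close> is a list enumerating \<open>F\<close> without repetition, and its restriction
  to \<open>S\<close> is \<open>filter (\<lambda>x. x \<in> S)\<close>. Since \<open>L[F]\<close> is free on linear orders,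
  \<open>L[F\<^sub>1] \<otimes> \<dots> \<otimes> L[F\<^sub>m]\<close> is free on the lists of linear orders on the blocks.\<close>

definition cobar_words :: "int \<Rightarrow> 'a set \<Rightarrow> 'a list list set" where
  "cobar_words n I = {w. int (length w) = n \<and>
     (\<exists>Fs\<in>compositions I. list_all2 (\<lambda>l F. l \<in> permutations_of_set F) w Fs)}"

definition cobar :: "int \<Rightarrow> 'a set \<Rightarrow> ('a list list \<Rightarrow>\<^sub>0 'k::comm_ring_1) set" where
  "cobar n I = free_on (cobar_words n I)"

definition cobar_face :: "nat \<Rightarrow> 'a list list \<Rightarrow> ('a list list \<Rightarrow>\<^sub>0 'k::comm_ring_1)" where
  "cobar_face i w =
     (\<Sum>(A, B) \<in> {(A, B). A \<noteq> {} \<and> B \<noteq> {} \<and> A \<inter> B = {} \<and> A \<union> B = set (w ! (i - 1))}.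
        Poly_Mapping.single
          (take (i - 1) w @
           [filter (\<lambda>x. x \<in> A) (w ! (i - 1)), filter (\<lambda>x. x \<in> B) (w ! (i - 1))] @
           drop i w) 1)"

definition cobar_diff :: "('a list list \<Rightarrow>\<^sub>0 'k::comm_ring_1) \<Rightarrow> ('a list list \<Rightarrow>\<^sub>0 'k)" where
  "cobar_diff = lin_ext (\<lambda>w. \<Sum>i = 1..length w. pm_scale ((- 1) ^ i) (cobar_face i w))"

definition cobar_cocycles :: "int \<Rightarrow> 'a set \<Rightarrow> ('a list list \<Rightarrow>\<^sub>0 'k::comm_ring_1) set" where
  "cobar_cocycles n I = {x \<in> cobar n I. cobar_diff x = 0}"

definition cobar_coboundaries :: "int \<Rightarrow> 'a set \<Rightarrow> ('a list list \<Rightarrow>\<^sub>0 'k::comm_ring_1) set" where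
  "cobar_coboundaries n I = cobar_diff ` cobar (n - 1) I"

definition koszul_dual_L ::
  "('a, 'k::comm_ring_1, ('a list list \<Rightarrow>\<^sub>0 'k) set) graded_species_algebra" where
  "koszul_dual_L =
     \<lparr>gr_val = (\<lambda>I n. quotient_module (cobar_cocycles n I) (cobar_coboundaries n I)),
      gr_map = (\<lambda>\<sigma> I n. on_classes (cobar_coboundaries n (\<sigma> ` I))
                  (lin_ext (\<lambda>w. Poly_Mapping.single (map (map \<sigma>) w) 1))),
      gr_mult = (\<lambda>A m B n. on_classes2 (cobar_coboundaries (m + n) (A \<union> B)) (bilin_ext (@))),
      gr_unit = residue_class (cobar_coboundaries 0 {}) (Poly_Mapping.single [] 1)\<rparr>"


section \<open>The species Lie\<close>

text \<open>The free Lie algebra on a set \<open>I\<close> is the free nonassociative algebra on \<open>I\<close>, with basis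
  the binary trees with leaves in \<open>I\<close>, modulo the ideal generated by the alternating and Jacobi laws.\<close>

datatype 'a magma = Gen 'a | Br "'a magma" "'a magma"

primrec leaves :: "'a magma \<Rightarrow> 'a list" where
  "leaves (Gen a) = [a]"
| "leaves (Br s t) = leaves s @ leaves t"

definition nonassoc_alg :: "'a set \<Rightarrow> ('a magma \<Rightarrow>\<^sub>0 'k::comm_ring_1) set" where
  "nonassoc_alg I = free_on {t. set_magma t \<subseteq> I}"

abbreviation bracket ::
  "('a magma \<Rightarrow>\<^sub>0 'k::comm_ring_1) \<Rightarrow> ('a magma \<Rightarrow>\<^sub>0 'k) \<Rightarrow> ('a magma \<Rightarrow>\<^sub>0 'k)" where
  "bracket \<equiv> bilin_ext Br"

inductive_set lie_ideal :: "'a set \<Rightarrow> ('a magma \<Rightarrow>\<^sub>0 'k::comm_ring_1) set" for I :: "'a set" where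
  zero: "0 \<in> lie_ideal I"
| add: "x \<in> lie_ideal I \<Longrightarrow> y \<in> lie_ideal I \<Longrightarrow> x + y \<in> lie_ideal I"
| scale: "x \<in> lie_ideal I \<Longrightarrow> pm_scale c x \<in> lie_ideal I"
| left: "x \<in> lie_ideal I \<Longrightarrow> p \<in> nonassoc_alg I \<Longrightarrow> bracket p x \<in> lie_ideal I"
| right: "x \<in> lie_ideal I \<Longrightarrow> p \<in> nonassoc_alg I \<Longrightarrow> bracket x p \<in> lie_ideal I"
| alternating: "p \<in> nonassoc_alg I \<Longrightarrow> bracket p p \<in> lie_ideal I"
| jacobi: "p \<in> nonassoc_alg I \<Longrightarrow> q \<in> nonassoc_alg I \<Longrightarrow> r \<in> nonassoc_alg I \<Longrightarrow>
    bracket p (bracket q r) + bracket q (bracket r p) + bracket r (bracket p q) \<in> lie_ideal I"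

definition multilinear_part :: "'a set \<Rightarrow> ('a magma \<Rightarrow>\<^sub>0 'k::comm_ring_1) set" where
  "multilinear_part I = free_on {t. leaves t \<in> permutations_of_set I}"

definition Lie_species :: "('a, 'k::comm_ring_1, ('a magma \<Rightarrow>\<^sub>0 'k) set) species" where
  "Lie_species =
     \<lparr>sp_val = (\<lambda>I. quotient_module (multilinear_part I) (lie_ideal I)),
      sp_map = (\<lambda>\<sigma> I. on_classes (lie_ideal (\<sigma> ` I))
                  (lin_ext (\<lambda>t. Poly_Mapping.single (map_magma \<sigma> t) 1)))\<rparr>"


section \<open>The free graded commutative algebra on a desuspended species\<close>

text \<open>For a species \<open>V\<close> with \<open>V[{}] = 0\<close>, placed in degree 1, the component of
  \<open>S(s\<^sup>-\<^sup>1V)[I]\<close> of degree \<open>n\<close> is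
  the sum of \<open>V[F\<^sub>1] \<otimes> \<dots> \<otimes> V[F\<^sub>n]\<close> over the compositions of \<open>I\<close>, modulo permutation of the
  factors with Koszul signs. It is presented by the formal words
  \<open>[(F\<^sub>1, z\<^sub>1), \<dots>, (F\<^sub>n, z\<^sub>n)]\<close> with \<open>z\<^sub>i \<in> V[F\<^sub>i]\<close>: the first two families of relations
  form the tensor products, the third makes adjacent factors, which have degree 1, anticommute.\<close>

definition sym_words :: "('a, 'k, 'v) species \<Rightarrow> int \<Rightarrow> 'a set \<Rightarrow> ('a set \<times> 'v) list set" where
  "sym_words V n I = {w. int (length w) = n \<and> map fst w \<in> compositions I \<and>
     (\<forall>(F, z)\<in>set w. z \<in> carrier (sp_val V F))}"

inductive_set sym_relators ::
  "('a, 'k, 'v) species \<Rightarrow> int \<Rightarrow> 'a set \<Rightarrow> (('a set \<times> 'v) list \<Rightarrow>\<^sub>0 'k::comm_ring_1) set"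
  for V :: "('a, 'k::comm_ring_1, 'v) species" and n :: int and I :: "'a set" where
  additive: "u @ (F, x) # v \<in> sym_words V n I \<Longrightarrow> u @ (F, y) # v \<in> sym_words V n I \<Longrightarrow>
    Poly_Mapping.single (u @ (F, x \<oplus>\<^bsub>sp_val V F\<^esub> y) # v) 1
      - Poly_Mapping.single (u @ (F, x) # v) 1 - Poly_Mapping.single (u @ (F, y) # v) 1
    \<in> sym_relators V n I"
| homogeneous: "u @ (F, x) # v \<in> sym_words V n I \<Longrightarrow>
    Poly_Mapping.single (u @ (F, c \<odot>\<^bsub>sp_val V F\<^esub> x) # v) 1
      - Poly_Mapping.single (u @ (F, x) # v) c
    \<in> sym_relators V n I"
| anticommutative: "u @ a # b # v \<in> sym_words V n I \<Longrightarrow>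
    Poly_Mapping.single (u @ a # b # v) 1 + Poly_Mapping.single (u @ b # a # v) 1
    \<in> sym_relators V n I"

definition sym_relations ::
  "('a, 'k, 'v) species \<Rightarrow> int \<Rightarrow> 'a set \<Rightarrow> (('a set \<times> 'v) list \<Rightarrow>\<^sub>0 'k::comm_ring_1) set" where
  "sym_relations V n I = free_mod.span (sym_relators V n I)"

definition sym_desusp ::
  "('a, 'k, 'v) species \<Rightarrow>
   ('a, 'k::comm_ring_1, (('a set \<times> 'v) list \<Rightarrow>\<^sub>0 'k) set) graded_species_algebra" where
  "sym_desusp V =
     \<lparr>gr_val = (\<lambda>I n. quotient_module (free_on (sym_words V n I)) (sym_relations V n I)),
      gr_map = (\<lambda>\<sigma> I n. on_classes (sym_relations V n (\<sigma> ` I))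
                  (lin_ext (\<lambda>w. Poly_Mapping.single
                     (map (\<lambda>(F, z). (\<sigma> ` F, sp_map V \<sigma> F z)) w) 1))),
      gr_mult = (\<lambda>A m B n. on_classes2 (sym_relations V (m + n) (A \<union> B)) (bilin_ext (@))),
      gr_unit = residue_class (sym_relations V 0 {}) (Poly_Mapping.single [] 1)\<rparr>"

definition num_cycles :: "'a set \<Rightarrow> ('a \<Rightarrow> 'a) \<Rightarrow> nat" where
  "num_cycles I \<pi> = card (orbit \<pi> ` I)"

end

theory Submission
  imports Defs
begin

text \<open>
  Lie polynomials are primitive in the coalgebra \<open>L\<close>, so they are 1-cocycles of its cobar construction.
  If \<open>x\<close> and \<open>y\<close> are Lie polynomials on disjoint sets, the coboundary of the one-block word \<open>xy\<close> is
  \<open>- (x|y + y|x)\<close>; hence products of Lie polynomials define a map of algebras from \<open>S(s\<^sup>-\<^sup>1Lie)\<close> to the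
  cohomology (\<open>comparison\<close> below), and it visibly commutes with relabelling. It remains to prove that
  it is bijective. The ring is arbitrary, so the symmetrization isomorphism between the universal
  enveloping algebra of the free Lie algebra and its symmetric algebra, which divides by factorials,
  need not exist; the proof computes the cohomology by removing one bracket at a time instead.

  Choose a letter \<open>a \<in> I\<close>. For every list \<open>c = a x\<^sub>1 \<dots> x\<^sub>k\<close> of distinct letters let \<open>b\<^sub>c\<close> be the left-normed bracket
  \<open>[\<dots>[[a, x\<^sub>1], x\<^sub>2], \<dots>, x\<^sub>k]\<close>. The rewriting \<open>x b = b x - [b, x]\<close> expresses every linear order that contains
  \<open>a\<close> uniquely as a combination of products \<open>b\<^sub>c w\<close>. Because \<open>b\<^sub>c\<close> is primitive, it behaves in coproducts
  like a single letter. So the cobar complex of \<open>I\<close> is the direct sum, over all \<open>c\<close>, of complexes spanned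
  by words on \<open>{a} \<union> (I - c)\<close> in which the letter \<open>a\<close>, standing for \<open>b\<^sub>c\<close>, can only occur at the head
  of a block (\<open>cobar_bracket_sum\<close>, \<open>bracket_sum_inj\<close>, \<open>cdiff_subst_heads\<close>). An explicit homotopy contracts each of
  them onto the words that end with the block \<open>[a]\<close> (\<open>head_homotopy_cdiff\<close>). Thus the cohomology of \<open>I\<close> in
  degree \<open>n + 1\<close> is the direct sum over \<open>c\<close> of the cohomology of \<open>I - c\<close> in degree \<open>n\<close>, multiplied by \<open>b\<^sub>c\<close>
  (\<open>cocycle_split_bracket\<close>, \<open>boundary_split_bracket\<close>). By induction it has a basis of products of left-normed
  brackets, indexed by lists of cycles in which every cycle starts with the letter chosen from what
  the preceding cycles leave of \<open>I\<close>.

  In the free Lie algebra the same brackets \<open>b\<^sub>c\<close> span the multilinear part, by antisymmetry and the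
  Jacobi law. So the products that are mapped to the basis of the cohomology span \<open>S(s\<^sup>-\<^sup>1Lie)[I]\<close>
  (\<open>sym_cycles_span\<close>). A linear map that sends a spanning family to a basis is bijective, and the spanning
  family is a basis. Finally the lists of \<open>n\<close> cycles and the permutations with \<open>n\<close> cycles are both counted
  by the recursion of the Stirling numbers, and the number of elements of a basis is unique by a
  determinant argument.
\<close>

section \<open>Linear maps between free modules\<close>

abbreviation gen :: "'x \<Rightarrow> ('x \<Rightarrow>\<^sub>0 'k::comm_ring_1)" where
  "gen x \<equiv> Poly_Mapping.single x 1"

definition linear_map :: "(('x \<Rightarrow>\<^sub>0 'k::comm_ring_1) \<Rightarrow> ('y \<Rightarrow>\<^sub>0 'k)) \<Rightarrow> bool" where
  "linear_map f \<longleftrightarrow>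
     (\<forall>x y. f (x + y) = f x + f y) \<and> (\<forall>c x. f (pm_scale c x) = pm_scale c (f x))"

lemma pm_scale_simps [simp]:
  "pm_scale 1 x = x" "pm_scale 0 x = 0" "pm_scale c 0 = 0" "pm_scale (-1) x = - x"
  "pm_scale c (Poly_Mapping.single y b) = Poly_Mapping.single y (c * b)"
  by (auto intro!: poly_mapping_eqI simp: lookup_single when_def)

lemma single_eq_scale: "Poly_Mapping.single x c = pm_scale c (gen x)"
  by simp

lemma linear_map_add: "linear_map f \<Longrightarrow> f (x + y) = f x + f y"
  and linear_map_scale: "linear_map f \<Longrightarrow> f (pm_scale c x) = pm_scale c (f x)"
  by (auto simp: linear_map_def)

lemma linear_map_zero: "linear_map f \<Longrightarrow> f 0 = 0"
  using linear_map_scale[of f 0 0] by simp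

lemma linear_map_minus: "linear_map f \<Longrightarrow> f (- x) = - f x"
  using linear_map_scale[of f "-1" x] by simp

lemma linear_map_diff: "linear_map f \<Longrightarrow> f (x - y) = f x - f y"
  using linear_map_add[of f x "- y"] linear_map_minus[of f y] by simp

lemma linear_map_sum: "linear_map f \<Longrightarrow> f (sum g A) = (\<Sum>i\<in>A. f (g i))"
  by (induction A rule: infinite_finite_induct) (auto simp: linear_map_zero linear_map_add)

lemmas linear_map_simps =
  linear_map_add linear_map_scale linear_map_zero linear_map_minus linear_map_diff linear_map_sum

named_theorems linear_intros

lemma linear_map_basic [linear_intros]:
  "linear_map (\<lambda>x. x)" "linear_map (\<lambda>x. 0)"
  by (auto simp: linear_map_def)

lemma linear_map_plusI [linear_intros]:
  assumes "linear_map f" "linear_map g"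
  shows "linear_map (\<lambda>x. f x + g x)" "linear_map (\<lambda>x. f x - g x)" "linear_map (\<lambda>x. - f x)"
  using assms by (auto simp: linear_map_def algebra_simps free_mod.scale_right_distrib
      free_mod.scale_right_diff_distrib)

lemma linear_map_scaleI [linear_intros]:
  "linear_map f \<Longrightarrow> linear_map (\<lambda>x. pm_scale c (f x))"
  by (auto simp: linear_map_def free_mod.scale_right_distrib mult.commute)

lemma linear_map_compose: "linear_map f \<Longrightarrow> linear_map g \<Longrightarrow> linear_map (\<lambda>x. f (g x))"
  by (auto simp: linear_map_def)

lemma linear_map_sumI [linear_intros]:
  "(\<And>i. i \<in> A \<Longrightarrow> linear_map (f i)) \<Longrightarrow> linear_map (\<lambda>x. \<Sum>i\<in>A. f i x)"
  by (induction A rule: infinite_finite_induct) (auto intro: linear_intros)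

lemma lin_ext_superset:
  assumes "finite A" "Poly_Mapping.keys p \<subseteq> A"
  shows "lin_ext f p = (\<Sum>x\<in>A. pm_scale (Poly_Mapping.lookup p x) (f x))"
  unfolding lin_ext_def using assms
  by (intro sum.mono_neutral_left) (auto simp: in_keys_iff)

lemma linear_map_lin_ext [linear_intros]: "linear_map (lin_ext f)"
  unfolding linear_map_def
proof safe
  fix x y :: "'a \<Rightarrow>\<^sub>0 'b" and c
  let ?A = "Poly_Mapping.keys x \<union> Poly_Mapping.keys y"
  have "Poly_Mapping.keys (x + y) \<subseteq> ?A" by (rule keys_add)
  then show "lin_ext f (x + y) = lin_ext f x + lin_ext f y"
    by (simp add: lin_ext_superset[of ?A] lookup_add free_mod.scale_left_distrib sum.distrib)
  have "Poly_Mapping.keys (pm_scale c x) \<subseteq> Poly_Mapping.keys x" by (auto simp: in_keys_iff)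
  then show "lin_ext f (pm_scale c x) = pm_scale c (lin_ext f x)"
    by (simp add: lin_ext_superset[of "Poly_Mapping.keys x"] free_mod.scale_sum_right)
qed

lemmas linear_map_lin_extI [linear_intros] = linear_map_compose[OF linear_map_lin_ext]

lemma linear_map_if [linear_intros]:
  "linear_map f \<Longrightarrow> linear_map g \<Longrightarrow> linear_map (\<lambda>x. if b then f x else g x)"
  by (cases b) auto

lemma lin_ext_single [simp]: "lin_ext f (Poly_Mapping.single x c) = pm_scale c (f x)"
  by (cases "c = 0") (auto simp: lin_ext_def)

lemmas lin_ext_simps = linear_map_simps[OF linear_map_lin_ext]

lemma subspace_free_on: "free_mod.subspace (free_on X)"
  unfolding free_mod.subspace_def free_on_def
  by (auto simp: in_keys_iff lookup_add subset_iff) (metis add.right_neutral mult_zero_right)+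

lemma free_on_mono: "X \<subseteq> Y \<Longrightarrow> p \<in> free_on X \<Longrightarrow> p \<in> free_on Y"
  by (auto simp: free_on_def)

lemma gen_in_free_on: "x \<in> X \<Longrightarrow> Poly_Mapping.single x c \<in> free_on X"
  by (auto simp: free_on_def)

lemma poly_mapping_eq_sum:
  "p = (\<Sum>x\<in>Poly_Mapping.keys p. pm_scale (Poly_Mapping.lookup p x) (gen x))"
  by (rule poly_mapping_eqI) (auto simp: lookup_sum lookup_single when_def in_keys_iff)

text \<open>Together with \<open>linear_map_eqI\<close> and \<open>linear_map_in_subspace\<close> below this reduces statements about linear
  maps to basis elements, which is how nearly all identities of the sequel are proved.\<close>

lemma free_on_induct [consumes 1, case_names zero gen add scale]:
  assumes "p \<in> free_on X"
    and "P 0" "\<And>x. x \<in> X \<Longrightarrow> P (gen x)"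
    and "\<And>x y. P x \<Longrightarrow> P y \<Longrightarrow> P (x + y)" "\<And>c x. P x \<Longrightarrow> P (pm_scale c x)"
  shows "P p"
proof -
  have "P (\<Sum>x\<in>A. pm_scale (Poly_Mapping.lookup p x) (gen x))" if "finite A" "A \<subseteq> X" for A
    using that by (induction A) (auto intro!: assms(2-) simp del: pm_scale_simps(5))
  from this[of "Poly_Mapping.keys p"] show ?thesis
    using poly_mapping_eq_sum[of p] assms(1) by (auto simp: free_on_def)
qed

lemma free_on_UNIV [simp]: "p \<in> free_on UNIV"
  by (simp add: free_on_def)

lemma linear_map_eqI:
  assumes "linear_map f" "linear_map g" "p \<in> free_on X" "\<And>x. x \<in> X \<Longrightarrow> f (gen x) = g (gen x)"
  shows "f p = g p"
  using assms(3) by (induction rule: free_on_induct) (auto simp: assms linear_map_simps)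

lemma bilinear_map_eqI:
  assumes "\<And>y. linear_map (\<lambda>x. f x y)" "\<And>y. linear_map (\<lambda>x. g x y)"
    and "\<And>x. linear_map (f x)" "\<And>x. linear_map (g x)"
    and "p \<in> free_on X" "q \<in> free_on Y"
    and "\<And>x y. x \<in> X \<Longrightarrow> y \<in> Y \<Longrightarrow> f (gen x) (gen y) = g (gen x) (gen y)"
  shows "f p q = g p q"
proof (rule linear_map_eqI[of "\<lambda>x. f x q" "\<lambda>x. g x q", OF _ _ \<open>p \<in> free_on X\<close>])
  fix x assume "x \<in> X"
  show "f (gen x) q = g (gen x) q"
    by (rule linear_map_eqI[OF assms(3,4,6)]) (use assms(7) \<open>x \<in> X\<close> in blast)
qed (rule assms)+

lemma linear_map_in_subspace:
  assumes "linear_map f" "free_mod.subspace S" "p \<in> free_on X" "\<And>x. x \<in> X \<Longrightarrow> f (gen x) \<in> S"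
  shows "f p \<in> S"
  using assms(3) by (induction rule: free_on_induct)
    (auto simp: assms linear_map_simps free_mod.subspace_add free_mod.subspace_scale
      free_mod.subspace_0)

lemma subspace_linear_image:
  "linear_map f \<Longrightarrow> free_mod.subspace S \<Longrightarrow> free_mod.subspace (f ` S)"
  unfolding free_mod.subspace_def
  by (auto simp flip: linear_map_add linear_map_scale) (metis image_eqI linear_map_zero)

lemma subspace_linear_preimage:
  "linear_map f \<Longrightarrow> free_mod.subspace S \<Longrightarrow> free_mod.subspace {x. f x \<in> S}"
  unfolding free_mod.subspace_def by (auto simp: linear_map_simps)

lemma bilin_ext_eq_lin_ext: "bilin_ext f p q = lin_ext (\<lambda>x. lin_ext (\<lambda>y. gen (f x y)) q) p"
  unfolding bilin_ext_def lin_ext_def by (simp add: free_mod.scale_sum_right)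

lemma linear_map_lin_ext2 [linear_intros]:
  assumes "\<And>x. linear_map (f x)"
  shows "linear_map (\<lambda>q. lin_ext (\<lambda>x. f x q) p)"
  unfolding lin_ext_def by (intro linear_intros assms)

lemma linear_map_bilin_ext [linear_intros]:
  "linear_map (bilin_ext f p)" "linear_map (\<lambda>p. bilin_ext f p q)"
  unfolding bilin_ext_eq_lin_ext by (intro linear_intros)+

lemma bilin_ext_gen [simp]: "bilin_ext f (gen x) (gen y) = gen (f x y)"
  by (simp add: bilin_ext_eq_lin_ext)

section \<open>Words as a monoid\<close>

text \<open>With concatenation as addition, finitely supported functions on words carry the convolution
  product, so the free associative algebra on letters, and the cobar construction whose letters are
  the blocks, are rings.\<close>

instantiation list :: (type) monoid_add
begin
definition "zero_list = ([] :: 'a list)"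
definition "plus_list = ((@) :: 'a list \<Rightarrow> 'a list \<Rightarrow> 'a list)"
instance by standard (auto simp: zero_list_def plus_list_def)
end

lemma gen_mult [simp]:
  "Poly_Mapping.single (u :: 'a list) c * Poly_Mapping.single v d = Poly_Mapping.single (u @ v) (c * d)"
  by (simp add: mult_single plus_list_def)

lemma gen_Nil [simp]: "gen [] = 1"
  by (metis single_one zero_list_def)

lemma scale_mult: "pm_scale c x = Poly_Mapping.single [] c * x"
  unfolding pm_scale_def by (metis mult_map_scale_conv_mult zero_list_def)

lemma linear_map_mult_right: "linear_map (\<lambda>x :: 'a list \<Rightarrow>\<^sub>0 'k::comm_ring_1. x * y)"
  by (auto simp: linear_map_def scale_mult algebra_simps)

text \<open>Scalars act as multiples of the empty word; that they are central makes multiplication bilinear.\<close>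

lemma scalar_commutes:
  fixes x :: "'a list \<Rightarrow>\<^sub>0 'k::comm_ring_1"
  shows "x * Poly_Mapping.single [] c = Poly_Mapping.single [] c * x"
proof (rule linear_map_eqI[of "\<lambda>x. x * Poly_Mapping.single [] c" _ x UNIV])
  show "linear_map ((*) (Poly_Mapping.single [] c :: 'a list \<Rightarrow>\<^sub>0 'k))"
  proof -
    have "linear_map (\<lambda>x :: 'a list \<Rightarrow>\<^sub>0 'k. pm_scale c x)" by (intro linear_intros)
    then show ?thesis by (simp only: scale_mult)
  qed
qed (auto intro: linear_map_mult_right)

lemma linear_map_mult_left: "linear_map ((*) (y :: 'a list \<Rightarrow>\<^sub>0 'k::comm_ring_1))"
  unfolding linear_map_def
proof safe
  fix c x
  have "y * (Poly_Mapping.single [] c * x) = (y * Poly_Mapping.single [] c) * x"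
    by (simp add: mult.assoc)
  then show "y * pm_scale c x = pm_scale c (y * x)"
    by (simp add: scale_mult scalar_commutes mult.assoc)
qed (simp add: distrib_left)

lemma linear_map_multI [linear_intros]:
  fixes y :: "'a list \<Rightarrow>\<^sub>0 'k::comm_ring_1"
  assumes "linear_map f"
  shows "linear_map (\<lambda>x. f x * y)" "linear_map (\<lambda>x. y * f x)"
  using linear_map_compose[OF linear_map_mult_right assms]
    linear_map_compose[OF linear_map_mult_left assms] by auto

lemma scale_mult_left: "pm_scale c x * y = pm_scale c (x * y :: 'a list \<Rightarrow>\<^sub>0 'k::comm_ring_1)"
  by (simp add: scale_mult mult.assoc)

lemma scale_mult_right: "x * pm_scale c y = pm_scale c (x * y :: 'a list \<Rightarrow>\<^sub>0 'k::comm_ring_1)"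
  using linear_map_scale[OF linear_map_mult_left] .

lemma bilin_ext_append: "bilin_ext (@) p q = p * q"
  by (rule bilinear_map_eqI[of _ _ p UNIV q UNIV]) (auto intro!: linear_intros)

section \<open>The cobar differential as a derivation\<close>

text \<open>The sum of \<open>f p q\<close> over the \<open>2 ^ length l\<close> ways to distribute the letters of \<open>l\<close> over two
  words, i.e. over the terms of the unshuffle coproduct. The recursion on \<open>l\<close> makes coassociativity
  and multiplicativity of the coproduct immediate, with no condition on repeated letters.\<close>

primrec unsh_sum :: "'a list \<Rightarrow> ('a list \<Rightarrow> 'a list \<Rightarrow> 'b::comm_monoid_add) \<Rightarrow> 'b" where
  "unsh_sum [] f = f [] []"
| "unsh_sum (x # l) f = unsh_sum l (\<lambda>p q. f (x # p) q + f p (x # q))"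

lemma unsh_sum_add: "unsh_sum l (\<lambda>p q. f p q + g p q) = unsh_sum l f + unsh_sum l g"
proof (induction l arbitrary: f g)
  case (Cons x l)
  show ?case
    by (simp add: Cons.IH[symmetric] ac_simps)
qed simp

lemma linear_map_unsh_sum:
  assumes "linear_map g" shows "g (unsh_sum l f) = unsh_sum l (\<lambda>p q. g (f p q))"
  by (induction l arbitrary: f) (simp_all add: linear_map_add[OF assms])

text \<open>Together the two words have the letters of \<open>l\<close>. This information is kept, so that
  a letter that does not occur in \<open>l\<close> is known not to occur in them either.\<close>

lemma unsh_sum_cong:
  assumes "\<And>p q. mset p + mset q = mset l \<Longrightarrow> f p q = g p q"
  shows "unsh_sum l f = unsh_sum l g"
  using assms
proof (induction l arbitrary: f g)
  case (Cons x l)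
  show ?case unfolding unsh_sum.simps
    by (rule Cons.IH) (auto intro!: arg_cong2[of _ _ _ _ "(+)"] Cons.prems)
qed simp

lemma unsh_sum_in_subspace:
  assumes "free_mod.subspace S" "\<And>p q. mset p + mset q = mset l \<Longrightarrow> f p q \<in> S"
  shows "unsh_sum l f \<in> S"
  using assms(2)
proof (induction l arbitrary: f)
  case (Cons x l)
  show ?case unfolding unsh_sum.simps
    by (rule Cons.IH) (auto intro!: free_mod.subspace_add[OF assms(1)] Cons.prems)
qed simp

lemma linear_map_unsh_sumI [linear_intros]:
  "(\<And>p q. linear_map (f p q)) \<Longrightarrow> linear_map (\<lambda>x. unsh_sum l (\<lambda>p q. f p q x))"
proof (induction l arbitrary: f)
  case (Cons x l)
  show ?case unfolding unsh_sum.simps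
    by (rule Cons.IH) (intro linear_intros Cons.prems)
qed simp

lemma unsh_sum_diff:
  "unsh_sum l (\<lambda>p q. f p q - g p q) = unsh_sum l f - unsh_sum l (g :: _ \<Rightarrow> _ \<Rightarrow> 'b::ab_group_add)"
  using unsh_sum_add[of l "\<lambda>p q. f p q - g p q" g] by (simp add: algebra_simps)

text \<open>Both sides distribute the letters over three words; the recursion adds the next letter to one of the
  three, so the induction hypothesis is applied to a sum of three functions.\<close>

lemma unsh_sum_coassoc:
  "unsh_sum l (\<lambda>p q. unsh_sum p (\<lambda>p1 p2. f p1 p2 q)) =
   unsh_sum l (\<lambda>p q. unsh_sum q (\<lambda>q1 q2. f p q1 q2))"
proof (induction l arbitrary: f)
  case (Cons x l)
  from Cons.IH[of "\<lambda>p q r. f (x # p) q r + f p (x # q) r + f p q (x # r)"]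
  show ?case by (simp add: unsh_sum_add ac_simps)
qed simp

lemma unsh_sum_append:
  "unsh_sum (l @ l') f = unsh_sum l (\<lambda>p q. unsh_sum l' (\<lambda>p' q'. f (p @ p') (q @ q')))"
  by (induction l arbitrary: f) (simp_all add: unsh_sum_add)

lemma unsh_sum_map: "unsh_sum (map \<sigma> l) f = unsh_sum l (\<lambda>p q. f (map \<sigma> p) (map \<sigma> q))"
  by (induction l arbitrary: f) simp_all

lemma unsh_sum_left_Nil: "unsh_sum l (\<lambda>p q. if p = [] then g q else 0) = g l"
  by (induction l arbitrary: g) (simp_all cong: if_cong)

lemma unsh_sum_right_Nil: "unsh_sum l (\<lambda>p q. if q = [] then g p else 0) = g l"
  by (induction l arbitrary: g) (simp_all cong: if_cong)

text \<open>Without repeated letters, a distribution over two words is a choice of the set of letters of the first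
  word, the form in which restrictions of linear orders appear in the cobar construction.\<close>

lemma unsh_sum_eq_sum_Pow:
  "distinct l \<Longrightarrow>
   unsh_sum l f = (\<Sum>A\<in>Pow (set l). f (filter (\<lambda>x. x \<in> A) l) (filter (\<lambda>x. x \<in> set l - A) l))"
proof (induction l arbitrary: f)
  case (Cons x l)
  let ?F = "\<lambda>A. f (filter (\<lambda>y. y \<in> A) (x # l)) (filter (\<lambda>y. y \<in> set (x # l) - A) (x # l))"
  have "Pow (set (x # l)) = insert x ` Pow (set l) \<union> Pow (set l)"
    by (auto simp: Pow_insert)
  moreover have "insert x ` Pow (set l) \<inter> Pow (set l) = {}"
    using Cons.prems by auto
  moreover have "inj_on (insert x) (Pow (set l))"
    using Cons.prems by (auto simp: inj_on_def)
  ultimately have "(\<Sum>A\<in>Pow (set (x # l)). F A)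
      = (\<Sum>A\<in>Pow (set l). F (insert x A)) + (\<Sum>A\<in>Pow (set l). F A)" for F :: "_ \<Rightarrow> 'b"
    by (simp add: sum.union_disjoint sum.reindex)
  then have "(\<Sum>A\<in>Pow (set (x # l)). ?F A)
      = (\<Sum>A\<in>Pow (set l). ?F (insert x A)) + (\<Sum>A\<in>Pow (set l). ?F A)" .
  also have "\<dots> = (\<Sum>A\<in>Pow (set l). ?F (insert x A) + ?F A)"
    by (simp add: sum.distrib)
  also have "\<dots> = (\<Sum>A\<in>Pow (set l).
      f (x # filter (\<lambda>y. y \<in> A) l) (filter (\<lambda>y. y \<in> set l - A) l)
      + f (filter (\<lambda>y. y \<in> A) l) (x # filter (\<lambda>y. y \<in> set l - A) l))"
  proof (rule sum.cong[OF refl])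
    fix A assume "A \<in> Pow (set l)"
    then have "x \<notin> A" "x \<notin> set l" using Cons.prems by auto
    then have "filter (\<lambda>y. y \<in> insert x A) l = filter (\<lambda>y. y \<in> A) l"
      "filter (\<lambda>y. y \<in> set (x # l) - insert x A) l = filter (\<lambda>y. y \<in> set l - A) l"
      "filter (\<lambda>y. y \<in> set (x # l) - A) l = filter (\<lambda>y. y \<in> set l - A) l"
      by (auto intro!: filter_cong)
    with \<open>x \<notin> A\<close> show "?F (insert x A) + ?F A = f (x # filter (\<lambda>y. y \<in> A) l) (filter (\<lambda>y. y \<in> set l - A) l)
      + f (filter (\<lambda>y. y \<in> A) l) (x # filter (\<lambda>y. y \<in> set l - A) l)"
      by simp
  qed
  also have "\<dots> = unsh_sum (x # l) f"
    using Cons by simp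
  finally show ?case by simp
qed simp

text \<open>The reduced coproduct. The trivial terms are subtracted instead of excluded, so that the identities
  below hold for all words, including the empty one.\<close>

definition red_coprod :: "'a list \<Rightarrow> ('a list list \<Rightarrow>\<^sub>0 'k::comm_ring_1)" where
  "red_coprod l = unsh_sum l (\<lambda>p q. gen [p, q]) - gen [l, []] - gen [[], l]"

primrec word_diff :: "'a list list \<Rightarrow> ('a list list \<Rightarrow>\<^sub>0 'k::comm_ring_1)" where
  "word_diff [] = 0"
| "word_diff (l # w) = - red_coprod l * gen w - gen [l] * word_diff w"

definition cdiff :: "('a list list \<Rightarrow>\<^sub>0 'k::comm_ring_1) \<Rightarrow> ('a list list \<Rightarrow>\<^sub>0 'k)" where
  "cdiff = lin_ext word_diff"

definition sign_twist :: "('x list \<Rightarrow>\<^sub>0 'k::comm_ring_1) \<Rightarrow> ('x list \<Rightarrow>\<^sub>0 'k)" where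
  "sign_twist = lin_ext (\<lambda>w. Poly_Mapping.single w ((- 1) ^ length w))"

lemma linear_map_cdiff: "linear_map cdiff"
  and linear_map_sign_twist: "linear_map sign_twist"
  unfolding cdiff_def sign_twist_def by (rule linear_map_lin_ext)+

lemmas linear_map_cdiffI [linear_intros] = linear_map_compose[OF linear_map_cdiff]
lemmas linear_map_sign_twistI [linear_intros] = linear_map_compose[OF linear_map_sign_twist]
lemmas cdiff_simps = linear_map_simps[OF linear_map_cdiff]
lemmas sign_twist_simps = linear_map_simps[OF linear_map_sign_twist]

lemma cdiff_single [simp]: "cdiff (Poly_Mapping.single w c) = pm_scale c (word_diff w)"
  by (simp add: cdiff_def)

lemma cdiff_one [simp]: "cdiff 1 = 0"
  using cdiff_single[of "[]" 1] by (simp only: pm_scale_simps word_diff.simps gen_Nil)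

lemma sign_twist_single [simp]:
  "sign_twist (Poly_Mapping.single w c) = Poly_Mapping.single w ((- 1) ^ length w * c)"
  by (simp add: sign_twist_def mult.commute)

lemma sign_twist_one [simp]: "sign_twist (1 :: 'x list \<Rightarrow>\<^sub>0 'k::comm_ring_1) = 1"
  using sign_twist_single[of "[]" "1 :: 'k"] by simp

lemma sign_twist_mult: "sign_twist (x * y) = sign_twist x * sign_twist y"
  by (rule bilinear_map_eqI[of _ _ x UNIV y UNIV])
     (auto intro!: linear_intros simp: power_add ac_simps)

lemma sign_twist_sign_twist [simp]: "sign_twist (sign_twist x) = x"
  by (rule linear_map_eqI[of _ _ x UNIV])
     (auto intro!: linear_intros simp flip: power_add)

lemma sign_twist_red_coprod [simp]: "sign_twist (red_coprod l) = red_coprod l"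
  by (simp add: red_coprod_def sign_twist_simps linear_map_unsh_sum[OF linear_map_sign_twist])

text \<open>Signs \<open>(- 1) ^ i\<close> in the differential of a word amount to the Leibniz rule for letters of
  degree 1.\<close>

lemma cdiff_mult: "cdiff (x * y) = cdiff x * y + sign_twist x * cdiff y"
proof (rule bilinear_map_eqI[of "\<lambda>x y. cdiff (x * y)" "\<lambda>x y. cdiff x * y + sign_twist x * cdiff y" x UNIV y UNIV])
  fix u v :: "'a list list"
  show "cdiff (gen u * gen v) = cdiff (gen u) * gen v + sign_twist (gen u :: _ \<Rightarrow>\<^sub>0 'b) * cdiff (gen v)"
  proof (induction u)
    case (Cons l u)
    have "gen (l # u) = (gen [l] * gen u :: _ \<Rightarrow>\<^sub>0 'b)" by simp
    then have s: "sign_twist (gen (l # u) :: _ \<Rightarrow>\<^sub>0 'b) = - gen [l] * sign_twist (gen u)"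
      by (simp only: sign_twist_mult sign_twist_single) (simp add: single_uminus)
    have a: "red_coprod l * gen (u @ v) = (red_coprod l * gen u * gen v :: _ \<Rightarrow>\<^sub>0 'b)"
      by (simp add: mult.assoc)
    have IH: "word_diff (u @ v)
        = word_diff u * gen v + sign_twist (gen u) * (word_diff v :: _ \<Rightarrow>\<^sub>0 'b)"
      using Cons.IH by (simp del: sign_twist_single)
    have "cdiff (gen (l # u) * gen v :: _ \<Rightarrow>\<^sub>0 'b)
        = - (red_coprod l * gen (u @ v)) - gen [l] * word_diff (u @ v)"
      by simp
    also have "\<dots> = (- red_coprod l * gen u - gen [l] * word_diff u) * gen v
        + (- gen [l] * sign_twist (gen u)) * word_diff v"
      unfolding a IH by (simp add: algebra_simps del: gen_mult)
    also have "\<dots> = cdiff (gen (l # u)) * gen v + sign_twist (gen (l # u)) * cdiff (gen v)"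
      unfolding s by simp
    finally show ?case .
  qed (use gen_Nil in simp)
qed (auto intro!: linear_intros)

lemma sign_twist_cdiff: "sign_twist (cdiff x) = - cdiff (sign_twist x)"
proof (rule linear_map_eqI[of "\<lambda>x. sign_twist (cdiff x)" _ x UNIV])
  fix w :: "'a list list"
  have "sign_twist (word_diff w :: _ \<Rightarrow>\<^sub>0 'b) = - pm_scale ((- 1) ^ length w) (word_diff w)"
  proof (induction w)
    case (Cons l w)
    then show ?case
      by (simp add: sign_twist_simps sign_twist_mult scale_mult_right free_mod.scale_right_diff_distrib
          single_uminus single_eq_scale[of _ "(- 1) ^ length w"] single_eq_scale[of _ "- ((- 1) ^ length w)"]
          del: pm_scale_simps(5))
  qed (simp add: sign_twist_simps)
  then show "sign_twist (cdiff (gen w)) = - cdiff (sign_twist (gen w :: _ \<Rightarrow>\<^sub>0 'b))"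
    by simp
qed (auto intro!: linear_intros)

text \<open>Coassociativity: the terms with three nontrivial factors cancel by \<open>unsh_sum_coassoc\<close>, and the
  subtracted trivial terms cancel in pairs.\<close>

lemma cdiff_red_coprod:
  fixes l :: "'a list" shows "cdiff (red_coprod l :: _ \<Rightarrow>\<^sub>0 'b::comm_ring_1) = 0"
proof -
  have 1: "(word_diff [p, q] :: _ \<Rightarrow>\<^sub>0 'b) = - (red_coprod p * gen [q]) + gen [p] * red_coprod q" for p q :: "'a list"
    by simp
  let ?L = "\<lambda>p q. unsh_sum p (\<lambda>p1 p2. gen [p1, p2, q]) :: _ \<Rightarrow>\<^sub>0 'b"
  let ?R = "\<lambda>p q. unsh_sum q (\<lambda>q1 q2. gen [p, q1, q2]) :: _ \<Rightarrow>\<^sub>0 'b"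
  have 2: "red_coprod p * gen [q] = ?L p q - gen [p, [], q] - gen [[], p, q]" for p q :: "'a list"
    by (simp add: red_coprod_def linear_map_unsh_sum[OF linear_map_mult_right] algebra_simps)
  have 3: "gen [p] * red_coprod q = ?R p q - gen [p, q, []] - gen [p, [], q]" for p q :: "'a list"
    by (simp add: red_coprod_def linear_map_unsh_sum[OF linear_map_mult_left] algebra_simps)
  have 4: "(word_diff [p, q] :: _ \<Rightarrow>\<^sub>0 'b) = ?R p q - ?L p q + gen [[], p, q] - gen [p, q, []]" for p q :: "'a list"
    unfolding 1 2 3 by (simp add: algebra_simps)
  have "cdiff (red_coprod l :: _ \<Rightarrow>\<^sub>0 'b) = unsh_sum l (\<lambda>p q. word_diff [p, q]) - word_diff [l, []] - word_diff [[], l]"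
    by (simp add: red_coprod_def cdiff_simps linear_map_unsh_sum[OF linear_map_cdiff] del: word_diff.simps)
  also have "\<dots> = 0"
    unfolding 4 by (simp add: unsh_sum_add unsh_sum_diff unsh_sum_coassoc)
  finally show ?thesis .
qed

text \<open>By the Leibniz rule the square of the differential is again a derivation, so it suffices that it
  vanishes on a single block.\<close>

lemma cdiff_cdiff: "cdiff (cdiff x) = 0"
proof (rule linear_map_eqI[of "\<lambda>x. cdiff (cdiff x)" "\<lambda>x. 0" x UNIV])
  fix w :: "'a list list"
  show "cdiff (cdiff (gen w)) = (0 :: _ \<Rightarrow>\<^sub>0 'b)"
  proof (induction w)
    case (Cons l w)
    have "sign_twist (gen [l] :: _ \<Rightarrow>\<^sub>0 'b) = - gen [l]" by (simp add: single_uminus)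
    with Cons show ?case
      by (simp add: cdiff_simps cdiff_mult cdiff_red_coprod mult.assoc)
  qed (simp add: cdiff_simps)
qed (auto intro!: linear_intros)

definition relabel :: "('a \<Rightarrow> 'b) \<Rightarrow> ('a list list \<Rightarrow>\<^sub>0 'k::comm_ring_1) \<Rightarrow> ('b list list \<Rightarrow>\<^sub>0 'k)" where
  "relabel \<sigma> = lin_ext (\<lambda>w. gen (map (map \<sigma>) w))"

lemma linear_map_relabel: "linear_map (relabel \<sigma>)"
  unfolding relabel_def by (rule linear_map_lin_ext)

lemmas linear_map_relabelI [linear_intros] = linear_map_compose[OF linear_map_relabel]
lemmas relabel_simps = linear_map_simps[OF linear_map_relabel]

lemma relabel_single [simp]: "relabel \<sigma> (Poly_Mapping.single w c) = Poly_Mapping.single (map (map \<sigma>) w) c"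
  by (simp add: relabel_def)

lemma relabel_one [simp]: "relabel \<sigma> 1 = (1 :: 'b list list \<Rightarrow>\<^sub>0 'k::comm_ring_1)"
  using relabel_single[of \<sigma> "[]" "1 :: 'k"] by simp

lemma relabel_mult: "relabel \<sigma> (x * y) = relabel \<sigma> x * relabel \<sigma> y"
  by (rule bilinear_map_eqI[of _ _ x UNIV y UNIV]) (auto intro!: linear_intros)

lemma relabel_red_coprod: "relabel \<sigma> (red_coprod l) = red_coprod (map \<sigma> l)"
  by (simp add: red_coprod_def relabel_simps linear_map_unsh_sum[OF linear_map_relabel] unsh_sum_map)

lemma cdiff_relabel:
  fixes x :: "'a list list \<Rightarrow>\<^sub>0 'k::comm_ring_1" and \<sigma> :: "'a \<Rightarrow> 'b"
  shows "cdiff (relabel \<sigma> x) = relabel \<sigma> (cdiff x)"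
proof (rule linear_map_eqI[of "\<lambda>x. cdiff (relabel \<sigma> x)" _ x UNIV])
  fix w :: "'a list list"
  show "cdiff (relabel \<sigma> (gen w)) = relabel \<sigma> (cdiff (gen w :: _ \<Rightarrow>\<^sub>0 'k))"
    by (induction w) (simp_all add: relabel_simps relabel_mult relabel_red_coprod cdiff_simps)
qed (auto intro!: linear_intros)

subsection \<open>Comparison with the cobar construction\<close>

text \<open>The blocks form a composition exactly if they are nonempty and have no letter in common. This form of
  the condition is stable under cutting and concatenating words.\<close>

lemma cobar_words_iff:
  "w \<in> cobar_words n I \<longleftrightarrow>
   int (length w) = n \<and> [] \<notin> set w \<and> distinct (concat w) \<and> set (concat w) = I"
proof
  assume "w \<in> cobar_words n I"
  then obtain Fs where n: "int (length w) = n" and Fs: "distinct Fs" "partition_on I (set Fs)"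
    and w: "list_all2 (\<lambda>l F. l \<in> permutations_of_set F) w Fs"
    by (auto simp: cobar_words_def compositions_def)
  have Fs_eq: "Fs = map set w" and dist: "\<And>l. l \<in> set w \<Longrightarrow> distinct l"
    using w by (induction rule: list_all2_induct) (auto simp: permutations_of_set_def)
  have ne: "[] \<notin> set w" using Fs(2) unfolding Fs_eq partition_on_def by force
  have disj: "pairwise disjnt (set (map set w))"
    using Fs(2) unfolding Fs_eq partition_on_def disjoint_def pairwise_def disjnt_def by auto
  have "distinct (concat w)"
    using ne dist disj Fs(1)[unfolded Fs_eq]
  proof (induction w)
    case (Cons l w)
    have "disjnt (set l) (set l')" if "l' \<in> set w" for l'
      using Cons.prems(3,4) that by (auto simp: pairwise_def)
    then have "set l \<inter> set (concat w) = {}" by (auto simp: disjnt_def)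
    moreover have "distinct (concat w)"
      using Cons by (auto simp: pairwise_insert)
    ultimately show ?case using Cons.prems(2) by auto
  qed simp
  moreover have "set (concat w) = I"
    using Fs(2) unfolding Fs_eq partition_on_def by auto
  ultimately show "int (length w) = n \<and> [] \<notin> set w \<and> distinct (concat w) \<and> set (concat w) = I"
    using n ne by blast
next
  assume *: "int (length w) = n \<and> [] \<notin> set w \<and> distinct (concat w) \<and> set (concat w) = I"
  then have ne: "[] \<notin> set w" and d: "distinct (concat w)" by auto
  have "distinct (map set w) \<and> disjoint (set (map set w))"
    using ne d
  proof (induction w)
    case (Cons l w)
    have "set l \<inter> set l' = {}" "set l \<noteq> set l'" if "l' \<in> set w" for l'
      using Cons.prems that by (cases l, auto)+
    with Cons show ?case by (auto simp: disjoint_def)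
  qed (auto simp: disjoint_def)
  moreover have "{} \<notin> set (map set w)" using ne by auto
  ultimately have "map set w \<in> compositions I"
    using * by (auto simp: compositions_def partition_on_def)
  moreover have "list_all2 (\<lambda>l F. l \<in> permutations_of_set F) w (map set w)"
    using d by (auto simp: list_all2_map2 list_all2_same permutations_of_set_def distinct_concat_iff)
  ultimately show "w \<in> cobar_words n I"
    using * unfolding cobar_words_def by blast
qed

lemma subspace_cobar: "free_mod.subspace (cobar n I)"
  unfolding cobar_def by (rule subspace_free_on)

text \<open>The complementary pairs with an empty member account for exactly the two subtracted terms.\<close>

lemma red_coprod_eq_sum:
  assumes "distinct l" "l \<noteq> []"
  shows "red_coprod l = (\<Sum>(A, B) \<in> {(A, B). A \<noteq> {} \<and> B \<noteq> {} \<and> A \<inter> B = {} \<and> A \<union> B = set l}.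
        gen [filter (\<lambda>x. x \<in> A) l, filter (\<lambda>x. x \<in> B) l])"
proof -
  let ?f = "\<lambda>A. gen [filter (\<lambda>x. x \<in> A) l, filter (\<lambda>x. x \<in> set l - A) l] :: _ \<Rightarrow>\<^sub>0 'b"
  have "filter (\<lambda>x. x \<in> set l) l = l" "filter (\<lambda>x. x \<in> {}) l = []" by simp_all
  then have "(\<Sum>A\<in>Pow (set l). ?f A) = ?f (set l) + (?f {} + (\<Sum>A\<in>Pow (set l) - {set l} - {{}}. ?f A))"
    using assms by (subst sum.remove[of _ "set l"], simp, simp, subst sum.remove[of _ "{}"]) auto
  then have "red_coprod l = (\<Sum>A\<in>Pow (set l) - {set l} - {{}}. ?f A)"
    using assms unfolding red_coprod_def by (simp add: unsh_sum_eq_sum_Pow)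
  also have "\<dots> = (\<Sum>(A, B) \<in> {(A, B). A \<noteq> {} \<and> B \<noteq> {} \<and> A \<inter> B = {} \<and> A \<union> B = set l}.
        gen [filter (\<lambda>x. x \<in> A) l, filter (\<lambda>x. x \<in> B) l])"
    by (rule sum.reindex_bij_witness[of _ fst "\<lambda>A. (A, set l - A)"])
       (auto intro!: filter_cong arg_cong[of _ _ gen], blast+)
  finally show ?thesis .
qed

lemma word_diff_eq:
  assumes "distinct (concat w)" "[] \<notin> set w"
  shows "(word_diff w :: _ \<Rightarrow>\<^sub>0 'k::comm_ring_1) = (\<Sum>i = 1..length w. pm_scale ((- 1) ^ i) (cobar_face i w))"
  using assms
proof (induction w)
  case (Cons l w)
  have 1: "(cobar_face (Suc 0) (l # w) :: _ \<Rightarrow>\<^sub>0 'k) = red_coprod l * gen w"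
    using red_coprod_eq_sum[of l, where ?'b = 'k] Cons.prems
    by (auto simp: cobar_face_def sum_distrib_right case_prod_unfold)
  have 2: "(cobar_face (Suc i) (l # w) :: _ \<Rightarrow>\<^sub>0 'k) = gen [l] * cobar_face i w" if "Suc 0 \<le> i" for i
  proof -
    from that obtain j where "i = Suc j" by (cases i) auto
    then show ?thesis
      by (simp add: cobar_face_def sum_distrib_left case_prod_unfold)
  qed
  have "(\<Sum>i = 1..length (l # w). pm_scale ((- 1) ^ i) (cobar_face i (l # w)) :: _ \<Rightarrow>\<^sub>0 'k)
      = - cobar_face (Suc 0) (l # w) + (\<Sum>i = 1..length w. pm_scale ((- 1) ^ Suc i) (cobar_face (Suc i) (l # w)))"
    by (simp add: sum.atLeast_Suc_atMost sum.shift_bounds_cl_Suc_ivl del: sum.cl_ivl_Suc)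
  also have "(\<Sum>i = 1..length w. pm_scale ((- 1) ^ Suc i) (cobar_face (Suc i) (l # w)) :: _ \<Rightarrow>\<^sub>0 'k)
      = (\<Sum>i = 1..length w. - (gen [l] * pm_scale ((- 1) ^ i) (cobar_face i w)))"
    by (intro sum.cong refl) (auto simp: 2 scale_mult_right)
  also have "- cobar_face (Suc 0) (l # w) + \<dots> = word_diff (l # w)"
    using Cons by (simp add: 1 sum_negf sum_distrib_left)
  finally show ?case ..
qed simp

lemma cobar_diff_eq: "x \<in> cobar n I \<Longrightarrow> cobar_diff x = cdiff x"
  unfolding cobar_def
proof (rule linear_map_eqI[of cobar_diff cdiff])
  fix w assume "w \<in> cobar_words n I"
  then show "cobar_diff (gen w) = cdiff (gen w :: _ \<Rightarrow>\<^sub>0 'b)"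
    by (simp add: cobar_words_iff cobar_diff_def word_diff_eq)
qed (auto intro: linear_map_cdiff simp: cobar_diff_def linear_map_lin_ext)

lemma cobar_mult:
  assumes "x \<in> cobar m A" "y \<in> cobar n B" "A \<inter> B = {}"
  shows "x * y \<in> cobar (m + n) (A \<union> B)"
proof -
  have *: "gen u * y \<in> cobar (m + n) (A \<union> B)" if "u \<in> cobar_words m A" for u
    by (rule linear_map_in_subspace[OF _ subspace_cobar assms(2)[unfolded cobar_def]])
       (use that assms(3) in \<open>auto intro!: linear_intros gen_in_free_on simp: cobar_def cobar_words_iff\<close>)
  show ?thesis
    by (rule linear_map_in_subspace[OF _ subspace_cobar assms(1)[unfolded cobar_def]])
       (auto intro!: linear_intros *)
qed

lemma cobar_gen: "w \<in> cobar_words n I \<Longrightarrow> gen w \<in> cobar n I"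
  by (simp add: cobar_def gen_in_free_on)

lemma sign_twist_cobar: "x \<in> cobar n I \<Longrightarrow> sign_twist x \<in> cobar n I"
  by (rule linear_map_in_subspace[OF linear_map_sign_twist subspace_cobar, where X = "cobar_words n I"])
     (auto simp: cobar_def gen_in_free_on)

lemma red_coprod_cobar:
  assumes "distinct l" "l \<noteq> []" shows "red_coprod l \<in> cobar 2 (set l)"
  unfolding red_coprod_eq_sum[OF assms]
proof (intro free_mod.subspace_sum[OF subspace_cobar], clarify)
  fix A B assume *: "A \<noteq> {}" "B \<noteq> {}" "A \<inter> B = {}" "A \<union> B = set l"
  then have "A \<inter> set l \<noteq> {}" "B \<inter> set l \<noteq> {}" by auto
  then have "filter (\<lambda>x. x \<in> A) l \<noteq> []" "filter (\<lambda>x. x \<in> B) l \<noteq> []"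
    by (auto simp: filter_empty_conv)
  with * assms show "gen [filter (\<lambda>x. x \<in> A) l, filter (\<lambda>x. x \<in> B) l] \<in> cobar 2 (set l)"
    by (intro cobar_gen) (auto simp: cobar_words_iff)
qed

lemma word_diff_cobar:
  assumes "[] \<notin> set w" "distinct (concat w)"
  shows "(word_diff w :: _ \<Rightarrow>\<^sub>0 'k::comm_ring_1) \<in> cobar (int (length w) + 1) (set (concat w))"
  using assms
proof (induction w)
  case (Cons l w)
  have d: "set l \<inter> set (concat w) = {}" "distinct l" "l \<noteq> []" using Cons.prems by auto
  have w: "(gen w :: _ \<Rightarrow>\<^sub>0 'k) \<in> cobar (int (length w)) (set (concat w))"
    using Cons.prems by (intro cobar_gen) (simp add: cobar_words_iff)
  have l: "(gen [l] :: _ \<Rightarrow>\<^sub>0 'k) \<in> cobar 1 (set l)"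
    using d by (intro cobar_gen) (simp add: cobar_words_iff)
  have "red_coprod l * (gen w :: _ \<Rightarrow>\<^sub>0 'k)
      \<in> cobar (2 + int (length w)) (set l \<union> set (concat w))"
    by (intro cobar_mult red_coprod_cobar d w)
  moreover have "gen [l] * (word_diff w :: _ \<Rightarrow>\<^sub>0 'k)
      \<in> cobar (1 + (int (length w) + 1)) (set l \<union> set (concat w))"
    by (intro cobar_mult l d Cons.IH) (use Cons.prems in auto)
  ultimately have "- (red_coprod l * gen w) - gen [l] * (word_diff w :: _ \<Rightarrow>\<^sub>0 'k)
      \<in> cobar (2 + int (length w)) (set l \<union> set (concat w))"
    by (intro free_mod.subspace_diff free_mod.subspace_neg subspace_cobar) (simp_all add: add.assoc)
  then show ?case by (simp add: add.commute)
qed (simp add: free_mod.subspace_0[OF subspace_cobar])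

lemma cdiff_cobar:
  assumes "x \<in> cobar n I" shows "cdiff x \<in> cobar (n + 1) I"
  using assms unfolding cobar_def[of n]
  by (rule linear_map_in_subspace[OF linear_map_cdiff subspace_cobar])
     (use word_diff_cobar in \<open>auto simp: cobar_words_iff\<close>)

definition boundaries :: "int \<Rightarrow> 'a set \<Rightarrow> ('a list list \<Rightarrow>\<^sub>0 'k::comm_ring_1) set" where
  "boundaries n I = cdiff ` cobar (n - 1) I"

lemma cobar_coboundaries_eq: "cobar_coboundaries n I = boundaries n I"
  unfolding cobar_coboundaries_def boundaries_def by (intro image_cong refl cobar_diff_eq)

lemma cobar_cocycles_eq: "cobar_cocycles n I = {x \<in> cobar n I. cdiff x = 0}"
  unfolding cobar_cocycles_def by (auto simp: cobar_diff_eq)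

section \<open>Primitive elements\<close>

text \<open>The embedding of the free associative algebra as the degree 1 part of the cobar construction.\<close>

definition block :: "('a list \<Rightarrow>\<^sub>0 'k::comm_ring_1) \<Rightarrow> ('a list list \<Rightarrow>\<^sub>0 'k)" where
  "block = lin_ext (\<lambda>l. gen [l])"

lemma linear_map_block: "linear_map block"
  unfolding block_def by (rule linear_map_lin_ext)

lemmas linear_map_blockI [linear_intros] = linear_map_compose[OF linear_map_block]
lemmas block_simps = linear_map_simps[OF linear_map_block]

lemma block_single [simp]: "block (Poly_Mapping.single l c) = Poly_Mapping.single [l] c"
  by (simp add: block_def)

lemma block_one [simp]: "block (1 :: 'a list \<Rightarrow>\<^sub>0 'k::comm_ring_1) = gen [[]]"
  using block_single[of "[]" "1::'k"] by simp

lemma sign_twist_block [simp]: "sign_twist (block x) = - block x"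
  by (rule linear_map_eqI[of _ _ x UNIV]) (auto intro!: linear_intros simp: single_uminus)

text \<open>The linear function \<open>f\<close> on tensors, given on pairs of words, evaluated at the coproduct of an element.\<close>

definition coprod_sum ::
  "('a list \<Rightarrow> 'a list \<Rightarrow> ('y \<Rightarrow>\<^sub>0 'k)) \<Rightarrow> ('a list \<Rightarrow>\<^sub>0 'k::comm_ring_1) \<Rightarrow> ('y \<Rightarrow>\<^sub>0 'k)" where
  "coprod_sum f = lin_ext (\<lambda>l. unsh_sum l f)"

lemma linear_map_coprod_sum: "linear_map (coprod_sum f)"
  unfolding coprod_sum_def by (rule linear_map_lin_ext)

lemmas linear_map_coprod_sumI [linear_intros] = linear_map_compose[OF linear_map_coprod_sum]

lemma linear_map_coprod_sum2 [linear_intros]: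
  "(\<And>p q. linear_map (f p q)) \<Longrightarrow> linear_map (\<lambda>y. coprod_sum (\<lambda>p q. f p q y) x)"
  unfolding coprod_sum_def by (intro linear_intros)

lemma coprod_sum_single [simp]:
  "coprod_sum f (Poly_Mapping.single l c) = pm_scale c (unsh_sum l f)"
  by (simp add: coprod_sum_def)

text \<open>The unshuffle coproduct is multiplicative.\<close>

lemma coprod_sum_mult:
  "coprod_sum f (x * y) = coprod_sum (\<lambda>p q. coprod_sum (\<lambda>p' q'. f (p @ p') (q @ q')) y) x"
  by (rule bilinear_map_eqI[of _ _ x UNIV y UNIV]) (auto intro!: linear_intros simp: unsh_sum_append)

lemma cdiff_block:
  "cdiff (block x) = block x * gen [[]] + gen [[]] * block x - coprod_sum (\<lambda>p q. gen [p, q]) x"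
  by (rule linear_map_eqI[of _ _ x UNIV]) (auto intro!: linear_intros simp: red_coprod_def)

text \<open>An element is primitive if its coproduct is \<open>x \<otimes> 1 + 1 \<otimes> x\<close>. Here this is expressed
  through all linear functions on tensors, so that the tensor square needs no model of its own.\<close>

definition primitive :: "('a list \<Rightarrow>\<^sub>0 'k::comm_ring_1) \<Rightarrow> bool" where
  "primitive x \<longleftrightarrow> (\<forall>f :: 'a list \<Rightarrow> 'a list \<Rightarrow> ('a list list \<Rightarrow>\<^sub>0 'k).
     coprod_sum f x = lin_ext (\<lambda>l. f l [] + f [] l) x)"

lemma primitiveD:
  fixes f :: "'a list \<Rightarrow> 'a list \<Rightarrow> ('a list list \<Rightarrow>\<^sub>0 'k::comm_ring_1)"
  shows "primitive x \<Longrightarrow> coprod_sum f x = lin_ext (\<lambda>l. f l [] + f [] l) x"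
  by (simp add: primitive_def)

lemma subspace_primitive: "free_mod.subspace (Collect primitive)"
  unfolding free_mod.subspace_def primitive_def
  by (simp add: linear_map_simps[OF linear_map_coprod_sum] lin_ext_simps)

lemma primitive_letter: "primitive (gen [a])"
  by (simp add: primitive_def algebra_simps)

lemma coprod_sum_primitive_mult:
  fixes f :: "'a list \<Rightarrow> 'a list \<Rightarrow> ('a list list \<Rightarrow>\<^sub>0 'k::comm_ring_1)"
  assumes "primitive x"
  shows "coprod_sum f (x * y) =
    lin_ext (\<lambda>l. coprod_sum (\<lambda>p q. f (l @ p) q) y + coprod_sum (\<lambda>p q. f p (l @ q)) y) x"
  by (simp add: coprod_sum_mult primitiveD[OF assms])

lemma lin_ext_plus: "lin_ext (\<lambda>x. f x + g x) p = lin_ext f p + lin_ext g p"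
  by (simp add: lin_ext_def free_mod.scale_right_distrib sum.distrib)

lemma lin_ext_swap: "lin_ext (\<lambda>x. lin_ext (\<lambda>y. f x y) q) p = lin_ext (\<lambda>y. lin_ext (\<lambda>x. f x y) p) q"
  by (rule bilinear_map_eqI[of _ _ p UNIV q UNIV]) (auto intro!: linear_intros)

lemma lin_ext_mult: "lin_ext f (x * y) = lin_ext (\<lambda>l. lin_ext (\<lambda>l'. f (l @ l')) y) x"
  by (rule bilinear_map_eqI[of _ _ x UNIV y UNIV]) (auto intro!: linear_intros linear_map_compose[OF linear_map_lin_ext])

text \<open>The coproduct of \<open>xy\<close> is \<open>xy \<otimes> 1 + 1 \<otimes> xy + x \<otimes> y + y \<otimes> x\<close>. The last two terms are symmetric in
  \<open>x\<close> and \<open>y\<close>, so they disappear in the commutator.\<close>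

lemma coprod_sum_primitive_mult2:
  fixes f :: "'a list \<Rightarrow> 'a list \<Rightarrow> ('a list list \<Rightarrow>\<^sub>0 'k::comm_ring_1)"
  assumes "primitive x" "primitive y"
  shows "coprod_sum f (x * y) = lin_ext (\<lambda>l. f l [] + f [] l) (x * y)
    + (lin_ext (\<lambda>l. lin_ext (\<lambda>l'. f l l') y) x + lin_ext (\<lambda>l. lin_ext (\<lambda>l'. f l l') x) y)"
  unfolding coprod_sum_primitive_mult[OF assms(1)] primitiveD[OF assms(2)]
  by (simp add: lin_ext_mult lin_ext_plus lin_ext_swap[of _ y x] algebra_simps)

lemma primitive_commutator:
  assumes "primitive x" "primitive y" shows "primitive (x * y - y * x)"
  using coprod_sum_primitive_mult2[OF assms] coprod_sum_primitive_mult2[OF assms(2,1)]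
  by (simp add: primitive_def linear_map_simps[OF linear_map_coprod_sum] lin_ext_simps)

lemma block_mult_eq: "lin_ext (\<lambda>l. lin_ext (\<lambda>l'. gen [l, l']) y) x = block x * block y"
  by (rule bilinear_map_eqI[of _ _ x UNIV y UNIV]) (auto intro!: linear_intros)

lemma block_pad_eq: "lin_ext (\<lambda>l. gen [l, []] + gen [[], l]) x = block x * gen [[]] + gen [[]] * block x"
  by (rule linear_map_eqI[of _ _ x UNIV]) (auto intro!: linear_intros)

lemma cdiff_block_primitive: "primitive x \<Longrightarrow> cdiff (block x) = 0"
  by (simp add: cdiff_block primitiveD block_pad_eq)

text \<open>Only the two mixed terms of the coproduct of \<open>xy\<close> survive in the reduced coproduct. This makes the
  cohomology classes of primitive elements anticommute.\<close>

lemma cdiff_block_mult_primitive: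
  assumes "primitive x" "primitive y"
  shows "cdiff (block (x * y)) = - (block x * block y + block y * block x)"
  by (simp add: cdiff_block coprod_sum_primitive_mult2[OF assms] block_pad_eq block_mult_eq)

subsection \<open>Lie polynomials\<close>

primrec magma_poly :: "'a magma \<Rightarrow> ('a list \<Rightarrow>\<^sub>0 'k::comm_ring_1)" where
  "magma_poly (Gen a) = gen [a]"
| "magma_poly (Br s t) = magma_poly s * magma_poly t - magma_poly t * magma_poly s"

definition lie_poly :: "('a magma \<Rightarrow>\<^sub>0 'k::comm_ring_1) \<Rightarrow> ('a list \<Rightarrow>\<^sub>0 'k)" where
  "lie_poly = lin_ext magma_poly"

lemma linear_map_lie_poly: "linear_map lie_poly"
  unfolding lie_poly_def by (rule linear_map_lin_ext)

lemmas linear_map_lie_polyI [linear_intros] = linear_map_compose[OF linear_map_lie_poly]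
lemmas lie_poly_simps = linear_map_simps[OF linear_map_lie_poly]

lemma lie_poly_single [simp]: "lie_poly (Poly_Mapping.single t c) = pm_scale c (magma_poly t)"
  by (simp add: lie_poly_def)

lemma lie_poly_bracket:
  "lie_poly (bracket p q) = lie_poly p * lie_poly q - lie_poly q * lie_poly p"
  by (rule bilinear_map_eqI[of "\<lambda>p q. lie_poly (bracket p q)" _ p UNIV q UNIV])
     (auto intro!: linear_intros)

text \<open>Commutators in an associative algebra satisfy the laws of a Lie algebra. This holds on the whole ideal,
  which contains elements that are not multilinear, so \<open>lie_poly\<close> may be evaluated on any representative
  of a class.\<close>

lemma lie_poly_lie_ideal: "x \<in> lie_ideal I \<Longrightarrow> lie_poly x = 0"
  by (induction rule: lie_ideal.induct) (simp_all add: lie_poly_simps lie_poly_bracket algebra_simps)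

lemma primitive_lie_poly: "primitive (lie_poly p)"
proof -
  have *: "primitive (magma_poly t :: _ \<Rightarrow>\<^sub>0 'b)" for t :: "'a magma"
    by (induction t) (auto intro: primitive_letter primitive_commutator)
  have "lie_poly p \<in> Collect primitive"
    by (rule linear_map_in_subspace[OF linear_map_lie_poly subspace_primitive, of _ UNIV])
       (auto simp: *)
  then show ?thesis by simp
qed

definition lin_orders :: "'a set \<Rightarrow> ('a list \<Rightarrow>\<^sub>0 'k::comm_ring_1) set" where
  "lin_orders I = free_on (permutations_of_set I)"

lemma subspace_lin_orders: "free_mod.subspace (lin_orders I)"
  unfolding lin_orders_def by (rule subspace_free_on)

lemma lin_orders_mult:
  assumes "x \<in> lin_orders A" "y \<in> lin_orders B" "A \<inter> B = {}"
  shows "x * y \<in> lin_orders (A \<union> B)"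
proof -
  have *: "gen u * y \<in> lin_orders (A \<union> B)" if "u \<in> permutations_of_set A" for u
    by (rule linear_map_in_subspace[OF _ subspace_lin_orders assms(2)[unfolded lin_orders_def]])
       (use that assms(3) in \<open>auto intro!: linear_intros gen_in_free_on
          simp: lin_orders_def permutations_of_set_def\<close>)
  show ?thesis
    by (rule linear_map_in_subspace[OF _ subspace_lin_orders assms(1)[unfolded lin_orders_def]])
       (auto intro!: linear_intros *)
qed

lemma lie_poly_in_lin_orders:
  fixes x :: "'a magma \<Rightarrow>\<^sub>0 'b::comm_ring_1"
  assumes "x \<in> multilinear_part I" shows "lie_poly x \<in> lin_orders I"
  using assms unfolding multilinear_part_def
proof (rule linear_map_in_subspace[OF linear_map_lie_poly subspace_lin_orders])
  fix t :: "'a magma" assume "t \<in> {t. leaves t \<in> permutations_of_set I}"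
  then have "distinct (leaves t)" "set (leaves t) = I" by (auto simp: permutations_of_set_def)
  then have "(magma_poly t :: _ \<Rightarrow>\<^sub>0 'b) \<in> lin_orders I"
  proof (induction t arbitrary: I)
    case (Br s t)
    then show ?case
      using lin_orders_mult[of "magma_poly s" "set (leaves s)" "magma_poly t" "set (leaves t)"]
        lin_orders_mult[of "magma_poly t" "set (leaves t)" "magma_poly s" "set (leaves s)"]
      by (auto intro!: free_mod.subspace_diff subspace_lin_orders simp: Un_commute Int_commute)
  qed (auto simp: lin_orders_def permutations_of_set_def intro!: gen_in_free_on)
  then show "lie_poly (gen t :: _ \<Rightarrow>\<^sub>0 'b) \<in> lin_orders I" by simp
qed

lemma block_in_cobar:
  assumes "x \<in> lin_orders I" "I \<noteq> {}" shows "block x \<in> cobar 1 I"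
  using assms(1) unfolding lin_orders_def
  by (rule linear_map_in_subspace[OF linear_map_block subspace_cobar])
     (use assms(2) in \<open>auto simp: cobar_words_iff permutations_of_set_def intro!: cobar_gen\<close>)

section \<open>Splitting off the bracket that contains a given letter\<close>

subsection \<open>Left-normed brackets\<close>

definition left_normed :: "'a list \<Rightarrow> 'a magma" where
  "left_normed c = foldl (\<lambda>t x. Br t (Gen x)) (Gen (hd c)) (tl c)"

lemma left_normed_singleton [simp]: "left_normed [a] = Gen a"
  by (simp add: left_normed_def)

lemma left_normed_snoc [simp]: "c \<noteq> [] \<Longrightarrow> left_normed (c @ [x]) = Br (left_normed c) (Gen x)"
  by (simp add: left_normed_def)

lemma leaves_left_normed: "c \<noteq> [] \<Longrightarrow> leaves (left_normed c) = c"
  by (induction c rule: rev_nonempty_induct) auto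

definition left_normed_poly :: "'a list \<Rightarrow> ('a list \<Rightarrow>\<^sub>0 'k::comm_ring_1)" where
  "left_normed_poly c = magma_poly (left_normed c)"

lemma left_normed_poly_eq_lie_poly: "left_normed_poly c = lie_poly (gen (left_normed c))"
  by (simp add: left_normed_poly_def)

lemma left_normed_poly_singleton [simp]: "left_normed_poly [a] = gen [a]"
  by (simp add: left_normed_poly_def)

lemma left_normed_poly_snoc: "c \<noteq> [] \<Longrightarrow>
  left_normed_poly (c @ [x]) = left_normed_poly c * gen [x] - gen [x] * left_normed_poly c"
  by (simp add: left_normed_poly_def)

lemma primitive_left_normed_poly: "primitive (left_normed_poly c)"
  unfolding left_normed_poly_eq_lie_poly by (rule primitive_lie_poly)

lemma left_normed_poly_in_lin_orders:
  assumes "c \<noteq> []" "distinct c" shows "left_normed_poly c \<in> lin_orders (set c)"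
  unfolding left_normed_poly_eq_lie_poly using assms
  by (intro lie_poly_in_lin_orders)
     (auto simp: multilinear_part_def permutations_of_set_def leaves_left_normed intro!: gen_in_free_on)

subsection \<open>Words in which a letter only occurs at the head of a block\<close>

text \<open>The letter \<open>a\<close> is a placeholder for a bracket that has been moved to the front of its block, and
  \<open>J\<close> consists of the letters outside this bracket.\<close>

definition head_words :: "'a \<Rightarrow> int \<Rightarrow> 'a set \<Rightarrow> 'a list list set" where
  "head_words a n J = {w \<in> cobar_words n (insert a J). \<forall>l\<in>set w. a \<notin> set (tl l)}"

definition head_cobar :: "'a \<Rightarrow> int \<Rightarrow> 'a set \<Rightarrow> ('a list list \<Rightarrow>\<^sub>0 'k::comm_ring_1) set" where
  "head_cobar a n J = free_on (head_words a n J)"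

definition avoiding :: "'a \<Rightarrow> ('a list list \<Rightarrow>\<^sub>0 'k::comm_ring_1) set" where
  "avoiding a = free_on {w. a \<notin> set (concat w)}"

lemma subspace_head_cobar: "free_mod.subspace (head_cobar a n J)"
  and subspace_avoiding: "free_mod.subspace (avoiding a)"
  unfolding head_cobar_def avoiding_def by (rule subspace_free_on)+

lemma head_words_split:
  assumes "w \<in> head_words a n J"
  obtains u G v where "w = u @ (a # G) # v" "a \<notin> set (concat u)" "a \<notin> set G" "a \<notin> set (concat v)"
proof -
  have d: "distinct (concat w)" "[] \<notin> set w" "a \<in> set (concat w)" and h: "\<And>l. l \<in> set w \<Longrightarrow> a \<notin> set (tl l)"
    using assms by (auto simp: head_words_def cobar_words_iff)
  from d(3) obtain l where l: "l \<in> set w" "a \<in> set l" by auto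
  with h[of l] have "l = a # tl l" by (cases l) auto
  with l obtain u v where "w = u @ (a # tl l) # v" by (metis split_list)
  with d(1) show ?thesis by (intro that[of u "tl l" v]) auto
qed

lemma cobar_avoiding: "x \<in> cobar n I \<Longrightarrow> a \<notin> I \<Longrightarrow> x \<in> avoiding a"
  unfolding cobar_def avoiding_def
  by (erule free_on_mono[rotated]) (auto simp: cobar_words_iff)

lemma cobar_mult_head_cobar:
  assumes "x \<in> cobar m A" "y \<in> head_cobar a n B" "A \<inter> B = {}" "a \<notin> A"
  shows "x * y \<in> head_cobar a (m + n) (A \<union> B)"
proof -
  have *: "gen u * y \<in> head_cobar a (m + n) (A \<union> B)" if u: "u \<in> cobar_words m A" for u
  proof (rule linear_map_in_subspace[OF _ subspace_head_cobar assms(2)[unfolded head_cobar_def]])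
    fix w assume "w \<in> head_words a n B"
    moreover have "a \<notin> set (tl l)" if "l \<in> set u" for l
      using u that assms(4) list.set_sel(2)[of l a] by (cases l) (auto simp: cobar_words_iff)
    ultimately have "u @ w \<in> head_words a (m + n) (A \<union> B)"
      using u assms(3,4) by (auto simp: cobar_words_iff head_words_def)
    then show "gen u * gen w \<in> head_cobar a (m + n) (A \<union> B)"
      by (simp add: head_cobar_def gen_in_free_on)
  qed (auto intro!: linear_intros)
  show ?thesis
    by (rule linear_map_in_subspace[OF _ subspace_head_cobar assms(1)[unfolded cobar_def]])
       (auto intro!: linear_intros *)
qed

text \<open>Restricting a block to a subset keeps its first letter first, if this letter belongs to the subset.\<close>

lemma red_coprod_heads:
  fixes a :: 'a
  assumes "a \<notin> set (tl l)"
  shows "red_coprod l \<in> free_on {w. \<forall>l\<in>set w. a \<notin> set (tl l)}"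
proof -
  let ?X = "{w :: 'a list list. \<forall>l\<in>set w. a \<notin> set (tl l)}"
  have tl: "a \<notin> set (tl p)" if "a \<notin> set p" for p
    using that by (cases p) auto
  have "unsh_sum l (\<lambda>p q. gen [p, q]) \<in> free_on ?X"
  proof (cases l)
    case (Cons b G)
    then have "a \<notin> set G" using assms by simp
    show ?thesis unfolding Cons unsh_sum.simps
    proof (intro unsh_sum_in_subspace subspace_free_on free_mod.subspace_add)
      fix p q assume "mset p + mset q = mset G"
      with \<open>a \<notin> set G\<close> have "a \<notin> set p" "a \<notin> set q"
        by (metis Un_iff set_mset_mset set_mset_union)+
      then show "gen [b # p, q] \<in> free_on ?X" "gen [p, b # q] \<in> free_on ?X"
        by (auto intro!: gen_in_free_on simp: tl)
    qed
  qed (auto intro!: gen_in_free_on)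
  then show ?thesis unfolding red_coprod_def
    by (intro free_mod.subspace_diff subspace_free_on)
       (auto intro!: gen_in_free_on simp: assms)
qed

lemma free_on_Int: "free_on A \<inter> free_on B = free_on (A \<inter> B)"
  by (auto simp: free_on_def)

lemma cdiff_head_cobar:
  fixes x :: "'a list list \<Rightarrow>\<^sub>0 'k::comm_ring_1"
  assumes "x \<in> head_cobar a n J" shows "cdiff x \<in> head_cobar a (n + 1) J"
proof -
  let ?X = "{w :: 'a list list. \<forall>l\<in>set w. a \<notin> set (tl l)}"
  have mult: "y * z \<in> free_on ?X" if "y \<in> free_on ?X" "z \<in> free_on ?X" for y z :: "'a list list \<Rightarrow>\<^sub>0 'k"
    using keys_mult[of y z] that by (fastforce simp: free_on_def plus_list_def)
  have "(word_diff w :: _ \<Rightarrow>\<^sub>0 'k) \<in> free_on ?X" if "w \<in> ?X" for w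
    using that
  proof (induction w)
    case (Cons l w)
    then show ?case
      by (simp only: word_diff.simps minus_mult_left[symmetric])
         (intro free_mod.subspace_diff free_mod.subspace_neg subspace_free_on mult red_coprod_heads;
           auto intro!: gen_in_free_on simp del: gen_Nil)
  qed (simp add: free_mod.subspace_0[OF subspace_free_on])
  then have "cdiff x \<in> free_on ?X"
    by (intro linear_map_in_subspace[OF linear_map_cdiff subspace_free_on
        assms[unfolded head_cobar_def]]) (simp add: head_words_def)
  moreover have "x \<in> cobar n (insert a J)"
    using assms unfolding head_cobar_def cobar_def
    by (rule free_on_mono[rotated]) (auto simp: head_words_def)
  then have "cdiff x \<in> free_on (cobar_words (n + 1) (insert a J))"
    using cdiff_cobar unfolding cobar_def by auto
  ultimately have "cdiff x \<in> free_on (cobar_words (n + 1) (insert a J) \<inter> ?X)"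
    using free_on_Int by blast
  then show ?thesis by (simp add: head_cobar_def head_words_def Int_def)
qed

subsection \<open>Substituting a primitive element for the head letter\<close>

definition subst_head :: "'a \<Rightarrow> ('a list \<Rightarrow>\<^sub>0 'k::comm_ring_1) \<Rightarrow> 'a list \<Rightarrow> ('a list \<Rightarrow>\<^sub>0 'k)" where
  "subst_head a b l = (if l \<noteq> [] \<and> hd l = a then b * gen (tl l) else gen l)"

primrec subst_heads_word ::
  "'a \<Rightarrow> ('a list \<Rightarrow>\<^sub>0 'k::comm_ring_1) \<Rightarrow> 'a list list \<Rightarrow> ('a list list \<Rightarrow>\<^sub>0 'k)" where
  "subst_heads_word a b [] = 1"
| "subst_heads_word a b (l # w) = block (subst_head a b l) * subst_heads_word a b w"

definition subst_heads ::
  "'a \<Rightarrow> ('a list \<Rightarrow>\<^sub>0 'k::comm_ring_1) \<Rightarrow> ('a list list \<Rightarrow>\<^sub>0 'k) \<Rightarrow> ('a list list \<Rightarrow>\<^sub>0 'k)" where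
  "subst_heads a b = lin_ext (subst_heads_word a b)"

lemma linear_map_subst_heads: "linear_map (subst_heads a b)"
  unfolding subst_heads_def by (rule linear_map_lin_ext)

lemmas linear_map_subst_headsI [linear_intros] = linear_map_compose[OF linear_map_subst_heads]
lemmas subst_heads_simps = linear_map_simps[OF linear_map_subst_heads]

lemma subst_heads_single [simp]:
  "subst_heads a b (Poly_Mapping.single w c) = pm_scale c (subst_heads_word a b w)"
  by (simp add: subst_heads_def)

lemma subst_heads_word_append:
  "subst_heads_word a b (u @ v) = subst_heads_word a b u * subst_heads_word a b v"
  by (induction u) (simp_all add: mult.assoc)

lemma subst_heads_mult: "subst_heads a b (x * y) = subst_heads a b x * subst_heads a b y"
  by (rule bilinear_map_eqI[of _ _ x UNIV y UNIV])
     (auto intro!: linear_intros simp: subst_heads_word_append)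

lemma subst_head_avoiding: "a \<notin> set l \<Longrightarrow> subst_head a b l = gen l"
  by (cases l) (auto simp: subst_head_def)

lemma subst_head_Cons: "subst_head a b (a # G) = b * gen G"
  by (simp add: subst_head_def)

lemma subst_heads_word_avoiding: "a \<notin> set (concat w) \<Longrightarrow> subst_heads_word a b w = gen w"
  by (induction w) (auto simp: subst_head_avoiding)

lemma subst_heads_avoiding: "x \<in> avoiding a \<Longrightarrow> subst_heads a b x = x"
  unfolding avoiding_def
  by (rule linear_map_eqI[OF linear_map_subst_heads linear_map_basic(1)])
     (auto simp del: set_concat simp: subst_heads_word_avoiding)

text \<open>Substituting a primitive element for the first letter of a block is compatible with coproducts,
  because multiplication by a primitive element acts on tensors like multiplication by a letter.\<close>

lemma coprod_subst_head:
  fixes b :: "'a list \<Rightarrow>\<^sub>0 'k::comm_ring_1"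
  assumes "primitive b" "a \<notin> set (tl l)"
  shows "coprod_sum (\<lambda>p q. gen [p, q]) (subst_head a b l) =
    unsh_sum l (\<lambda>p q. block (subst_head a b p) * block (subst_head a b q))"
proof (cases "l \<noteq> [] \<and> hd l = a")
  case True
  then obtain G where l: "l = a # G" by (cases l) auto
  with assms have G: "a \<notin> set G" by simp
  have av: "a \<notin> set p" "a \<notin> set q" if "mset p + mset q = mset G" for p q
    using that G by (metis Un_iff set_mset_mset set_mset_union)+
  have 1: "lin_ext (\<lambda>l. gen [l @ p, q]) b = block (b * gen p) * gen [q]" for p q
    by (rule linear_map_eqI[of _ _ b UNIV]) (auto intro!: linear_intros)
  have 2: "lin_ext (\<lambda>l. gen [p, l @ q]) b = gen [p] * block (b * gen q)" for p q
    by (rule linear_map_eqI[of _ _ b UNIV]) (auto intro!: linear_intros)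
  have "coprod_sum (\<lambda>p q. gen [p, q]) (b * gen G) =
      lin_ext (\<lambda>l. unsh_sum G (\<lambda>p q. gen [l @ p, q] + gen [p, l @ q])) b"
    by (simp add: coprod_sum_primitive_mult[OF assms(1)] unsh_sum_add)
  also have "\<dots> = unsh_sum G (\<lambda>p q. lin_ext (\<lambda>l. gen [l @ p, q] + gen [p, l @ q]) b)"
    by (rule linear_map_eqI[of _ _ b UNIV]) (auto intro!: linear_intros)
  also have "\<dots> = unsh_sum G (\<lambda>p q. block (b * gen p) * gen [q] + gen [p] * block (b * gen q))"
    by (simp only: lin_ext_plus 1 2)
  also have "\<dots> = unsh_sum l (\<lambda>p q. block (subst_head a b p) * block (subst_head a b q))"
    unfolding l unsh_sum.simps
    by (rule unsh_sum_cong) (simp add: av subst_head_avoiding subst_head_Cons)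
  finally show ?thesis by (simp add: l subst_head_Cons)
next
  case False
  then have l: "a \<notin> set l" using assms(2) by (cases l) auto
  have av: "a \<notin> set p" "a \<notin> set q" if "mset p + mset q = mset l" for p q
    using that l by (metis Un_iff set_mset_mset set_mset_union)+
  have "unsh_sum l (\<lambda>p q. gen [p, q]) =
      unsh_sum l (\<lambda>p q. block (subst_head a b p) * block (subst_head a b q))"
    by (rule unsh_sum_cong) (simp add: av subst_head_avoiding)
  then show ?thesis by (simp add: subst_head_avoiding[OF l])
qed

lemma cdiff_subst_heads_word:
  fixes b :: "'a list \<Rightarrow>\<^sub>0 'k::comm_ring_1"
  assumes b: "primitive b" and "\<forall>l\<in>set w. a \<notin> set (tl l)"
  shows "cdiff (subst_heads_word a b w) = subst_heads a b (word_diff w)"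
  using assms(2)
proof (induction w)
  case (Cons l w)
  have nil: "subst_head a b [] = 1" by (simp add: subst_head_def)
  have "subst_heads a b (red_coprod l) = - cdiff (block (subst_head a b l))"
    using coprod_subst_head[OF b, of a l] Cons.prems
    by (simp add: red_coprod_def subst_heads_simps linear_map_unsh_sum[OF linear_map_subst_heads]
        cdiff_block nil)
  then show ?case
    using Cons by (simp add: cdiff_mult subst_heads_simps subst_heads_mult subst_heads_word_avoiding)
qed (simp add: subst_heads_simps)

lemma cdiff_subst_heads:
  assumes "primitive b" "x \<in> head_cobar a n J"
  shows "cdiff (subst_heads a b x) = subst_heads a b (cdiff x)"
  using assms(2) unfolding head_cobar_def
  by (rule linear_map_eqI[rotated 2])
     (auto intro!: linear_intros simp: cdiff_subst_heads_word[OF assms(1)] head_words_def)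

lemma subst_heads_split:
  assumes "a \<notin> set (concat u)" "a \<notin> set (concat v)"
  shows "subst_heads_word a b (u @ (a # G) # v) = gen u * block (b * gen G) * gen v"
  using assms by (simp add: subst_heads_word_append subst_heads_word_avoiding subst_head_Cons
      mult.assoc del: set_concat)

lemma subst_heads_cobar:
  fixes x :: "'a list list \<Rightarrow>\<^sub>0 'k::comm_ring_1"
  assumes b: "b \<in> lin_orders S" and S: "a \<in> S" "S \<subseteq> I" and x: "x \<in> head_cobar a n (I - S)"
  shows "subst_heads a b x \<in> cobar n I"
  using x unfolding head_cobar_def
proof (rule linear_map_in_subspace[OF linear_map_subst_heads subspace_cobar])
  fix w assume w: "w \<in> head_words a n (I - S)"
  then obtain u G v where *: "w = u @ (a # G) # v" "a \<notin> set (concat u)" "a \<notin> set G" "a \<notin> set (concat v)"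
    by (rule head_words_split)
  have cw: "int (length w) = n" "[] \<notin> set w" "distinct (concat w)" "set (concat w) = insert a (I - S)"
    using w by (auto simp: head_words_def cobar_words_iff)
  have G: "gen G \<in> lin_orders (set G)"
    using cw * by (auto simp: lin_orders_def permutations_of_set_def intro!: gen_in_free_on)
  have disj: "set G \<inter> S = {}" "set (concat u) \<inter> S = {}" "set (concat v) \<inter> S = {}"
    using cw(4) * by (auto simp: set_eq_iff)
  have u: "(gen u :: _ \<Rightarrow>\<^sub>0 'k) \<in> cobar (length u) (set (concat u))"
    and v: "(gen v :: _ \<Rightarrow>\<^sub>0 'k) \<in> cobar (length v) (set (concat v))"
    using cw(2,3) *(1) by (intro cobar_gen; simp add: cobar_words_iff)+
  have "block (b * gen G) \<in> cobar 1 (S \<union> set G)"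
    using disj S by (intro block_in_cobar lin_orders_mult b G) auto
  then have "gen u * block (b * gen G) * gen v \<in>
      cobar (int (length u) + 1 + int (length v)) (set (concat u) \<union> (S \<union> set G) \<union> set (concat v))"
    using disj cw(3) *(1) by (intro cobar_mult u v) auto
  moreover have "set (concat u) \<union> (S \<union> set G) \<union> set (concat v) = I"
    using cw(4) *(1) S by (auto simp: set_eq_iff)
  moreover have "int (length u) + 1 + int (length v) = n" using cw(1) *(1) by simp
  ultimately have "gen u * block (b * gen G) * gen v \<in> cobar n I"
    by (simp only:)
  then show "subst_heads a b (gen w :: _ \<Rightarrow>\<^sub>0 'k) \<in> cobar n I"
    by (simp only: *(1) subst_heads_single pm_scale_simps subst_heads_split[OF *(2,4)])
qed

subsection \<open>Decomposing blocks by left-normed brackets\<close>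

text \<open>A cycle is written as a list that starts with \<open>a\<close>; as an index it stands for the left-normed bracket
  of its letters.\<close>

definition cycles_from :: "'a \<Rightarrow> 'a set \<Rightarrow> 'a list set" where
  "cycles_from a I = {c. c \<noteq> [] \<and> hd c = a \<and> distinct c \<and> set c \<subseteq> I}"

lemma finite_cycles_from: "finite I \<Longrightarrow> finite (cycles_from a I)"
  by (rule finite_subset[OF _ finite_subset_distinct[of I]]) (auto simp: cycles_from_def)

lemma cycles_from_Cons: "c \<in> cycles_from a I \<Longrightarrow> c = a # tl c \<and> a \<notin> set (tl c)"
  by (cases c) (auto simp: cycles_from_def)

definition bracket_sum ::
  "'a \<Rightarrow> 'a set \<Rightarrow> ('a list \<Rightarrow> ('a list list \<Rightarrow>\<^sub>0 'k::comm_ring_1)) \<Rightarrow> ('a list list \<Rightarrow>\<^sub>0 'k)" where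
  "bracket_sum a I X = (\<Sum>c\<in>cycles_from a I. subst_heads a (left_normed_poly c) (X c))"

text \<open>Letters in front of \<open>a\<close> are moved behind it by the rewriting
  \<open>x \<cdot> b = b \<cdot> x - [b, x]\<close>, so the products of a left-normed bracket from \<open>a\<close> and a word span the
  linear orders.\<close>

lemma cobar_bracket_sum:
  fixes x :: "'a list list \<Rightarrow>\<^sub>0 'k::comm_ring_1"
  assumes I: "finite I" "a \<in> I" and x: "x \<in> cobar n I"
  obtains X where "\<And>c. c \<in> cycles_from a I \<Longrightarrow> X c \<in> head_cobar a n (I - set c)" "x = bracket_sum a I X"
proof -
  define Z where "Z = {bracket_sum a I X | X :: 'a list \<Rightarrow> ('a list list \<Rightarrow>\<^sub>0 'k).
    \<forall>c\<in>cycles_from a I. X c \<in> head_cobar a n (I - set c)}"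
  have Z: "free_mod.subspace Z"
    unfolding free_mod.subspace_def
  proof (intro conjI allI impI ballI)
    show "0 \<in> Z" unfolding Z_def
      by (rule CollectI, rule exI[of _ "\<lambda>_. 0"])
         (simp add: bracket_sum_def subst_heads_simps free_mod.subspace_0[OF subspace_head_cobar])
  next
    fix y z assume "y \<in> Z" "z \<in> Z"
    then obtain X Y where "\<forall>c\<in>cycles_from a I. X c \<in> head_cobar a n (I - set c)" "y = bracket_sum a I X"
      "\<forall>c\<in>cycles_from a I. Y c \<in> head_cobar a n (I - set c)" "z = bracket_sum a I Y"
      by (auto simp: Z_def)
    then show "y + z \<in> Z" unfolding Z_def
      by (intro CollectI exI[of _ "\<lambda>c. X c + Y c"])
         (simp add: bracket_sum_def subst_heads_simps sum.distrib free_mod.subspace_add[OF subspace_head_cobar])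
  next
    fix y k assume "y \<in> Z"
    then obtain X where "\<forall>c\<in>cycles_from a I. X c \<in> head_cobar a n (I - set c)" "y = bracket_sum a I X"
      by (auto simp: Z_def)
    then show "pm_scale k y \<in> Z" unfolding Z_def
      by (intro CollectI exI[of _ "\<lambda>c. pm_scale k (X c)"])
         (simp add: bracket_sum_def subst_heads_simps free_mod.scale_sum_right
           free_mod.subspace_scale[OF subspace_head_cobar])
  qed
  \<comment> \<open>The prefix \<open>r\<close> of the block is shortened from the right; its last letter enters the suffix or the bracket.\<close>
  have Z_word: "gen u * block (gen r * left_normed_poly c * gen s) * gen v \<in> Z"
    if "int (length u + length v) + 1 = n" "[] \<notin> set u" "[] \<notin> set v" "c \<noteq> []" "hd c = a"
      "distinct (concat u @ r @ c @ s @ concat v)" "set (concat u @ r @ c @ s @ concat v) = I" for u v r c s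
    using that
  proof (induction r arbitrary: c s rule: rev_induct)
    case Nil
    have c: "c \<in> cycles_from a I" using Nil by (auto simp: cycles_from_def)
    have av: "a \<notin> set (concat u)" "a \<notin> set (concat v)"
      using Nil(4-6) hd_in_set[of c] by auto
    let ?w = "u @ (a # s) # v"
    let ?X = "\<lambda>c'. if c' = c then gen ?w else 0 :: 'a list list \<Rightarrow>\<^sub>0 'k"
    have tl: "a \<notin> set (tl l)" if "a \<notin> set l" for l using that by (cases l) auto
    have "a \<notin> set s" "a \<in> set c"
      using Nil(4-6) hd_in_set[of c] by auto
    have "\<forall>l\<in>set (u @ v). a \<notin> set (tl l)"
    proof
      fix l assume "l \<in> set (u @ v)"
      then have "a \<notin> set l" using av by auto
      then show "a \<notin> set (tl l)" by (rule tl)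
    qed
    then have "\<forall>l\<in>set ?w. a \<notin> set (tl l)" using \<open>a \<notin> set s\<close> by auto
    then have "?w \<in> head_words a n (I - set c)"
      using Nil \<open>a \<notin> set s\<close> \<open>a \<in> set c\<close> av by (auto simp: head_words_def cobar_words_iff)
    then have "\<forall>c'\<in>cycles_from a I. ?X c' \<in> head_cobar a n (I - set c')"
      by (auto simp: head_cobar_def gen_in_free_on free_mod.subspace_0[OF subspace_free_on])
    moreover have "bracket_sum a I ?X = (\<Sum>c'\<in>{c}. subst_heads a (left_normed_poly c') (?X c'))"
      unfolding bracket_sum_def
      by (intro sum.mono_neutral_right) (use c I in \<open>auto simp: finite_cycles_from subst_heads_simps\<close>)
    ultimately show ?case unfolding Z_def
      using subst_heads_split[OF av, of "left_normed_poly c :: _ \<Rightarrow>\<^sub>0 'k" s]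
      by (intro CollectI exI[of _ ?X]) (simp add: mult.assoc)
  next
    case (snoc y r)
    have 1: "left_normed_poly (c @ [y]) = left_normed_poly c * gen [y] - gen [y] * (left_normed_poly c :: _ \<Rightarrow>\<^sub>0 'k)"
      using snoc.prems by (simp add: left_normed_poly_snoc)
    have 2: "gen (r @ [y]) = (gen r * gen [y] :: _ \<Rightarrow>\<^sub>0 'k)"
      "gen (y # s) = (gen [y] * gen s :: _ \<Rightarrow>\<^sub>0 'k)" by simp_all
    have e: "gen (r @ [y]) * left_normed_poly c * gen s =
        gen r * left_normed_poly c * gen (y # s) - gen r * left_normed_poly (c @ [y]) * (gen s :: _ \<Rightarrow>\<^sub>0 'k)"
      unfolding 1 2 by (simp add: algebra_simps del: gen_mult)
    have "gen u * block (gen r * left_normed_poly c * gen (y # s)) * gen v \<in> Z"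
      "gen u * block (gen r * left_normed_poly (c @ [y]) * gen s) * gen v \<in> Z"
      using snoc.prems by (intro snoc.IH; auto)+
    from free_mod.subspace_diff[OF Z this] show ?case
      unfolding e by (simp add: block_simps right_diff_distrib left_diff_distrib)
  qed
  have "x \<in> Z"
    using x unfolding cobar_def
  proof (rule linear_map_in_subspace[OF linear_map_basic(1) Z])
    fix w assume "w \<in> cobar_words n I"
    then have w: "int (length w) = n" "[] \<notin> set w" "distinct (concat w)" "set (concat w) = I"
      by (auto simp: cobar_words_iff)
    with \<open>a \<in> I\<close> obtain l where "l \<in> set w" "a \<in> set l" by auto
    then obtain u v r s where "w = u @ (r @ a # s) # v" by (metis split_list)
    with w Z_word[of u v "[a]" r s] show "gen w \<in> Z" by simp
  qed
  then show ?thesis using that by (auto simp: Z_def)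
qed

definition insert_snd :: "'a \<Rightarrow> ('a list \<Rightarrow>\<^sub>0 'k::comm_ring_1) \<Rightarrow> ('a list \<Rightarrow>\<^sub>0 'k)" where
  "insert_snd y = lin_ext (\<lambda>l. gen (hd l # y # tl l))"

text \<open>The coefficient of the left-normed bracket \<open>c\<close> in the expansion of a word, recorded as a
  combination of words that begin with the letter \<open>a\<close> standing for the bracket. The recursion is the
  rewriting \<open>x \<cdot> b = b \<cdot> x - [b, x]\<close>.\<close>

primrec bracket_coeff_word :: "'a \<Rightarrow> 'a list \<Rightarrow> 'a list \<Rightarrow> ('a list \<Rightarrow>\<^sub>0 'k::comm_ring_1)" where
  "bracket_coeff_word a [] c = 0"
| "bracket_coeff_word a (y # w) c =
    (if y = a then if c = [a] then gen (a # w) else 0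
     else insert_snd y (bracket_coeff_word a w c) -
       (if last c = y then bracket_coeff_word a w (butlast c) else 0))"

definition bracket_coeff ::
  "'a \<Rightarrow> 'a list \<Rightarrow> ('a list \<Rightarrow>\<^sub>0 'k::comm_ring_1) \<Rightarrow> ('a list \<Rightarrow>\<^sub>0 'k)" where
  "bracket_coeff a c = lin_ext (\<lambda>l. bracket_coeff_word a l c)"

lemma linear_map_insert_snd: "linear_map (insert_snd y)"
  and linear_map_bracket_coeff: "linear_map (bracket_coeff a c)"
  unfolding insert_snd_def bracket_coeff_def by (rule linear_map_lin_ext)+

lemmas linear_map_bracket_coeffI [linear_intros] =
  linear_map_compose[OF linear_map_insert_snd] linear_map_compose[OF linear_map_bracket_coeff]

lemma bracket_coeff_letter_mult:
  "y \<noteq> a \<Longrightarrow> bracket_coeff a c (gen [y] * z) =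
    insert_snd y (bracket_coeff a c z) - (if last c = y then bracket_coeff a (butlast c) z else 0)"
  by (rule linear_map_eqI[of _ _ z UNIV]) (auto intro!: linear_intros simp: bracket_coeff_def)

text \<open>The coefficients are exact: the recursion for a letter \<open>y\<close> in front undoes the recursion
  \<open>[b, y] = b y - y b\<close> of the left-normed brackets, whatever word follows.\<close>

lemma bracket_coeff_left_normed:
  assumes "a \<notin> set v"
  shows "bracket_coeff a c (left_normed_poly (a # v) * gen G) =
    (if c = a # v then gen (a # G) else 0 :: 'a list \<Rightarrow>\<^sub>0 'k::comm_ring_1)"
  using assms
proof (induction v arbitrary: c G rule: rev_induct)
  case (snoc y v)
  define b where "b = (left_normed_poly (a # v) :: 'a list \<Rightarrow>\<^sub>0 'k)"
  have IH: "bracket_coeff a c (b * gen G) = (if c = a # v then gen (a # G) else 0)" for c G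
    using snoc by (simp add: b_def)
  have "left_normed_poly (a # v @ [y]) = b * gen [y] - gen [y] * b"
    using left_normed_poly_snoc[of "a # v" y] by (simp add: b_def)
  then have "left_normed_poly (a # v @ [y]) * gen G = b * gen (y # G) - gen [y] * (b * gen G)"
    by (simp add: left_diff_distrib mult.assoc)
  moreover have ne: "y \<noteq> a" using snoc.prems by auto
  ultimately have "bracket_coeff a c (left_normed_poly (a # v @ [y]) * gen G) =
      bracket_coeff a c (b * gen (y # G)) - (insert_snd y (bracket_coeff a c (b * gen G))
        - (if last c = y then bracket_coeff a (butlast c) (b * gen G) else 0))"
    using bracket_coeff_letter_mult[OF ne, of c "b * gen G"]
    by (simp add: linear_map_simps[OF linear_map_bracket_coeff])
  also have "\<dots> = (if last c = y \<and> butlast c = a # v then gen (a # G) else 0)"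
    unfolding IH by (auto simp: insert_snd_def lin_ext_simps)
  also have "(last c = y \<and> butlast c = a # v) \<longleftrightarrow> c = a # v @ [y]"
    by (cases c rule: rev_cases) auto
  finally show ?case .
qed (simp add: bracket_coeff_def)

primrec bracket_part_word :: "'a \<Rightarrow> 'a list \<Rightarrow> 'a list list \<Rightarrow> ('a list list \<Rightarrow>\<^sub>0 'k::comm_ring_1)" where
  "bracket_part_word a c [] = 1"
| "bracket_part_word a c (l # w) =
    block (if a \<in> set l then bracket_coeff_word a l c else gen l) * bracket_part_word a c w"

definition bracket_part ::
  "'a \<Rightarrow> 'a list \<Rightarrow> ('a list list \<Rightarrow>\<^sub>0 'k::comm_ring_1) \<Rightarrow> ('a list list \<Rightarrow>\<^sub>0 'k)" where
  "bracket_part a c = lin_ext (bracket_part_word a c)"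

lemma linear_map_bracket_part: "linear_map (bracket_part a c)"
  unfolding bracket_part_def by (rule linear_map_lin_ext)

lemmas linear_map_bracket_partI [linear_intros] = linear_map_compose[OF linear_map_bracket_part]

lemma bracket_part_word_append:
  "bracket_part_word a c (u @ v) = bracket_part_word a c u * bracket_part_word a c v"
  by (induction u) (simp_all add: mult.assoc)

lemma bracket_part_mult: "bracket_part a c (x * y) = bracket_part a c x * bracket_part a c y"
  by (rule bilinear_map_eqI[of _ _ x UNIV y UNIV])
     (auto intro!: linear_intros simp: bracket_part_word_append bracket_part_def)

lemma bracket_part_avoiding:
  assumes "a \<notin> set (concat w)" shows "bracket_part a c (gen w) = gen w"
proof -
  have "bracket_part_word a c w = gen w"
    using assms by (induction w) auto
  then show ?thesis by (simp add: bracket_part_def)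
qed

lemma bracket_part_block:
  assumes "x \<in> free_on {l. a \<in> set l}"
  shows "bracket_part a c (block x) = block (bracket_coeff a c x)"
  by (rule linear_map_eqI[OF _ _ assms])
     (auto intro!: linear_intros simp: bracket_part_def bracket_coeff_def)

text \<open>Extracting coefficients in the one block that contains \<open>a\<close> recovers the summand with index \<open>c\<close> and
  kills the others, so the decomposition into brackets is unique.\<close>

lemma bracket_part_subst_heads:
  fixes x :: "'a list list \<Rightarrow>\<^sub>0 'k::comm_ring_1"
  assumes c: "c \<in> cycles_from a I" and x: "x \<in> head_cobar a n (I - set c)"
  shows "bracket_part a c' (subst_heads a (left_normed_poly c) x) = (if c' = c then x else 0)"
proof -
  have lin: "linear_map (\<lambda>x :: 'a list list \<Rightarrow>\<^sub>0 'k. if c' = c then x else 0)"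
    by (cases "c' = c") (auto intro: linear_intros)
  show ?thesis
  proof (rule linear_map_eqI[OF _ lin x[unfolded head_cobar_def]])
    fix w assume w: "w \<in> head_words a n (I - set c)"
    then obtain u G v where *: "w = u @ (a # G) # v" "a \<notin> set (concat u)" "a \<notin> set G" "a \<notin> set (concat v)"
      by (rule head_words_split)
    have c': "c = a # tl c" "a \<notin> set (tl c)" "distinct c" "c \<noteq> []"
      using cycles_from_Cons[OF c] c by (auto simp: cycles_from_def)
    have "left_normed_poly c * gen G \<in> (free_on {l. a \<in> set l} :: ('a list \<Rightarrow>\<^sub>0 'k) set)"
    proof (rule linear_map_in_subspace[of "\<lambda>x. x * gen G" _ _ "permutations_of_set (set c)"])
      show "left_normed_poly c \<in> free_on (permutations_of_set (set c))"
        using left_normed_poly_in_lin_orders[OF c'(4,3)] by (simp add: lin_orders_def)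
      fix l assume "l \<in> permutations_of_set (set c)"
      moreover have "a \<in> set c" using c'(1) by (metis list.set_intros(1))
      ultimately show "gen l * gen G \<in> free_on {l. a \<in> set l}"
        by (auto simp: permutations_of_set_def intro!: gen_in_free_on)
    qed (auto intro!: linear_intros subspace_free_on)
    then have "bracket_part a c' (block (left_normed_poly c * gen G)) =
        (if c' = c then gen [a # G] else 0 :: _ \<Rightarrow>\<^sub>0 'k)"
      using bracket_coeff_left_normed[OF c'(2), of c' G, where ?'k = 'k] c'(1)
      by (simp add: bracket_part_block block_simps)
    then show "bracket_part a c' (subst_heads a (left_normed_poly c) (gen w)) =
        (if c' = c then gen w else 0 :: _ \<Rightarrow>\<^sub>0 'k)"
      unfolding *(1) by (simp add: subst_heads_split[OF *(2,4)] bracket_part_mult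
          bracket_part_avoiding[OF *(2)] bracket_part_avoiding[OF *(4)] del: gen_Nil)
  qed (auto intro!: linear_intros)
qed

lemma bracket_sum_inj:
  fixes X :: "'a list \<Rightarrow> ('a list list \<Rightarrow>\<^sub>0 'k::comm_ring_1)"
  assumes "finite I" "\<And>c. c \<in> cycles_from a I \<Longrightarrow> X c \<in> head_cobar a n (I - set c)"
    and "bracket_sum a I X = 0" and c: "c \<in> cycles_from a I"
  shows "X c = 0"
proof -
  have "0 = bracket_part a c (bracket_sum a I X)"
    using assms(3) by (simp add: linear_map_zero[OF linear_map_bracket_part])
  also have "\<dots> = (\<Sum>c'\<in>cycles_from a I. if c = c' then X c' else 0)"
    unfolding bracket_sum_def linear_map_sum[OF linear_map_bracket_part]
    by (rule sum.cong[OF refl], rule bracket_part_subst_heads[OF _ assms(2)])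
  also have "\<dots> = X c"
    using c finite_cycles_from[OF assms(1)] by simp
  finally show ?thesis ..
qed

subsection \<open>Contracting the head letter\<close>

text \<open>Inserting \<open>a\<close> at the head of each block in turn. By \<open>cdiff_add_head\<close> this commutes with the
  differential up to multiplication by the block \<open>[a]\<close> on the left and on the right, because the
  splittings that separate \<open>a\<close> from the rest of its block have no counterpart.\<close>

primrec add_head_word :: "'a \<Rightarrow> 'a list list \<Rightarrow> ('a list list \<Rightarrow>\<^sub>0 'k::comm_ring_1)" where
  "add_head_word a [] = 0"
| "add_head_word a (l # w) = gen ((a # l) # w) + gen [l] * add_head_word a w"

definition add_head :: "'a \<Rightarrow> ('a list list \<Rightarrow>\<^sub>0 'k::comm_ring_1) \<Rightarrow> ('a list list \<Rightarrow>\<^sub>0 'k)" where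
  "add_head a = lin_ext (add_head_word a)"

lemma linear_map_add_head: "linear_map (add_head a)"
  unfolding add_head_def by (rule linear_map_lin_ext)

lemmas linear_map_add_headI [linear_intros] = linear_map_compose[OF linear_map_add_head]
lemmas add_head_simps = linear_map_simps[OF linear_map_add_head]

lemma add_head_single [simp]: "add_head a (Poly_Mapping.single w c) = pm_scale c (add_head_word a w)"
  by (simp add: add_head_def)

lemma add_head_one [simp]: "add_head a (1 :: 'a list list \<Rightarrow>\<^sub>0 'k::comm_ring_1) = 0"
  using add_head_single[of a "[]" "1 :: 'k"] by simp

lemma add_head_word_append:
  "add_head_word a (u @ v) = add_head_word a u * gen v + gen u * (add_head_word a v :: _ \<Rightarrow>\<^sub>0 'k::comm_ring_1)"
proof (induction u)
  case (Cons l u)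
  have "gen (l # u) * x = gen [l] * (gen u * x)" for x :: "'a list list \<Rightarrow>\<^sub>0 'k"
    by (simp add: mult.assoc[symmetric])
  then show ?case using Cons by (simp add: algebra_simps)
qed simp

lemma add_head_mult: "add_head a (x * y) = add_head a x * y + x * add_head a y"
  by (rule bilinear_map_eqI[of _ _ x UNIV y UNIV])
     (auto intro!: linear_intros simp: add_head_word_append)

lemma add_head_red_coprod:
  "add_head a (red_coprod l) = red_coprod (a # l) - gen [l, [a]] - gen [[a], l]"
  by (simp add: red_coprod_def add_head_simps linear_map_unsh_sum[OF linear_map_add_head])

lemma cdiff_add_head:
  fixes x :: "'a list list \<Rightarrow>\<^sub>0 'k::comm_ring_1"
  shows "cdiff (add_head a x) = add_head a (cdiff x) - gen [[a]] * x + sign_twist x * gen [[a]]"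
proof (rule linear_map_eqI[of "\<lambda>x. cdiff (add_head a x)" _ x UNIV])
  fix w :: "'a list list"
  show "cdiff (add_head a (gen w)) = add_head a (cdiff (gen w))
      - gen [[a]] * gen w + sign_twist (gen w) * (gen [[a]] :: _ \<Rightarrow>\<^sub>0 'k)"
  proof (induction w)
    case (Cons l w)
    define m where "m = (gen w :: _ \<Rightarrow>\<^sub>0 'k)"
    have lw: "gen (l # w) = gen [l] * m" by (simp add: m_def)
    have s: "sign_twist (gen [l] :: _ \<Rightarrow>\<^sub>0 'k) = - gen [l]" "sign_twist (gen [a # l] :: _ \<Rightarrow>\<^sub>0 'k) = - gen [a # l]"
      by (simp_all add: single_uminus)
    have j: "add_head a (gen [l]) = (gen [a # l] :: _ \<Rightarrow>\<^sub>0 'k)" by simp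
    have d: "cdiff (gen [l]) = (- red_coprod l :: _ \<Rightarrow>\<^sub>0 'k)" "cdiff (gen [a # l]) = (- red_coprod (a # l) :: _ \<Rightarrow>\<^sub>0 'k)"
      by simp_all
    have r: "red_coprod (a # l) = add_head a (red_coprod l) + gen [l] * gen [[a]] + (gen [[a]] * gen [l] :: _ \<Rightarrow>\<^sub>0 'k)"
      by (simp add: add_head_red_coprod)
    note IH = Cons.IH[folded m_def]
    show ?case unfolding lw
      by (simp add: cdiff_mult add_head_mult sign_twist_mult s j d r IH cdiff_simps add_head_simps
            del: gen_mult add_head_single cdiff_single sign_twist_single)
         (simp add: algebra_simps del: gen_mult)
  qed (simp add: add_head_simps cdiff_simps)
qed (auto intro!: linear_intros)

text \<open>A word \<open>u [a] v\<close> is sent, with sign \<open>(- 1) ^ (length u + 1)\<close>, to the sum of the words in which \<open>a\<close> has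
  moved into one of the blocks of \<open>v\<close>. Since \<open>a\<close> moves to the right only, the words \<open>u [a]\<close> are not
  contracted.\<close>

primrec head_homotopy_word :: "'a \<Rightarrow> 'a list list \<Rightarrow> ('a list list \<Rightarrow>\<^sub>0 'k::comm_ring_1)" where
  "head_homotopy_word a [] = 0"
| "head_homotopy_word a (l # w) =
    (if l = [a] then - add_head_word a w
     else if a \<in> set l then 0
     else - gen [l] * head_homotopy_word a w)"

text \<open>The word \<open>u [a] v\<close> is cohomologous to \<open>u v [a]\<close> with the sign of \<open>v\<close>; the value is its part in front
  of \<open>[a]\<close>.\<close>

primrec drop_head_word :: "'a \<Rightarrow> 'a list list \<Rightarrow> ('a list list \<Rightarrow>\<^sub>0 'k::comm_ring_1)" where
  "drop_head_word a [] = 0"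
| "drop_head_word a (l # w) =
    (if l = [a] then sign_twist (gen w)
     else if a \<in> set l then 0
     else gen [l] * drop_head_word a w)"

definition head_homotopy :: "'a \<Rightarrow> ('a list list \<Rightarrow>\<^sub>0 'k::comm_ring_1) \<Rightarrow> ('a list list \<Rightarrow>\<^sub>0 'k)" where
  "head_homotopy a = lin_ext (head_homotopy_word a)"

definition drop_head :: "'a \<Rightarrow> ('a list list \<Rightarrow>\<^sub>0 'k::comm_ring_1) \<Rightarrow> ('a list list \<Rightarrow>\<^sub>0 'k)" where
  "drop_head a = lin_ext (drop_head_word a)"

lemma linear_map_head_homotopy: "linear_map (head_homotopy a)"
  and linear_map_drop_head: "linear_map (drop_head a)"
  unfolding head_homotopy_def drop_head_def by (rule linear_map_lin_ext)+

lemmas linear_map_head_homotopyI [linear_intros] =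
  linear_map_compose[OF linear_map_head_homotopy] linear_map_compose[OF linear_map_drop_head]
lemmas head_homotopy_simps = linear_map_simps[OF linear_map_head_homotopy]
lemmas drop_head_simps = linear_map_simps[OF linear_map_drop_head]

lemma head_homotopy_single [simp]:
  "head_homotopy a (Poly_Mapping.single w c) = pm_scale c (head_homotopy_word a w)"
  "drop_head a (Poly_Mapping.single w c) = pm_scale c (drop_head_word a w)"
  by (simp_all add: head_homotopy_def drop_head_def)

lemma head_homotopy_avoiding_mult:
  assumes "x \<in> avoiding a"
  shows "head_homotopy a (x * y) = sign_twist x * head_homotopy a y"
proof (rule bilinear_map_eqI[OF _ _ _ _ assms[unfolded avoiding_def], of _ _ y UNIV])
  fix u v assume "u \<in> {w. a \<notin> set (concat w)}"
  then have u: "a \<notin> set (concat u)" by simp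
  have "head_homotopy_word a (u @ v) = sign_twist (gen u) * (head_homotopy_word a v :: _ \<Rightarrow>\<^sub>0 'b)"
    using u
  proof (induction u)
    case (Cons l u)
    have "sign_twist (gen (l # u)) = - gen [l] * sign_twist (gen u :: _ \<Rightarrow>\<^sub>0 'b)"
      by (simp add: single_uminus[symmetric])
    with Cons show ?case by (auto simp: mult.assoc simp del: sign_twist_single)
  qed simp
  then show "head_homotopy a (gen u * gen v) = sign_twist (gen u) * head_homotopy a (gen v :: _ \<Rightarrow>\<^sub>0 'b)"
    by simp
qed (auto intro!: linear_intros)

lemma drop_head_avoiding_mult:
  assumes "x \<in> avoiding a"
  shows "drop_head a (x * y) = x * drop_head a y"
proof (rule bilinear_map_eqI[OF _ _ _ _ assms[unfolded avoiding_def], of _ _ y UNIV])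
  fix u v assume "u \<in> {w. a \<notin> set (concat w)}"
  then have u: "a \<notin> set (concat u)" by simp
  have "drop_head_word a (u @ v) = gen u * (drop_head_word a v :: _ \<Rightarrow>\<^sub>0 'b)"
    using u
  proof (induction u)
    case (Cons l u)
    then show ?case by (auto simp: mult.assoc[symmetric])
  qed simp
  then show "drop_head a (gen u * gen v) = gen u * drop_head a (gen v :: _ \<Rightarrow>\<^sub>0 'b)"
    by simp
qed (auto intro!: linear_intros)

lemma head_homotopy_head_mult:
  "head_homotopy a (gen [[a]] * y) = - add_head a y"
  "G \<noteq> [] \<Longrightarrow> head_homotopy a (gen [a # G] * y) = 0"
  "drop_head a (gen [[a]] * y) = sign_twist y"
  "G \<noteq> [] \<Longrightarrow> drop_head a (gen [a # G] * y) = 0"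
  by (rule linear_map_eqI[of _ _ y UNIV]; auto intro!: linear_intros simp del: sign_twist_single)+

lemma gen_avoiding: "a \<notin> set (concat w) \<Longrightarrow> gen w \<in> avoiding a"
  by (simp add: avoiding_def gen_in_free_on)

lemma red_coprod_avoiding:
  assumes "a \<notin> set l" shows "red_coprod l \<in> avoiding a"
proof -
  have "unsh_sum l (\<lambda>p q. gen [p, q]) \<in> avoiding a"
  proof (rule unsh_sum_in_subspace[OF subspace_avoiding])
    fix p q assume "mset p + mset q = mset l"
    with assms have "a \<notin> set p" "a \<notin> set q"
      by (metis Un_iff set_mset_mset set_mset_union)+
    then show "gen [p, q] \<in> avoiding a" by (intro gen_avoiding) simp
  qed
  then show ?thesis unfolding red_coprod_def
    by (intro free_mod.subspace_diff subspace_avoiding gen_avoiding) (simp_all add: assms)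
qed

lemma red_coprod_letter [simp]: "red_coprod [a] = 0"
  by (simp add: red_coprod_def)

text \<open>Of all splittings of the block \<open>a G\<close> only \<open>[a]|G\<close> and \<open>G|[a]\<close> contribute. In the first, \<open>a\<close> moves into
  \<open>G\<close> or behind it, in the second only behind it, and the latter terms cancel.\<close>

lemma head_homotopy_red_coprod:
  assumes "a \<notin> set G" "G \<noteq> []"
  shows "head_homotopy a (red_coprod (a # G) * y) = - (gen [a # G] * y)"
proof -
  have av: "a \<notin> set p" "a \<notin> set q" if "mset p + mset q = mset G" for p q
    using that assms(1) by (metis Un_iff set_mset_mset set_mset_union)+
  have sp: "gen [l, r] * y = gen [l] * (gen [r] * y)" for l r
    by (simp add: mult.assoc[symmetric])
  have neg: "head_homotopy a (gen [l] * z) = - gen [l] * head_homotopy a z" if "a \<notin> set l" for l z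
    using head_homotopy_avoiding_mult[OF gen_avoiding, of a "[l]" z] that by (simp add: single_uminus)
  have 1: "head_homotopy a (gen [a # p, q] * y) = (if p = [] then - add_head a (gen [q] * y) else 0)" for p q
    unfolding sp by (simp add: head_homotopy_head_mult)
  have 2: "head_homotopy a (gen [p, a # q] * y) = (if q = [] then gen [p] * add_head a y else 0)"
    if "a \<notin> set p" for p q
    unfolding sp neg[OF that] by (simp add: head_homotopy_head_mult)
  have lin: "linear_map (\<lambda>x. head_homotopy a (x * y))" by (auto intro!: linear_intros)
  have "head_homotopy a (unsh_sum (a # G) (\<lambda>p q. gen [p, q]) * y) =
      unsh_sum G (\<lambda>p q. (if p = [] then - add_head a (gen [q] * y) else 0)
        + (if q = [] then gen [p] * add_head a y else 0))"
    unfolding linear_map_unsh_sum[OF lin] unsh_sum.simps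
    by (rule unsh_sum_cong) (simp add: 1 2 av distrib_right head_homotopy_simps)
  also have "\<dots> = - add_head a (gen [G] * y) + gen [G] * add_head a y"
    unfolding unsh_sum_add unsh_sum_right_Nil by (subst unsh_sum_left_Nil) (rule refl)
  also have "\<dots> = - (gen [a # G] * y)"
    by (simp add: add_head_mult)
  finally show ?thesis
    unfolding red_coprod_def
    using assms(2) 1[of G "[]"] by (simp add: left_diff_distrib head_homotopy_simps sp[of "[]"] neg
      head_homotopy_head_mult)
qed

text \<open>The signs make both sides compatible with a block without \<open>a\<close> in front, so the word may be assumed to
  start with the block of \<open>a\<close>. If this block is \<open>[a]\<close>, the identity is \<open>cdiff_add_head\<close>, otherwise it is
  \<open>head_homotopy_red_coprod\<close>. The complex is thereby contracted onto the words that end with \<open>[a]\<close>.\<close>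

lemma head_homotopy_cdiff:
  fixes x :: "'a list list \<Rightarrow>\<^sub>0 'k::comm_ring_1"
  assumes "x \<in> head_cobar a n J"
  shows "cdiff (head_homotopy a x) + head_homotopy a (cdiff x) = x - drop_head a x * gen [[a]]"
proof (rule linear_map_eqI[OF _ _ assms[unfolded head_cobar_def]])
  fix w assume "w \<in> head_words a n J"
  then obtain u G v where *: "w = u @ (a # G) # v" "a \<notin> set (concat u)" "a \<notin> set G" "a \<notin> set (concat v)"
    by (rule head_words_split)
  have s: "sign_twist (gen [l] :: _ \<Rightarrow>\<^sub>0 'k) = - gen [l]" for l :: "'a list"
    by (simp add: single_uminus)
  show "cdiff (head_homotopy a (gen w)) + head_homotopy a (cdiff (gen w))
      = gen w - drop_head a (gen w) * (gen [[a]] :: _ \<Rightarrow>\<^sub>0 'k)"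
    using *(2) unfolding *(1)
  proof (induction u)
    case Nil
    define m where "m = (gen v :: _ \<Rightarrow>\<^sub>0 'k)"
    have m: "gen ([] @ (a # G) # v) = gen [a # G] * m" by (simp add: m_def)
    show ?case
    proof (cases "G = []")
      case True
      show ?thesis unfolding m unfolding True
        by (simp add: cdiff_mult s cdiff_simps head_homotopy_simps head_homotopy_head_mult cdiff_add_head
            del: gen_mult sign_twist_single)
    next
      case False
      show ?thesis unfolding m
        by (simp add: cdiff_mult s cdiff_simps head_homotopy_simps head_homotopy_head_mult(2,4)[OF False]
            head_homotopy_red_coprod[OF *(3) False] False head_homotopy_head_mult del: gen_mult sign_twist_single)
    qed
  next
    case (Cons l u)
    define m where "m = (gen (u @ (a # G) # v) :: _ \<Rightarrow>\<^sub>0 'k)"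
    have m: "gen ((l # u) @ (a # G) # v) = gen [l] * m" by (simp add: m_def)
    have l: "a \<notin> set l" "a \<notin> set (concat [l])" using Cons.prems by auto
    have IH: "head_homotopy a (cdiff m) = m - drop_head a m * gen [[a]] - cdiff (head_homotopy a m)"
      using Cons by (simp add: m_def algebra_simps)
    note h = head_homotopy_avoiding_mult[OF gen_avoiding[OF l(2)]]
      head_homotopy_avoiding_mult[OF red_coprod_avoiding[OF l(1)]]
      drop_head_avoiding_mult[OF gen_avoiding[OF l(2)]]
    show ?case unfolding m
      by (simp add: h cdiff_mult s cdiff_simps head_homotopy_simps IH algebra_simps del: gen_mult sign_twist_single)
  qed
qed (auto intro!: linear_intros)

lemma cdiff_letter [simp]: "cdiff (gen [[a]]) = 0"
  by simp

lemma add_head_cobar: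
  fixes v :: "'a list list"
  assumes "[] \<notin> set v" "distinct (concat v)" "a \<notin> set (concat v)"
  shows "(add_head_word a v :: _ \<Rightarrow>\<^sub>0 'k::comm_ring_1) \<in> head_cobar a (int (length v)) (set (concat v))"
  using assms
proof (induction v)
  case (Cons l v)
  have tl: "a \<notin> set (tl l')" if "a \<notin> set l'" for l' using that by (cases l') auto
  have "(gen [l] :: _ \<Rightarrow>\<^sub>0 'k) \<in> cobar 1 (set l)"
    using Cons.prems by (intro cobar_gen) (auto simp: cobar_words_iff)
  moreover have "(add_head_word a v :: _ \<Rightarrow>\<^sub>0 'k) \<in> head_cobar a (int (length v)) (set (concat v))"
    using Cons by auto
  ultimately have "gen [l] * (add_head_word a v :: _ \<Rightarrow>\<^sub>0 'k)
      \<in> head_cobar a (1 + int (length v)) (set l \<union> set (concat v))"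
    using Cons.prems by (intro cobar_mult_head_cobar) auto
  moreover have "(gen ((a # l) # v) :: _ \<Rightarrow>\<^sub>0 'k) \<in> head_cobar a (1 + int (length v)) (set l \<union> set (concat v))"
    using Cons.prems unfolding head_cobar_def
    by (intro gen_in_free_on) (auto simp: head_words_def cobar_words_iff dest: tl)
  ultimately show ?case
    using free_mod.subspace_add[OF subspace_head_cobar] by (simp add: add.commute)
qed (simp add: free_mod.subspace_0[OF subspace_head_cobar])

lemma head_words_split_parts:
  assumes "u @ (a # G) # v \<in> head_words a n J" "a \<notin> J"
  shows "gen u \<in> cobar (int (length u)) (set (concat u))"
    "gen v \<in> cobar (int (length v)) (set (concat v))"
    "[] \<notin> set v" "distinct (concat v)" "a \<notin> set (concat u)" "a \<notin> set (concat v)"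
    "set (concat u) \<inter> set (concat v) = {}" "n = int (length u) + 1 + int (length v)"
    "set (concat u) \<union> set G \<union> set (concat v) = J"
  using assms by (auto simp: head_words_def cobar_words_iff intro!: cobar_gen)

lemma drop_head_cobar:
  fixes x :: "'a list list \<Rightarrow>\<^sub>0 'k::comm_ring_1"
  assumes x: "x \<in> head_cobar a n J" and "a \<notin> J"
  shows "drop_head a x \<in> cobar (n - 1) J"
  using x unfolding head_cobar_def
proof (rule linear_map_in_subspace[OF linear_map_drop_head subspace_cobar])
  fix w assume w: "w \<in> head_words a n J"
  then obtain u G v where *: "w = u @ (a # G) # v" "a \<notin> set (concat u)"
    by (rule head_words_split)
  note parts = head_words_split_parts[OF w[unfolded *(1)] assms(2)]
  have e: "drop_head a (gen w) = gen u * drop_head a (gen [a # G] * gen v :: _ \<Rightarrow>\<^sub>0 'k)"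
    using drop_head_avoiding_mult[OF gen_avoiding[OF *(2)], of "gen ((a # G) # v)"] by (simp add: *(1) del: head_homotopy_single)
  show "drop_head a (gen w :: _ \<Rightarrow>\<^sub>0 'k) \<in> cobar (n - 1) J"
  proof (cases "G = []")
    case True
    have "gen u * sign_twist (gen v :: _ \<Rightarrow>\<^sub>0 'k)
        \<in> cobar (int (length u) + int (length v)) (set (concat u) \<union> set (concat v))"
      by (intro cobar_mult sign_twist_cobar parts)
    with parts(8,9) show ?thesis
      unfolding e by (simp add: True head_homotopy_head_mult del: gen_mult sign_twist_single)
  next
    case False
    then show ?thesis
      unfolding e by (simp add: head_homotopy_head_mult free_mod.subspace_0[OF subspace_cobar] del: gen_mult)
  qed
qed

lemma head_homotopy_cobar:
  fixes x :: "'a list list \<Rightarrow>\<^sub>0 'k::comm_ring_1"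
  assumes x: "x \<in> head_cobar a n J" and "a \<notin> J"
  shows "head_homotopy a x \<in> head_cobar a (n - 1) J"
  using x unfolding head_cobar_def[of a n]
proof (rule linear_map_in_subspace[OF linear_map_head_homotopy subspace_head_cobar])
  fix w assume w: "w \<in> head_words a n J"
  then obtain u G v where *: "w = u @ (a # G) # v" "a \<notin> set (concat u)"
    by (rule head_words_split)
  note parts = head_words_split_parts[OF w[unfolded *(1)] assms(2)]
  have e: "head_homotopy a (gen w)
      = sign_twist (gen u) * head_homotopy a (gen [a # G] * gen v :: _ \<Rightarrow>\<^sub>0 'k)"
    using head_homotopy_avoiding_mult[OF gen_avoiding[OF *(2)], of "gen ((a # G) # v)"]
    by (simp add: *(1) del: head_homotopy_single sign_twist_single)
  show "head_homotopy a (gen w :: _ \<Rightarrow>\<^sub>0 'k) \<in> head_cobar a (n - 1) J"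
  proof (cases "G = []")
    case True
    have "sign_twist (gen u) * (add_head_word a v :: _ \<Rightarrow>\<^sub>0 'k)
        \<in> head_cobar a (int (length u) + int (length v)) (set (concat u) \<union> set (concat v))"
      by (intro cobar_mult_head_cobar sign_twist_cobar add_head_cobar parts)
    with parts(8,9) show ?thesis
      unfolding e by (simp add: True head_homotopy_head_mult free_mod.subspace_neg[OF subspace_head_cobar]
          del: gen_mult sign_twist_single)
  next
    case False
    then show ?thesis
      unfolding e by (simp add: head_homotopy_head_mult free_mod.subspace_0[OF subspace_head_cobar]
          del: gen_mult sign_twist_single)
  qed
qed

lemma mult_letter_cancel:
  fixes y z :: "'a list list \<Rightarrow>\<^sub>0 'k::comm_ring_1"
  assumes "y * gen [l] = z * gen [l]" shows "y = z"
proof -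
  have "lin_ext (\<lambda>w. gen (butlast w)) (x * gen [l]) = x" for x :: "'a list list \<Rightarrow>\<^sub>0 'k"
    by (rule linear_map_eqI[of _ _ x UNIV]) (auto intro!: linear_intros)
  then show ?thesis using assms by metis
qed

text \<open>A projection that is homotopic to the identity commutes with the differential; the last block \<open>[a]\<close>
  is a cocycle and can be cancelled.\<close>

lemma drop_head_cdiff:
  fixes x :: "'a list list \<Rightarrow>\<^sub>0 'k::comm_ring_1"
  assumes "x \<in> head_cobar a n J"
  shows "drop_head a (cdiff x) = cdiff (drop_head a x)"
proof (rule mult_letter_cancel)
  have "cdiff (head_homotopy a (cdiff x)) = cdiff x - cdiff (drop_head a x) * gen [[a]]"
    using arg_cong[OF head_homotopy_cdiff[OF assms], of cdiff]
    by (simp add: cdiff_simps cdiff_cdiff cdiff_mult del: cdiff_single)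
  moreover have "cdiff (head_homotopy a (cdiff x)) = cdiff x - drop_head a (cdiff x) * gen [[a]]"
    using head_homotopy_cdiff[OF cdiff_head_cobar[OF assms]] by (simp add: cdiff_cdiff head_homotopy_simps)
  ultimately show "drop_head a (cdiff x) * gen [[a]] = cdiff (drop_head a x) * gen [[a]]"
    by simp
qed

subsection \<open>Recursion for the cohomology\<close>

lemma subspace_boundaries: "free_mod.subspace (boundaries n I)"
  unfolding boundaries_def by (rule subspace_linear_image[OF linear_map_cdiff subspace_cobar])

lemma boundaries_mult_cocycle:
  assumes "x \<in> boundaries m A" "y \<in> cobar n B" "cdiff y = 0" "A \<inter> B = {}"
  shows "x * y \<in> boundaries (m + n) (A \<union> B)"
proof -
  from assms(1) obtain z where z: "z \<in> cobar (m - 1) A" "x = cdiff z" by (auto simp: boundaries_def)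
  then have "z * y \<in> cobar (m - 1 + n) (A \<union> B)" by (intro cobar_mult assms)
  moreover have "cdiff (z * y) = x * y" using z assms by (simp add: cdiff_mult)
  ultimately show ?thesis unfolding boundaries_def by (force simp: algebra_simps)
qed

lemma cocycle_mult_boundaries:
  assumes "y \<in> cobar n B" "cdiff y = 0" "x \<in> boundaries m A" "A \<inter> B = {}"
  shows "y * x \<in> boundaries (n + m) (B \<union> A)"
proof -
  from assms obtain z where z: "z \<in> cobar (m - 1) A" "x = cdiff z" by (auto simp: boundaries_def)
  then have "sign_twist y * z \<in> cobar (n + (m - 1)) (B \<union> A)"
    using assms by (intro cobar_mult sign_twist_cobar) auto
  moreover have "cdiff (sign_twist y) = 0"
    using sign_twist_cdiff[of y] assms(2) by (simp add: sign_twist_simps)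
  then have "cdiff (sign_twist y * z) = y * x"
    using z assms by (simp add: cdiff_mult)
  ultimately show ?thesis unfolding boundaries_def by (force simp: algebra_simps)
qed

lemma cycles_from_props:
  assumes "c \<in> cycles_from a I"
  shows "a \<in> set c" "set c \<subseteq> I" "distinct c" "c \<noteq> []"
  using assms hd_in_set[of c] by (auto simp: cycles_from_def)

lemma subst_heads_cycle_cobar:
  "c \<in> cycles_from a I \<Longrightarrow> x \<in> head_cobar a n (I - set c) \<Longrightarrow>
    subst_heads a (left_normed_poly c) x \<in> cobar n I"
  by (rule subst_heads_cobar[OF left_normed_poly_in_lin_orders]) (auto dest: cycles_from_props)

lemma subst_heads_mult_letter:
  assumes "y \<in> cobar n (I - set c)" "a \<in> set c"
  shows "subst_heads a b (y * gen [[a]]) = y * block b"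
proof -
  have "y \<in> avoiding a" using cobar_avoiding[OF assms(1)] assms(2) by auto
  then show ?thesis
    by (simp add: subst_heads_mult subst_heads_avoiding subst_head_def)
qed

lemma block_left_normed_cobar:
  assumes "c \<in> cycles_from a I"
  shows "block (left_normed_poly c) \<in> cobar 1 (set c)"
  using cycles_from_props[OF assms] by (intro block_in_cobar left_normed_poly_in_lin_orders) auto

lemma cdiff_block_left_normed [simp]: "cdiff (block (left_normed_poly c)) = 0"
  by (intro cdiff_block_primitive primitive_left_normed_poly)

text \<open>The decomposition into brackets is a decomposition of complexes, and the homotopy replaces the
  component of \<open>c\<close> by a word that ends with \<open>[a]\<close>. Substituting the bracket for \<open>a\<close> turns this last
  block into the factor of \<open>c\<close>.\<close>

lemma cocycle_split_bracket:
  fixes x :: "'a list list \<Rightarrow>\<^sub>0 'k::comm_ring_1"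
  assumes I: "finite I" "a \<in> I" and x: "x \<in> cobar (n + 1) I" "cdiff x = 0"
  obtains Y where "\<And>c. c \<in> cycles_from a I \<Longrightarrow> Y c \<in> cobar n (I - set c) \<and> cdiff (Y c) = 0"
    "x - (\<Sum>c\<in>cycles_from a I. Y c * block (left_normed_poly c)) \<in> boundaries (n + 1) I"
proof -
  obtain X where X: "\<And>c. c \<in> cycles_from a I \<Longrightarrow> X c \<in> head_cobar a (n + 1) (I - set c)"
    and xX: "x = bracket_sum a I X"
    using cobar_bracket_sum[OF I x(1)] by blast
  have "bracket_sum a I (\<lambda>c. cdiff (X c)) = cdiff x"
    unfolding xX bracket_sum_def cdiff_simps
    by (rule sum.cong[OF refl], rule cdiff_subst_heads[symmetric, OF primitive_left_normed_poly X])
  with x(2) have dX: "cdiff (X c) = 0" if "c \<in> cycles_from a I" for c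
    using bracket_sum_inj[OF I(1) cdiff_head_cobar[OF X] _ that] by simp
  define Y where "Y c = drop_head a (X c)" for c
  have Y: "Y c \<in> cobar n (I - set c)" "cdiff (Y c) = 0" if "c \<in> cycles_from a I" for c
    using drop_head_cobar[OF X[OF that]] drop_head_cdiff[OF X[OF that]] dX[OF that] cycles_from_props[OF that]
    by (auto simp: Y_def drop_head_simps)
  define z where "z = (\<Sum>c\<in>cycles_from a I. subst_heads a (left_normed_poly c) (head_homotopy a (X c)))"
  have H: "head_homotopy a (X c) \<in> head_cobar a n (I - set c)" if "c \<in> cycles_from a I" for c
    using head_homotopy_cobar[OF X[OF that]] cycles_from_props[OF that] by auto
  have "z \<in> cobar n I"
    unfolding z_def
    by (intro free_mod.subspace_sum[OF subspace_cobar] subst_heads_cycle_cobar H)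
  moreover have "cdiff z = x - (\<Sum>c\<in>cycles_from a I. Y c * block (left_normed_poly c))"
  proof -
    have "cdiff (subst_heads a (left_normed_poly c) (head_homotopy a (X c)))
        = subst_heads a (left_normed_poly c) (X c) - Y c * block (left_normed_poly c)"
      if c: "c \<in> cycles_from a I" for c
    proof -
      have "cdiff (head_homotopy a (X c)) = X c - Y c * gen [[a]]"
        using head_homotopy_cdiff[OF X[OF c]] dX[OF c] by (simp add: Y_def head_homotopy_simps)
      then show ?thesis
        using cdiff_subst_heads[OF primitive_left_normed_poly H[OF c]]
          subst_heads_mult_letter[OF Y(1)[OF c] cycles_from_props(1)[OF c]]
        by (simp add: subst_heads_simps)
    qed
    then show ?thesis
      unfolding z_def cdiff_simps xX bracket_sum_def by (simp add: sum_subtractf)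
  qed
  ultimately have "x - (\<Sum>c\<in>cycles_from a I. Y c * block (left_normed_poly c)) \<in> boundaries (n + 1) I"
    unfolding boundaries_def by (metis add_diff_cancel_right' image_eqI)
  with Y that show ?thesis by blast
qed

text \<open>By uniqueness of the decomposition every component is a coboundary by itself, and removing the last
  block \<open>[a]\<close> is compatible with the differential.\<close>

lemma boundary_split_bracket:
  fixes Y :: "'a list \<Rightarrow> ('a list list \<Rightarrow>\<^sub>0 'k::comm_ring_1)"
  assumes I: "finite I" "a \<in> I" and Y: "\<And>c. c \<in> cycles_from a I \<Longrightarrow> Y c \<in> cobar n (I - set c)"
    and b: "(\<Sum>c\<in>cycles_from a I. Y c * block (left_normed_poly c)) \<in> boundaries (n + 1) I"
    and c: "c \<in> cycles_from a I"
  shows "Y c \<in> boundaries n (I - set c)"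
proof -
  from b obtain z where z: "z \<in> cobar n I"
    "(\<Sum>c\<in>cycles_from a I. Y c * block (left_normed_poly c)) = cdiff z"
    by (auto simp: boundaries_def)
  obtain Z where Z: "\<And>c. c \<in> cycles_from a I \<Longrightarrow> Z c \<in> head_cobar a n (I - set c)"
    and zZ: "z = bracket_sum a I Z"
    using cobar_bracket_sum[OF I z(1)] by blast
  have Ya: "Y c * gen [[a]] \<in> head_cobar a (n + 1) (I - set c)" if "c \<in> cycles_from a I" for c
  proof -
    have "gen [[a]] \<in> head_cobar a 1 {}"
      by (auto simp: head_cobar_def head_words_def cobar_words_iff intro!: gen_in_free_on)
    from cobar_mult_head_cobar[OF Y[OF that] this] cycles_from_props[OF that] show ?thesis by simp
  qed
  have "bracket_sum a I (\<lambda>c. Y c * gen [[a]] - cdiff (Z c))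
      = (\<Sum>c\<in>cycles_from a I. Y c * block (left_normed_poly c))
        - (\<Sum>c\<in>cycles_from a I. cdiff (subst_heads a (left_normed_poly c) (Z c)))"
    unfolding bracket_sum_def sum_subtractf[symmetric] subst_heads_simps
    by (rule sum.cong[OF refl])
       (simp add: subst_heads_mult_letter[OF Y] cycles_from_props cdiff_subst_heads[OF primitive_left_normed_poly Z])
  also have "\<dots> = 0"
    using z(2) unfolding zZ bracket_sum_def cdiff_simps by simp
  finally have zero: "bracket_sum a I (\<lambda>c. Y c * gen [[a]] - cdiff (Z c)) = 0" .
  have "Y c * gen [[a]] - cdiff (Z c) = 0"
  proof (rule bracket_sum_inj[where X = "\<lambda>c. Y c * gen [[a]] - cdiff (Z c)", OF I(1) _ zero c])
    fix c assume c: "c \<in> cycles_from a I"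
    show "Y c * gen [[a]] - cdiff (Z c) \<in> head_cobar a (n + 1) (I - set c)"
      by (rule free_mod.subspace_diff[OF subspace_head_cobar Ya[OF c] cdiff_head_cobar[OF Z[OF c]]])
  qed
  then have "Y c * gen [[a]] = cdiff (Z c)" by simp
  then have "drop_head a (Y c * gen [[a]]) = cdiff (drop_head a (Z c))"
    using drop_head_cdiff[OF Z[OF c]] by simp
  moreover have "Y c \<in> avoiding a"
    using cobar_avoiding[OF Y[OF c]] cycles_from_props[OF c] by auto
  then have "drop_head a (Y c * gen [[a]]) = Y c"
    by (simp add: drop_head_avoiding_mult)
  moreover have "drop_head a (Z c) \<in> cobar (n - 1) (I - set c)"
    using drop_head_cobar[OF Z[OF c]] cycles_from_props[OF c] by auto
  ultimately show ?thesis unfolding boundaries_def by auto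
qed

section \<open>A basis of the cohomology\<close>

text \<open>Any choice works; it is made globally so that the index sets below depend on nothing but \<open>I\<close>.\<close>

definition pick :: "'a set \<Rightarrow> 'a" where
  "pick I = (SOME a. a \<in> I)"

lemma pick_in: "I \<noteq> {} \<Longrightarrow> pick I \<in> I"
  unfolding pick_def by (rule some_in_eq[THEN iffD2])

text \<open>The index set of the bases: decompositions of \<open>I\<close> into \<open>n\<close> cycles, where the first letter of every
  cycle and the order of the cycles are prescribed by \<open>pick\<close>.\<close>

fun cycle_lists :: "nat \<Rightarrow> 'a set \<Rightarrow> 'a list list set" where
  "cycle_lists 0 I = (if I = {} then {[]} else {})"
| "cycle_lists (Suc n) I = (if I = {} then {} else
     (\<Union>c\<in>cycles_from (pick I) I. (#) c ` cycle_lists n (I - set c)))"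

lemma finite_cycle_lists: "finite I \<Longrightarrow> finite (cycle_lists n I)"
  by (induction n arbitrary: I) (auto simp: finite_cycles_from)

lemma sum_cycle_lists:
  assumes "finite I" "I \<noteq> {}"
  shows "sum f (cycle_lists (Suc n) I) =
    (\<Sum>c\<in>cycles_from (pick I) I. \<Sum>cs\<in>cycle_lists n (I - set c). f (c # cs))"
proof -
  have "sum f (cycle_lists (Suc n) I) =
      (\<Sum>c\<in>cycles_from (pick I) I. sum f ((#) c ` cycle_lists n (I - set c)))"
    using assms by (simp, intro sum.UNION_disjoint) (auto simp: finite_cycles_from finite_cycle_lists)
  also have "\<dots> = (\<Sum>c\<in>cycles_from (pick I) I. \<Sum>cs\<in>cycle_lists n (I - set c). f (c # cs))"
    by (simp add: sum.reindex)
  finally show ?thesis .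
qed

text \<open>The first cycle gives the last factor, because the homotopy moves the chosen bracket to the end.\<close>

primrec bracket_product :: "'a list list \<Rightarrow> ('a list list \<Rightarrow>\<^sub>0 'k::comm_ring_1)" where
  "bracket_product [] = 1"
| "bracket_product (c # cs) = bracket_product cs * block (left_normed_poly c)"

lemma one_cobar: "1 \<in> cobar 0 {}"
  using cobar_gen[of "[]" 0 "{}"] by (simp add: cobar_words_iff)

lemma bracket_product_cobar:
  "cs \<in> cycle_lists n I \<Longrightarrow> bracket_product cs \<in> cobar (int n) I"
proof (induction n arbitrary: I cs)
  case (Suc n)
  then obtain c ds where cs: "cs = c # ds" "c \<in> cycles_from (pick I) I" "ds \<in> cycle_lists n (I - set c)"
    by (auto split: if_splits)
  have "(bracket_product cs :: _ \<Rightarrow>\<^sub>0 'b) \<in> cobar (int n + 1) ((I - set c) \<union> set c)"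
    unfolding cs(1) bracket_product.simps
    by (intro cobar_mult Suc.IH cs(3) block_left_normed_cobar[OF cs(2)]) auto
  with cycles_from_props(2)[OF cs(2)] show ?case
    by (simp add: Un_absorb2 add.commute)
qed (auto split: if_splits intro: one_cobar)

lemma cobar_trivial:
  "n > 0 \<Longrightarrow> cobar n {} = ({0} :: ('a list list \<Rightarrow>\<^sub>0 'k::comm_ring_1) set)"
  "I \<noteq> {} \<Longrightarrow> cobar 0 I = ({0} :: ('a list list \<Rightarrow>\<^sub>0 'k) set)"
  "n < 0 \<Longrightarrow> cobar n I = ({0} :: ('a list list \<Rightarrow>\<^sub>0 'k::comm_ring_1) set)"
proof -
  have *: "cobar n I = ({0} :: ('a list list \<Rightarrow>\<^sub>0 'k) set)" if "\<And>w. w \<notin> cobar_words n I" for n :: int and I :: "'a set"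
    using that by (auto simp: cobar_def free_on_def subset_iff poly_mapping_eq_iff fun_eq_iff in_keys_iff)
  have "w \<notin> cobar_words n {}" if "n > 0" for w :: "'a list list"
    using that by (cases w) (auto simp: cobar_words_iff)
  then show "n > 0 \<Longrightarrow> cobar n {} = ({0} :: ('a list list \<Rightarrow>\<^sub>0 'k) set)" by (intro *)
  show "I \<noteq> {} \<Longrightarrow> cobar 0 I = ({0} :: ('a list list \<Rightarrow>\<^sub>0 'k) set)"
    "n < 0 \<Longrightarrow> cobar n I = ({0} :: ('a list list \<Rightarrow>\<^sub>0 'k) set)"
    by (intro *; auto simp: cobar_words_iff)+
qed

lemma cobar_zero_empty: "x \<in> cobar 0 {} \<Longrightarrow> x = pm_scale (Poly_Mapping.lookup x []) 1"
proof -
  assume "x \<in> cobar 0 {}"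
  then have "Poly_Mapping.keys x \<subseteq> {[]}" by (auto simp: cobar_def free_on_def cobar_words_iff)
  then have "lin_ext gen x = pm_scale (Poly_Mapping.lookup x []) 1"
    by (subst lin_ext_superset[of "{[]}"]) auto
  moreover have "lin_ext gen x = x"
    by (rule linear_map_eqI[of _ _ x UNIV]) (auto intro!: linear_intros)
  ultimately show ?thesis by simp
qed

lemma boundaries_zero: "boundaries 0 I = {0}"
  by (auto simp: boundaries_def cobar_trivial cdiff_simps)

theorem bracket_products_span:
  fixes x :: "'a list list \<Rightarrow>\<^sub>0 'k::comm_ring_1"
  assumes "finite I" "x \<in> cobar (int n) I" "cdiff x = 0"
  shows "\<exists>f. x - (\<Sum>cs\<in>cycle_lists n I. pm_scale (f cs) (bracket_product cs)) \<in> boundaries (int n) I"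
  using assms
proof (induction n arbitrary: I x)
  case 0
  show ?case
  proof (cases "I = {}")
    case True
    with cobar_zero_empty[of x] 0 show ?thesis
      by (intro exI[of _ "\<lambda>_. Poly_Mapping.lookup x []"]) (simp add: boundaries_zero)
  next
    case False
    with 0 show ?thesis by (simp add: cobar_trivial boundaries_zero)
  qed
next
  case (Suc n)
  show ?case
  proof (cases "I = {}")
    case True
    with Suc.prems show ?thesis
      by (simp add: cobar_trivial free_mod.subspace_0[OF subspace_boundaries])
  next
    case False
    let ?C = "cycles_from (pick I) I"
    let ?b = "\<lambda>c. block (left_normed_poly c) :: 'a list list \<Rightarrow>\<^sub>0 'k"
    have "x \<in> cobar (int n + 1) I" using Suc.prems(2) by (simp add: add.commute)
    then obtain Y where Y: "\<And>c. c \<in> ?C \<Longrightarrow> Y c \<in> cobar (int n) (I - set c) \<and> cdiff (Y c) = 0"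
      "x - (\<Sum>c\<in>?C. Y c * ?b c) \<in> boundaries (int n + 1) I"
      using cocycle_split_bracket[OF Suc.prems(1) pick_in[OF False] _ Suc.prems(3)] by blast
    have "\<forall>c\<in>?C. \<exists>f. Y c - (\<Sum>cs\<in>cycle_lists n (I - set c). pm_scale (f cs) (bracket_product cs))
        \<in> boundaries (int n) (I - set c)"
      using Suc.IH Suc.prems(1) Y(1) by blast
    then obtain F where F: "\<And>c. c \<in> ?C \<Longrightarrow>
        Y c - (\<Sum>cs\<in>cycle_lists n (I - set c). pm_scale (F c cs) (bracket_product cs))
        \<in> boundaries (int n) (I - set c)"
      by metis
    have "(\<Sum>c\<in>?C. (Y c - (\<Sum>cs\<in>cycle_lists n (I - set c). pm_scale (F c cs) (bracket_product cs))) * ?b c)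
        \<in> boundaries (int n + 1) I"
    proof (intro free_mod.subspace_sum[OF subspace_boundaries])
      fix c assume c: "c \<in> ?C"
      have "(I - set c) \<union> set c = I" using cycles_from_props(2)[OF c] by auto
      with boundaries_mult_cocycle[OF F[OF c] block_left_normed_cobar[OF c]]
      show "(Y c - (\<Sum>cs\<in>cycle_lists n (I - set c). pm_scale (F c cs) (bracket_product cs))) * ?b c
          \<in> boundaries (int n + 1) I"
        by (simp add: Diff_disjoint Int_commute)
    qed
    from free_mod.subspace_add[OF subspace_boundaries Y(2) this]
    have "x - (\<Sum>c\<in>?C. (\<Sum>cs\<in>cycle_lists n (I - set c). pm_scale (F c cs) (bracket_product cs)) * ?b c)
        \<in> boundaries (int n + 1) I"
      by (simp add: left_diff_distrib sum_subtractf)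
    then show ?thesis
      by (intro exI[of _ "\<lambda>cs. F (hd cs) (tl cs)"])
         (simp add: sum_cycle_lists[OF Suc.prems(1) False] sum_distrib_right scale_mult_left add.commute
           del: cycle_lists.simps)
  qed
qed

text \<open>Both theorems iterate the splitting of one bracket. The uniqueness part applies to the coefficients of
  each bracket separately.\<close>

theorem bracket_products_independent:
  fixes f :: "'a list list \<Rightarrow> 'k::comm_ring_1"
  assumes "finite I" "(\<Sum>cs\<in>cycle_lists n I. pm_scale (f cs) (bracket_product cs)) \<in> boundaries (int n) I"
    and "cs \<in> cycle_lists n I"
  shows "f cs = 0"
  using assms
proof (induction n arbitrary: I f cs)
  case 0
  then have "I = {}" "cs = []" by (auto split: if_splits)
  with 0 have "pm_scale (f []) 1 = (0 :: 'a list list \<Rightarrow>\<^sub>0 'k)" by (simp add: boundaries_zero)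
  then have "Poly_Mapping.lookup (pm_scale (f []) (gen [] :: 'a list list \<Rightarrow>\<^sub>0 'k)) [] = 0" by simp
  then show ?case using \<open>cs = []\<close> by (simp del: gen_Nil)
next
  case (Suc n)
  then have ne: "I \<noteq> {}" by (auto split: if_splits)
  let ?C = "cycles_from (pick I) I"
  obtain c ds where cs: "cs = c # ds" "c \<in> ?C" "ds \<in> cycle_lists n (I - set c)"
    using Suc.prems(3) by (auto split: if_splits)
  define Y where "Y c = (\<Sum>cs\<in>cycle_lists n (I - set c). pm_scale (f (c # cs)) (bracket_product cs))"
    for c
  have Y: "Y c \<in> cobar (int n) (I - set c)" for c
    unfolding Y_def
    by (intro free_mod.subspace_sum[OF subspace_cobar] free_mod.subspace_scale[OF subspace_cobar]
        bracket_product_cobar)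
  have "(\<Sum>c\<in>?C. Y c * block (left_normed_poly c)) \<in> boundaries (int n + 1) I"
    using Suc.prems(2) unfolding sum_cycle_lists[OF Suc.prems(1) ne] Y_def
    by (simp add: sum_distrib_right scale_mult_left add.commute)
  from boundary_split_bracket[OF Suc.prems(1) pick_in[OF ne] Y this cs(2)]
  have "Y c \<in> boundaries (int n) (I - set c)" .
  then show ?case
    using Suc.IH[of "I - set c" "\<lambda>cs. f (c # cs)" ds] Suc.prems(1) cs by (simp add: Y_def)
qed

section \<open>Spanning sets modulo a submodule\<close>

text \<open>The sum of the submodule \<open>N\<close> and the span of \<open>X\<close>.\<close>

definition span_mod :: "('x \<Rightarrow>\<^sub>0 'k::comm_ring_1) set \<Rightarrow> 'x set \<Rightarrow> ('x \<Rightarrow>\<^sub>0 'k) set" where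
  "span_mod N X = {x. \<exists>p\<in>free_on X. x - p \<in> N}"

lemma subspace_span_mod:
  assumes "free_mod.subspace N" shows "free_mod.subspace (span_mod N X)"
  unfolding free_mod.subspace_def
proof (intro conjI allI impI ballI)
  show "0 \<in> span_mod N X"
    using free_mod.subspace_0[OF assms] free_mod.subspace_0[OF subspace_free_on, of X]
    by (auto simp: span_mod_def intro!: bexI[of _ 0])
next
  fix x y assume "x \<in> span_mod N X" "y \<in> span_mod N X"
  then obtain p q where "p \<in> free_on X" "x - p \<in> N" "q \<in> free_on X" "y - q \<in> N"
    by (auto simp: span_mod_def)
  then have "p + q \<in> free_on X" "(x - p) + (y - q) \<in> N"
    using assms by (auto intro: free_mod.subspace_add subspace_free_on)
  then show "x + y \<in> span_mod N X"
    unfolding span_mod_def by (intro CollectI bexI[of _ "p + q"]) (auto simp: algebra_simps)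
next
  fix c x assume "x \<in> span_mod N X"
  then obtain p where "p \<in> free_on X" "x - p \<in> N" by (auto simp: span_mod_def)
  then have "pm_scale c p \<in> free_on X" "pm_scale c (x - p) \<in> N"
    using assms by (auto intro: free_mod.subspace_scale subspace_free_on)
  then show "pm_scale c x \<in> span_mod N X"
    unfolding span_mod_def
    by (intro CollectI bexI[of _ "pm_scale c p"]) (auto simp: free_mod.scale_right_diff_distrib)
qed

lemma span_mod_gen: "free_mod.subspace N \<Longrightarrow> x \<in> X \<Longrightarrow> gen x \<in> span_mod N X"
  unfolding span_mod_def
  by (intro CollectI bexI[of _ "gen x"]) (auto simp: free_mod.subspace_0 gen_in_free_on)

lemma span_mod_submodule: "x \<in> N \<Longrightarrow> x \<in> span_mod N X"
  unfolding span_mod_def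
  by (intro CollectI bexI[of _ 0]) (auto simp: free_mod.subspace_0[OF subspace_free_on])

lemma span_mod_diff:
  assumes "free_mod.subspace N" "x - y \<in> N" "y \<in> span_mod N X"
  shows "x \<in> span_mod N X"
  using free_mod.subspace_add[OF subspace_span_mod[OF assms(1)] span_mod_submodule[OF assms(2)] assms(3)]
  by simp

lemma span_mod_linear_image:
  assumes "linear_map f" "free_mod.subspace N'" "\<And>x. x \<in> N \<Longrightarrow> f x \<in> span_mod N' Y"
    and "\<And>x. x \<in> X \<Longrightarrow> f (gen x) \<in> span_mod N' Y" "x \<in> span_mod N X"
  shows "f x \<in> span_mod N' Y"
proof -
  from assms(5) obtain p where p: "p \<in> free_on X" "x - p \<in> N" by (auto simp: span_mod_def)
  have "f p \<in> span_mod N' Y"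
    by (rule linear_map_in_subspace[OF assms(1) subspace_span_mod[OF assms(2)] p(1) assms(4)])
  from free_mod.subspace_add[OF subspace_span_mod[OF assms(2)] assms(3)[OF p(2)] this]
  show ?thesis by (simp add: linear_map_simps[OF assms(1)])
qed

lemma span_mod_sum:
  assumes "finite A" "inj_on g A" "x \<in> span_mod N (g ` A)"
  obtains f where "x - (\<Sum>a\<in>A. pm_scale (f a) (gen (g a))) \<in> N"
proof -
  from assms(3) obtain p where p: "p \<in> free_on (g ` A)" "x - p \<in> N" by (auto simp: span_mod_def)
  have "p = lin_ext gen p"
    by (rule linear_map_eqI[of _ _ p UNIV]) (auto intro!: linear_intros)
  also have "\<dots> = (\<Sum>y\<in>g ` A. pm_scale (Poly_Mapping.lookup p y) (gen y))"
    using assms(1) p(1) by (intro lin_ext_superset) (auto simp: free_on_def)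
  also have "\<dots> = (\<Sum>a\<in>A. pm_scale (Poly_Mapping.lookup p (g a)) (gen (g a)))"
    using assms(2) by (rule sum.reindex_cong) auto
  finally show ?thesis using p(2) that by metis
qed

section \<open>The multilinear part of the free Lie algebra\<close>

lemma subspace_lie_ideal: "free_mod.subspace (lie_ideal I)"
  unfolding free_mod.subspace_def by (auto intro: lie_ideal.intros)

lemma subspace_nonassoc_alg: "free_mod.subspace (nonassoc_alg I)"
  unfolding nonassoc_alg_def by (rule subspace_free_on)

lemmas bracket_simps =
  linear_map_simps[OF linear_map_bilin_ext(1)] linear_map_simps[OF linear_map_bilin_ext(2)]

lemma bracket_nonassoc_alg:
  assumes "p \<in> nonassoc_alg I" "q \<in> nonassoc_alg I" shows "bracket p q \<in> nonassoc_alg I"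
proof -
  have *: "bracket (gen s) q \<in> nonassoc_alg I" if "s \<in> {t. set_magma t \<subseteq> I}" for s
    by (rule linear_map_in_subspace[OF linear_map_bilin_ext(1) subspace_nonassoc_alg
          assms(2)[unfolded nonassoc_alg_def]])
       (use that in \<open>auto simp: nonassoc_alg_def intro!: gen_in_free_on\<close>)
  show ?thesis
    by (rule linear_map_in_subspace[OF linear_map_bilin_ext(2) subspace_nonassoc_alg
          assms(1)[unfolded nonassoc_alg_def] *])
qed

lemma bracket_antisym:
  assumes "p \<in> nonassoc_alg I" "q \<in> nonassoc_alg I"
  shows "bracket p q + bracket q p \<in> lie_ideal I"
proof -
  have "p + q \<in> nonassoc_alg I" using assms by (rule free_mod.subspace_add[OF subspace_nonassoc_alg])
  from free_mod.subspace_diff[OF subspace_lie_ideal free_mod.subspace_diff[OF subspace_lie_ideal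
      lie_ideal.alternating[OF this] lie_ideal.alternating[OF assms(1)]] lie_ideal.alternating[OF assms(2)]]
  show ?thesis by (simp add: bracket_simps algebra_simps)
qed

text \<open>The Jacobi law as a derivation property of bracketing from the right.\<close>

lemma bracket_derivation:
  assumes "p \<in> nonassoc_alg I" "q \<in> nonassoc_alg I" "r \<in> nonassoc_alg I"
  shows "bracket p (bracket q r) - (bracket (bracket p q) r - bracket (bracket p r) q) \<in> lie_ideal I"
proof -
  let ?J = "bracket p (bracket q r) + bracket q (bracket r p) + bracket r (bracket p q)"
  have 1: "?J \<in> lie_ideal I" using assms by (rule lie_ideal.jacobi)
  have 2: "bracket q (bracket p r + bracket r p) \<in> lie_ideal I"
    by (intro lie_ideal.left bracket_antisym assms)
  have 3: "bracket q (bracket p r) + bracket (bracket p r) q \<in> lie_ideal I"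
    by (intro bracket_antisym bracket_nonassoc_alg assms)
  have 4: "bracket r (bracket p q) + bracket (bracket p q) r \<in> lie_ideal I"
    by (intro bracket_antisym bracket_nonassoc_alg assms)
  have "bracket p (bracket q r) - (bracket (bracket p q) r - bracket (bracket p r) q) =
    ?J - bracket q (bracket p r + bracket r p) + (bracket q (bracket p r) + bracket (bracket p r) q)
      - (bracket r (bracket p q) + bracket (bracket p q) r)"
    by (simp add: bracket_simps algebra_simps)
  also have "\<dots> \<in> lie_ideal I"
    by (intro free_mod.subspace_diff[OF subspace_lie_ideal] free_mod.subspace_add[OF subspace_lie_ideal] 1 2 3 4)
  finally show ?thesis .
qed

definition full_cycles :: "'a \<Rightarrow> 'a set \<Rightarrow> 'a list set" where
  "full_cycles a F = {c \<in> cycles_from a F. set c = F}"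

lemma full_cycles_props:
  assumes "c \<in> full_cycles a F"
  shows "c \<noteq> []" "hd c = a" "distinct c" "set c = F"
  using assms by (auto simp: full_cycles_def cycles_from_def)

lemma set_magma_leaves: "set_magma t = set (leaves t)"
  by (induction t) auto

text \<open>Induction on the tree \<open>r\<close>: a letter prolongs the left-normed bracket, and for \<open>r = [r\<^sub>1, r\<^sub>2]\<close> the bracket
  with \<open>r\<close> is the commutator of the brackets with \<open>r\<^sub>1\<close> and \<open>r\<^sub>2\<close>.\<close>

lemma span_mod_bracket:
  fixes y :: "'a magma \<Rightarrow>\<^sub>0 'k::comm_ring_1"
  assumes "y \<in> span_mod (lie_ideal I) (left_normed ` full_cycles a Y)" "y \<in> nonassoc_alg I"
    and "distinct (leaves r)" "set (leaves r) \<inter> Y = {}" "set (leaves r) \<subseteq> I"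
  shows "bracket y (gen r) \<in> span_mod (lie_ideal I) (left_normed ` full_cycles a (Y \<union> set (leaves r)))"
  using assms
proof (induction r arbitrary: y Y)
  case (Gen x)
  show ?case
  proof (rule span_mod_linear_image[OF linear_map_bilin_ext(2) subspace_lie_ideal _ _ Gen.prems(1)])
    fix z :: "'a magma \<Rightarrow>\<^sub>0 'k" assume "z \<in> lie_ideal I"
    then show "bracket z (gen (Gen x)) \<in> span_mod (lie_ideal I) (left_normed ` full_cycles a (Y \<union> set (leaves (Gen x))))"
      using Gen.prems(5)
      by (intro span_mod_submodule lie_ideal.right) (auto simp: nonassoc_alg_def intro!: gen_in_free_on)
  next
    fix t assume "t \<in> left_normed ` full_cycles a Y"
    then obtain c where c: "c \<in> full_cycles a Y" "t = left_normed c" by auto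
    have "c @ [x] \<in> full_cycles a (Y \<union> {x})"
      using full_cycles_props[OF c(1)] Gen.prems(4) by (auto simp: full_cycles_def cycles_from_def)
    then have "left_normed (c @ [x]) \<in> left_normed ` full_cycles a (Y \<union> {x})" by (rule imageI)
    then show "bracket (gen t) (gen (Gen x)) \<in> span_mod (lie_ideal I) (left_normed ` full_cycles a (Y \<union> set (leaves (Gen x))))"
      using full_cycles_props[OF c(1)] by (auto simp: c(2) intro!: span_mod_gen subspace_lie_ideal)
  qed
next
  case (Br r s)
  let ?S = "\<lambda>Z. span_mod (lie_ideal I) (left_normed ` full_cycles a Z) :: ('a magma \<Rightarrow>\<^sub>0 'k) set"
  have na: "gen r \<in> nonassoc_alg I" "gen s \<in> nonassoc_alg I"
    using Br.prems by (auto simp: nonassoc_alg_def set_magma_leaves intro!: gen_in_free_on)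
  have "bracket y (gen r) \<in> ?S (Y \<union> set (leaves r))" "bracket y (gen s) \<in> ?S (Y \<union> set (leaves s))"
    using Br.prems by (intro Br.IH; auto)+
  then have "bracket (bracket y (gen r)) (gen s) \<in> ?S (Y \<union> set (leaves r) \<union> set (leaves s))"
    "bracket (bracket y (gen s)) (gen r) \<in> ?S (Y \<union> set (leaves s) \<union> set (leaves r))"
    using Br.prems na by (intro Br.IH bracket_nonassoc_alg; auto)+
  then have "bracket (bracket y (gen r)) (gen s) - bracket (bracket y (gen s)) (gen r)
      \<in> ?S (Y \<union> set (leaves (Br r s)))"
    by (intro free_mod.subspace_diff[OF subspace_span_mod[OF subspace_lie_ideal]]) (auto simp: ac_simps)
  with bracket_derivation[OF Br.prems(2) na] show ?case
    by (auto intro: span_mod_diff[OF subspace_lie_ideal])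
qed

text \<open>By antisymmetry the letter \<open>a\<close> may be assumed to lie in the left subtree, which is a combination of
  left-normed brackets by induction.\<close>

lemma left_normed_span_magma:
  assumes "distinct (leaves t)" "a \<in> set (leaves t)" "set (leaves t) \<subseteq> I"
  shows "gen t \<in> span_mod (lie_ideal I :: ('a magma \<Rightarrow>\<^sub>0 'k::comm_ring_1) set)
    (left_normed ` full_cycles a (set (leaves t)))"
  using assms
proof (induction t)
  case (Gen x)
  then have "[x] \<in> full_cycles a {x}" by (auto simp: full_cycles_def cycles_from_def)
  then have "left_normed [x] \<in> left_normed ` full_cycles a {x}" by (rule imageI)
  then show ?case by (intro span_mod_gen subspace_lie_ideal) simp
next
  case (Br s r)
  let ?S = "\<lambda>Z. span_mod (lie_ideal I) (left_normed ` full_cycles a Z) :: ('a magma \<Rightarrow>\<^sub>0 'k) set"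
  have na: "(gen s :: _ \<Rightarrow>\<^sub>0 'k) \<in> nonassoc_alg I" "(gen r :: _ \<Rightarrow>\<^sub>0 'k) \<in> nonassoc_alg I"
    using Br.prems by (auto simp: nonassoc_alg_def set_magma_leaves intro!: gen_in_free_on)
  have e: "gen (Br s r) = bracket (gen s) (gen r :: _ \<Rightarrow>\<^sub>0 'k)" by simp
  show ?case
  proof (cases "a \<in> set (leaves s)")
    case True
    with Br show ?thesis unfolding e leaves.simps set_append
      by (intro span_mod_bracket) (auto simp: na)
  next
    case False
    with Br have "bracket (gen r) (gen s) \<in> ?S (set (leaves r) \<union> set (leaves s))"
      by (intro span_mod_bracket) (auto simp: na)
    then have "- bracket (gen r) (gen s) \<in> ?S (set (leaves (Br s r)))"
      using free_mod.subspace_neg[OF subspace_span_mod[OF subspace_lie_ideal]] by (simp add: Un_commute)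
    moreover have "bracket (gen s) (gen r) - - bracket (gen r) (gen s :: _ \<Rightarrow>\<^sub>0 'k) \<in> lie_ideal I"
      using bracket_antisym[OF na] by simp
    ultimately show ?thesis unfolding e by (rule span_mod_diff[OF subspace_lie_ideal, rotated])
  qed
qed

lemma left_normed_span:
  fixes x :: "'a magma \<Rightarrow>\<^sub>0 'k::comm_ring_1"
  assumes "x \<in> multilinear_part F" "a \<in> F" "finite F"
  obtains f where "x - (\<Sum>c\<in>full_cycles a F. pm_scale (f c) (gen (left_normed c))) \<in> lie_ideal F"
proof -
  have mem: "x \<in> span_mod (lie_ideal F) (left_normed ` full_cycles a F)"
    using assms(1) unfolding multilinear_part_def
  proof (rule linear_map_in_subspace[OF linear_map_basic(1) subspace_span_mod[OF subspace_lie_ideal]])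
    fix t assume "t \<in> {t. leaves t \<in> permutations_of_set F}"
    then have "distinct (leaves t)" "set (leaves t) = F" by (auto simp: permutations_of_set_def)
    then show "gen t \<in> span_mod (lie_ideal F :: (_ \<Rightarrow>\<^sub>0 'k) set) (left_normed ` full_cycles a F)"
      using left_normed_span_magma[of t a F] assms(2) by simp
  qed
  have "finite (full_cycles a F)"
    using finite_cycles_from[OF assms(3)] by (simp add: full_cycles_def)
  moreover have "inj_on left_normed (full_cycles a F)"
    by (rule inj_onI) (metis full_cycles_props(1) leaves_left_normed)
  ultimately obtain f where "x - (\<Sum>c\<in>full_cycles a F. pm_scale (f c) (gen (left_normed c))) \<in> lie_ideal F"
    using mem by (rule span_mod_sum)
  then show ?thesis by (rule that)
qed

section \<open>Quotients and maps between them\<close>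

lemma in_residue_class: "free_mod.subspace N \<Longrightarrow> x \<in> residue_class N x"
  by (simp add: residue_class_def free_mod.subspace_0)

lemma residue_class_eq_iff:
  assumes "free_mod.subspace N"
  shows "residue_class N x = residue_class N y \<longleftrightarrow> x - y \<in> N"
proof
  assume "residue_class N x = residue_class N y"
  with in_residue_class[OF assms, of x] have "x \<in> residue_class N y" by simp
  then show "x - y \<in> N" by (simp add: residue_class_def)
next
  assume *: "x - y \<in> N"
  have "z - x \<in> N \<longleftrightarrow> z - y \<in> N" for z
    using free_mod.subspace_add[OF assms _ *, of "z - x"] free_mod.subspace_diff[OF assms _ *, of "z - y"]
    by auto
  then show "residue_class N x = residue_class N y" by (simp add: residue_class_def)
qed

text \<open>This and the next lemma turn the operations of the quotients, defined as unions over all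
  representatives, into operations on one representative.\<close>

lemma on_classes_residue_class:
  assumes "free_mod.subspace N" "free_mod.subspace N'" "linear_map f" "\<And>x. x \<in> N \<Longrightarrow> f x \<in> N'"
  shows "on_classes N' f (residue_class N x) = residue_class N' (f x)"
proof -
  have "residue_class N' (f y) = residue_class N' (f x)" if "y \<in> residue_class N x" for y
  proof -
    from that have "y - x \<in> N" by (simp add: residue_class_def)
    from assms(4)[OF this] show ?thesis
      by (simp add: residue_class_eq_iff[OF assms(2)] linear_map_simps[OF assms(3)])
  qed
  then have "on_classes N' f (residue_class N x) = (\<Union>y\<in>residue_class N x. residue_class N' (f x))"
    unfolding on_classes_def by (intro SUP_cong refl)
  moreover have "residue_class N x \<noteq> {}"
    using in_residue_class[OF assms(1), of x] by blast
  ultimately show ?thesis by (simp only: UN_constant if_False)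
qed

lemma on_classes2_residue_class:
  assumes "free_mod.subspace N1" "free_mod.subspace N2" "free_mod.subspace N'"
    and "\<And>x' y'. x' - x \<in> N1 \<Longrightarrow> y' - y \<in> N2 \<Longrightarrow> f x' y' - f x y \<in> N'"
  shows "on_classes2 N' f (residue_class N1 x) (residue_class N2 y) = residue_class N' (f x y)"
proof -
  have "residue_class N' (f x' y') = residue_class N' (f x y)"
    if "x' \<in> residue_class N1 x" "y' \<in> residue_class N2 y" for x' y'
  proof -
    from that have "x' - x \<in> N1" "y' - y \<in> N2" by (simp_all add: residue_class_def)
    from assms(4)[OF this] show ?thesis by (simp add: residue_class_eq_iff[OF assms(3)])
  qed
  then have "on_classes2 N' f (residue_class N1 x) (residue_class N2 y) =
      (\<Union>x'\<in>residue_class N1 x. \<Union>y'\<in>residue_class N2 y. residue_class N' (f x y))"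
    unfolding on_classes2_def by (intro SUP_cong refl)
  moreover have "residue_class N1 x \<noteq> {}" "residue_class N2 y \<noteq> {}"
    using in_residue_class[OF assms(1), of x] in_residue_class[OF assms(2), of y] by blast+
  ultimately show ?thesis by (simp only: UN_constant if_False)
qed

lemma quotient_module_simps:
  "carrier (quotient_module M N) = residue_class N ` M"
  "\<zero>\<^bsub>quotient_module M N\<^esub> = N"
  by (simp_all add: quotient_module_def)

lemma quotient_module_add:
  assumes "free_mod.subspace N"
  shows "residue_class N x \<oplus>\<^bsub>quotient_module M N\<^esub> residue_class N y = residue_class N (x + y)"
proof -
  have "x' + y' - (x + y) \<in> N" if "x' - x \<in> N" "y' - y \<in> N" for x' y'
    using free_mod.subspace_add[OF assms that] by (simp add: algebra_simps)
  then show ?thesis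
    by (simp add: quotient_module_def on_classes2_residue_class[OF assms assms assms])
qed

lemma quotient_module_smult:
  assumes "free_mod.subspace N"
  shows "c \<odot>\<^bsub>quotient_module M N\<^esub> residue_class N x = residue_class N (pm_scale c x)"
  by (simp add: quotient_module_def)
     (rule on_classes_residue_class[OF assms assms],
      auto intro!: linear_intros free_mod.subspace_scale assms)

lemma residue_class_zero: "residue_class N 0 = N"
  by (simp add: residue_class_def)

section \<open>The free graded commutative algebra\<close>

lemma compositions_mset: "mset Fs = mset Gs \<Longrightarrow> Fs \<in> compositions I \<longleftrightarrow> Gs \<in> compositions I"
  by (metis (no_types, lifting) compositions_def mem_Collect_eq mset_eq_imp_distinct_iff mset_eq_setD)

lemma compositions_append:
  assumes "Fs \<in> compositions A" "Gs \<in> compositions B" "A \<inter> B = {}"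
  shows "Fs @ Gs \<in> compositions (A \<union> B)"
proof -
  have "F \<inter> G = {}" if "F \<in> set Fs" "G \<in> set Gs" for F G
    using that assms unfolding compositions_def partition_on_def by blast
  moreover have "{} \<notin> set Fs" using assms by (auto simp: compositions_def partition_on_def)
  ultimately have "set Fs \<inter> set Gs = {}" by (metis Int_absorb disjoint_iff)
  moreover have "\<Union>(set Fs) = A" "\<Union>(set Gs) = B"
    using assms by (simp_all add: compositions_def partition_on_def)
  then have "partition_on (A \<union> B) (set Fs \<union> set Gs)"
    using assms by (auto simp: compositions_def partition_on_def intro!: disjoint_union)
  ultimately show ?thesis using assms by (auto simp: compositions_def)
qed

lemma compositions_snoc:
  assumes "Fs @ [F] \<in> compositions I"
  shows "F \<noteq> {}" "F \<subseteq> I" "Fs \<in> compositions (I - F)"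
proof -
  have d: "distinct Fs" "F \<notin> set Fs" and p: "partition_on I (insert F (set Fs))"
    using assms by (auto simp: compositions_def)
  show "F \<noteq> {}" "F \<subseteq> I" using p by (auto simp: partition_on_def)
  have pw: "A \<inter> B = {}" if "A \<in> insert F (set Fs)" "B \<in> insert F (set Fs)" "A \<noteq> B" for A B
    using p that unfolding partition_on_def disjoint_def by metis
  have "F \<inter> G = {}" if "G \<in> set Fs" for G
    using pw[of F G] d(2) that by auto
  then have "disjnt F (\<Union>(set Fs))" unfolding disjnt_def by blast
  moreover have "F \<union> \<Union>(set Fs) = I" using p by (simp add: partition_on_def)
  ultimately have "\<Union>(set Fs) = I - F" unfolding disjnt_def by blast
  moreover have "disjoint (set Fs)" "{} \<notin> set Fs"
    using p pw by (auto simp: partition_on_def disjoint_def)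
  ultimately have "partition_on (I - F) (set Fs)" by (simp add: partition_on_def)
  then show "Fs \<in> compositions (I - F)" using d by (simp add: compositions_def)
qed

lemma compositions_singleton: "F \<noteq> {} \<Longrightarrow> [F] \<in> compositions F"
  by (simp add: compositions_def partition_on_space)

lemma compositions_empty: "[] \<in> compositions I \<longleftrightarrow> I = {}"
  by (auto simp: compositions_def partition_on_def)

lemma sym_words_append:
  assumes "u \<in> sym_words V m A" "v \<in> sym_words V n B" "A \<inter> B = {}"
  shows "u @ v \<in> sym_words V (m + n) (A \<union> B)"
  using assms by (auto simp: sym_words_def intro: compositions_append)

lemma sym_words_mset: "mset u = mset v \<Longrightarrow> u \<in> sym_words V n I \<longleftrightarrow> v \<in> sym_words V n I"
  using compositions_mset[of "map fst u" "map fst v" I]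
  by (simp add: sym_words_def) (metis mset_eq_length mset_eq_setD)

lemma subspace_sym_relations: "free_mod.subspace (sym_relations V n I)"
  unfolding sym_relations_def by (rule free_mod.subspace_span)

lemma sym_relationsI: "r \<in> sym_relators V n I \<Longrightarrow> r \<in> sym_relations V n I"
  unfolding sym_relations_def by (rule free_mod.span_base)

lemma sym_relations_linear_image:
  assumes "linear_map f" "free_mod.subspace S" "\<And>r. r \<in> sym_relators V n I \<Longrightarrow> f r \<in> S"
    and "x \<in> sym_relations V n I"
  shows "f x \<in> S"
  using free_mod.span_minimal[of "sym_relators V n I" "{x. f x \<in> S}"]
    subspace_linear_preimage[OF assms(1,2)] assms(3,4)
  unfolding sym_relations_def by blast

lemma sym_relators_mult_word:
  fixes V :: "('a, 'k::comm_ring_1, 'v) species"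
  assumes r: "r \<in> sym_relators V m A" and w: "w \<in> sym_words V n B" and d: "A \<inter> B = {}"
  shows "r * gen w \<in> sym_relators V (m + n) (A \<union> B)"
  using r
proof cases
  case (additive u F x v y)
  show ?thesis
    using sym_relators.additive[of u F x "v @ w" V "m + n" "A \<union> B" y]
      sym_words_append[OF additive(2) w d] sym_words_append[OF additive(3) w d]
    by (simp add: additive(1) left_diff_distrib)
next
  case (homogeneous u F x v c)
  show ?thesis
    using sym_relators.homogeneous[of u F x "v @ w" V "m + n" "A \<union> B" c]
      sym_words_append[OF homogeneous(2) w d]
    by (simp add: homogeneous(1) left_diff_distrib)
next
  case (anticommutative u a b v)
  show ?thesis
    using sym_relators.anticommutative[of u a b "v @ w" V "m + n" "A \<union> B"]
      sym_words_append[OF anticommutative(2) w d]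
    by (simp add: anticommutative(1) distrib_right)
qed

lemma word_mult_sym_relators:
  fixes V :: "('a, 'k::comm_ring_1, 'v) species"
  assumes r: "r \<in> sym_relators V m A" and w: "w \<in> sym_words V n B" and d: "A \<inter> B = {}"
  shows "gen w * r \<in> sym_relators V (n + m) (B \<union> A)"
proof -
  have d': "B \<inter> A = {}" using d by auto
  show ?thesis using r
  proof cases
    case (additive u F x v y)
    show ?thesis
      using sym_relators.additive[of "w @ u" F x v V "n + m" "B \<union> A" y]
        sym_words_append[OF w additive(2) d'] sym_words_append[OF w additive(3) d']
      by (simp add: additive(1) right_diff_distrib)
  next
    case (homogeneous u F x v c)
    show ?thesis
      using sym_relators.homogeneous[of "w @ u" F x v V "n + m" "B \<union> A" c]
        sym_words_append[OF w homogeneous(2) d']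
      by (simp add: homogeneous(1) right_diff_distrib)
  next
    case (anticommutative u a b v)
    show ?thesis
      using sym_relators.anticommutative[of "w @ u" a b v V "n + m" "B \<union> A"]
        sym_words_append[OF w anticommutative(2) d']
      by (simp add: anticommutative(1) distrib_left)
  qed
qed

lemma sym_relations_mult:
  fixes V :: "('a, 'k::comm_ring_1, 'v) species"
  assumes r: "r \<in> sym_relations V m A" and y: "y \<in> free_on (sym_words V n B)" and d: "A \<inter> B = {}"
  shows "r * y \<in> sym_relations V (m + n) (A \<union> B)" "y * r \<in> sym_relations V (n + m) (B \<union> A)"
proof -
  have 1: "r * gen w \<in> sym_relations V (m + n) (A \<union> B)" if w: "w \<in> sym_words V n B" for w
    by (rule sym_relations_linear_image[of "\<lambda>x. x * gen w", OF _ subspace_sym_relations _ r])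
       (auto intro!: linear_intros sym_relationsI sym_relators_mult_word w d)
  have 2: "gen w * r \<in> sym_relations V (n + m) (B \<union> A)" if w: "w \<in> sym_words V n B" for w
    by (rule sym_relations_linear_image[of "\<lambda>x. gen w * x", OF _ subspace_sym_relations _ r])
       (auto intro!: linear_intros sym_relationsI word_mult_sym_relators w d)
  show "r * y \<in> sym_relations V (m + n) (A \<union> B)"
    by (rule linear_map_in_subspace[OF linear_map_mult_left subspace_sym_relations y 1])
  show "y * r \<in> sym_relations V (n + m) (B \<union> A)"
    by (rule linear_map_in_subspace[OF linear_map_mult_right subspace_sym_relations y 2])
qed

lemma sym_move_last:
  fixes V :: "('a, 'k::comm_ring_1, 'v) species"
  assumes "u @ x # v \<in> sym_words V n I"
  shows "gen (u @ x # v) - pm_scale ((- 1) ^ length v) (gen (u @ v @ [x])) \<in> sym_relations V n I"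
  using assms
proof (induction v arbitrary: u)
  case (Cons b v)
  have "gen (u @ x # b # v) + gen (u @ b # x # v) \<in> sym_relations V n I"
    using Cons.prems by (intro sym_relationsI sym_relators.anticommutative)
  moreover have "u @ b # x # v \<in> sym_words V n I"
    using Cons.prems by (subst sym_words_mset[of _ "u @ x # b # v"]) auto
  with Cons.IH[of "u @ [b]"]
  have "gen (u @ b # x # v) - pm_scale ((- 1) ^ length v) (gen (u @ b # v @ [x])) \<in> sym_relations V n I"
    by simp
  ultimately have "(gen (u @ x # b # v) + gen (u @ b # x # v))
      - (gen (u @ b # x # v) - pm_scale ((- 1) ^ length v) (gen (u @ b # v @ [x]))) \<in> sym_relations V n I"
    by (rule free_mod.subspace_diff[OF subspace_sym_relations])
  then show ?case by (simp add: single_uminus)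
qed (simp add: free_mod.subspace_0[OF subspace_sym_relations])

subsection \<open>The species Lie\<close>

abbreviation lie_class :: "'a set \<Rightarrow> ('a magma \<Rightarrow>\<^sub>0 'k::comm_ring_1) \<Rightarrow> ('a magma \<Rightarrow>\<^sub>0 'k) set" where
  "lie_class F \<equiv> residue_class (lie_ideal F)"

lemma Lie_simps:
  "carrier (sp_val Lie_species F) = lie_class F ` multilinear_part F"
  "lie_class F x \<oplus>\<^bsub>sp_val Lie_species F\<^esub> lie_class F y = lie_class F (x + y)"
  "c \<odot>\<^bsub>sp_val Lie_species F\<^esub> lie_class F x = lie_class F (pm_scale c x)"
  by (simp_all add: Lie_species_def quotient_module_simps quotient_module_add quotient_module_smult
      subspace_lie_ideal)

lemma subspace_multilinear_part: "free_mod.subspace (multilinear_part F)"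
  unfolding multilinear_part_def by (rule subspace_free_on)

lemma sym_words_replace:
  assumes "u @ (F, z) # v \<in> sym_words V n I" "z' \<in> carrier (sp_val V F)"
  shows "u @ (F, z') # v \<in> sym_words V n I"
  using assms by (auto simp: sym_words_def)

lemma sym_relators_Lie_free_on:
  fixes r :: "('a set \<times> ('a magma \<Rightarrow>\<^sub>0 'k::comm_ring_1) set) list \<Rightarrow>\<^sub>0 'k"
  assumes "r \<in> sym_relators Lie_species n I"
  shows "r \<in> free_on (sym_words Lie_species n I)"
  using assms
proof cases
  case (additive u F x v y)
  then obtain p q where "p \<in> multilinear_part F" "q \<in> multilinear_part F" "x = lie_class F p" "y = lie_class F q"
    by (auto simp: sym_words_def Lie_simps)
  then have "x \<oplus>\<^bsub>sp_val Lie_species F\<^esub> y \<in> carrier (sp_val Lie_species F)"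
    using free_mod.subspace_add[OF subspace_multilinear_part] by (auto simp: Lie_simps)
  from sym_words_replace[OF additive(2) this] additive show ?thesis
    by (auto intro!: free_mod.subspace_diff subspace_free_on gen_in_free_on)
next
  case (homogeneous u F x v c)
  then obtain p where "p \<in> multilinear_part F" "x = lie_class F p"
    by (auto simp: sym_words_def Lie_simps)
  then have "c \<odot>\<^bsub>sp_val Lie_species F\<^esub> x \<in> carrier (sp_val Lie_species F)"
    using free_mod.subspace_scale[OF subspace_multilinear_part] by (auto simp: Lie_simps)
  from sym_words_replace[OF homogeneous(2) this] homogeneous show ?thesis
    by (auto intro!: free_mod.subspace_diff subspace_free_on gen_in_free_on)
next
  case (anticommutative u a b v)
  have "u @ b # a # v \<in> sym_words Lie_species n I"
    using anticommutative by (subst sym_words_mset[of _ "u @ a # b # v"]) auto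
  with anticommutative show ?thesis
    by (auto intro!: free_mod.subspace_add subspace_free_on gen_in_free_on)
qed

text \<open>Multiplying representatives of classes requires that representatives stay words of the right shape.\<close>

lemma sym_relations_Lie_free_on:
  "x \<in> sym_relations Lie_species n I \<Longrightarrow> x \<in> free_on (sym_words Lie_species n I)"
  by (rule sym_relations_linear_image[OF linear_map_basic(1) subspace_free_on sym_relators_Lie_free_on])

text \<open>The relations make each factor of a word multilinear.\<close>

lemma sym_expand_factor:
  fixes m :: "'i \<Rightarrow> ('a magma \<Rightarrow>\<^sub>0 'k::comm_ring_1)"
  assumes w: "u @ (F, z) # v \<in> sym_words Lie_species n I"
    and C: "finite C" "\<And>c. c \<in> C \<Longrightarrow> m c \<in> multilinear_part F"
  shows "gen (u @ (F, lie_class F (\<Sum>c\<in>C. pm_scale (k c) (m c))) # v)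
     - (\<Sum>c\<in>C. pm_scale (k c) (gen (u @ (F, lie_class F (m c)) # v))) \<in> sym_relations Lie_species n I"
proof -
  let ?w = "\<lambda>x. gen (u @ (F, lie_class F x) # v) :: _ \<Rightarrow>\<^sub>0 'k"
  let ?R = "sym_relations Lie_species n I :: (_ \<Rightarrow>\<^sub>0 'k) set"
  have word: "u @ (F, lie_class F x) # v \<in> sym_words Lie_species n I" if "x \<in> multilinear_part F" for x :: "_ \<Rightarrow>\<^sub>0 'k"
    by (rule sym_words_replace[OF w]) (use that in \<open>auto simp: Lie_simps\<close>)
  have scale: "?w (pm_scale c x) - pm_scale c (?w x) \<in> ?R" if "x \<in> multilinear_part F" for c x
    using sym_relationsI[OF sym_relators.homogeneous[OF word[OF that], of c]] by (simp add: Lie_simps)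
  have add: "?w (x + y) - ?w x - ?w y \<in> ?R" if "x \<in> multilinear_part F" "y \<in> multilinear_part F" for x y
    using sym_relationsI[OF sym_relators.additive[OF word[OF that(1)] word[OF that(2)]]] by (simp add: Lie_simps)
  show ?thesis
    using C
  proof (induction C)
    case empty
    show ?case using scale[of 0 0] by (simp add: free_mod.subspace_0[OF subspace_multilinear_part])
  next
    case (insert c C)
    have S: "(\<Sum>c\<in>C. pm_scale (k c) (m c)) \<in> multilinear_part F"
      using insert.prems by (intro free_mod.subspace_sum free_mod.subspace_scale subspace_multilinear_part) auto
    have mc: "pm_scale (k c) (m c) \<in> multilinear_part F"
      using insert.prems by (intro free_mod.subspace_scale subspace_multilinear_part) auto
    let ?S = "\<Sum>c\<in>C. pm_scale (k c) (m c)"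
    have "?w (pm_scale (k c) (m c) + ?S) - (pm_scale (k c) (?w (m c)) + (\<Sum>c\<in>C. pm_scale (k c) (?w (m c))))
      = (?w (pm_scale (k c) (m c) + ?S) - ?w (pm_scale (k c) (m c)) - ?w ?S)
        + (?w (pm_scale (k c) (m c)) - pm_scale (k c) (?w (m c)))
        + (?w ?S - (\<Sum>c\<in>C. pm_scale (k c) (?w (m c))))"
      by simp
    also have "\<dots> \<in> ?R"
      using insert.IH insert.prems
      by (intro free_mod.subspace_add[OF subspace_sym_relations] add S mc scale) auto
    finally show ?case using insert.hyps by simp
  qed
qed

definition sym_cycles :: "'a list list \<Rightarrow> ('a set \<times> ('a magma \<Rightarrow>\<^sub>0 'k::comm_ring_1) set) list" where
  "sym_cycles cs = map (\<lambda>c. (set c, lie_class (set c) (gen (left_normed c)))) (rev cs)"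

lemma sym_cycles_simps:
  "sym_cycles [] = []"
  "sym_cycles (c # cs) = sym_cycles cs @ [(set c, lie_class (set c) (gen (left_normed c)))]"
  by (simp_all add: sym_cycles_def)

lemma left_normed_multilinear:
  "c \<noteq> [] \<Longrightarrow> distinct c \<Longrightarrow> gen (left_normed c) \<in> multilinear_part (set c)"
  by (auto simp: multilinear_part_def permutations_of_set_def leaves_left_normed intro!: gen_in_free_on)

lemma bracket_letter_sym_words:
  assumes "c \<noteq> []" "distinct c"
  shows "[(set c, lie_class (set c) (gen (left_normed c)))] \<in> sym_words Lie_species 1 (set c)"
  using assms by (auto simp: sym_words_def compositions_singleton Lie_simps left_normed_multilinear)

lemma sym_cycles_sym_words:
  "cs \<in> cycle_lists n I \<Longrightarrow>
    (sym_cycles cs :: ('a set \<times> ('a magma \<Rightarrow>\<^sub>0 'k::comm_ring_1) set) list) \<in> sym_words Lie_species (int n) I"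
proof (induction n arbitrary: I cs)
  case 0
  then show ?case by (auto simp: sym_words_def sym_cycles_simps compositions_empty split: if_splits)
next
  case (Suc n)
  then obtain c ds where cs: "cs = c # ds" "c \<in> cycles_from (pick I) I" "ds \<in> cycle_lists n (I - set c)"
    by (auto split: if_splits)
  note c = cycles_from_props[OF cs(2)]
  have "(sym_cycles cs :: ('a set \<times> ('a magma \<Rightarrow>\<^sub>0 'k) set) list)
      \<in> sym_words Lie_species (int n + 1) ((I - set c) \<union> set c)"
    unfolding cs(1) sym_cycles_simps
    by (intro sym_words_append Suc.IH cs bracket_letter_sym_words c) auto
  then show ?case using c(2) by (simp add: Un_absorb2 add.commute)
qed

text \<open>By anticommutativity the factor containing the chosen letter can be moved to the end, and
  by multilinearity it may be taken to be a left-normed bracket.\<close>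

theorem sym_cycles_span:
  fixes w :: "('a set \<times> ('a magma \<Rightarrow>\<^sub>0 'k::comm_ring_1) set) list"
  assumes "finite I" "w \<in> sym_words Lie_species (int n) I"
  shows "gen w \<in> span_mod (sym_relations (Lie_species :: ('a, 'k, _) species) (int n) I)
    (sym_cycles ` cycle_lists n I)"
  using assms
proof (induction n arbitrary: I w)
  case 0
  then have "w = []" "I = {}" by (auto simp: sym_words_def compositions_empty)
  then show ?case
    by (intro span_mod_gen subspace_sym_relations) (simp add: sym_cycles_simps)
next
  case (Suc n)
  let ?R = "sym_relations (Lie_species :: ('a, 'k, _) species)"
  let ?S = "\<lambda>n I. span_mod (?R (int n) I) (sym_cycles ` cycle_lists n I)"
  have sub: "free_mod.subspace (?S n I)" for n I
    by (intro subspace_span_mod subspace_sym_relations)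
  define a where "a = pick I"
  have comp: "map fst w \<in> compositions I" "int (length w) = int n + 1"
    using Suc.prems by (auto simp: sym_words_def)
  then obtain G where "G \<in> set (map fst w)" by (cases w) auto
  then have "G \<noteq> {}" "G \<subseteq> I" using comp(1) by (auto simp: compositions_def partition_on_def)
  then have "I \<noteq> {}" by auto
  then have "a \<in> I" unfolding a_def by (rule pick_in)
  then obtain F z where Fz: "(F, z) \<in> set w" "a \<in> F"
    using comp(1) by (force simp: compositions_def partition_on_def)
  then obtain u v where w: "w = u @ (F, z) # v" by (metis split_list)
  have wl: "(u @ v) @ [(F, z)] \<in> sym_words Lie_species (int (Suc n)) I"
    using Suc.prems by (subst sym_words_mset[of _ w]) (auto simp: w)
  have "map fst (u @ v) @ [F] \<in> compositions I" using wl by (simp add: sym_words_def)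
  note F = compositions_snoc[OF this]
  have uv: "u @ v \<in> sym_words Lie_species (int n) (I - F)"
    using wl F(3) by (auto simp: sym_words_def)
  obtain x where x: "x \<in> multilinear_part F" "z = lie_class F x"
    using wl by (auto simp: sym_words_def Lie_simps)
  have finF: "finite F" using F(2) Suc.prems(1) by (rule finite_subset)
  let ?C = "full_cycles a F"
  obtain k where k: "x - (\<Sum>c\<in>?C. pm_scale (k c) (gen (left_normed c))) \<in> lie_ideal F"
    using left_normed_span[OF x(1) Fz(2) finF] .
  have C: "finite ?C" using finite_cycles_from[OF finF] by (simp add: full_cycles_def)
  have ln: "(gen (left_normed c) :: _ \<Rightarrow>\<^sub>0 'k) \<in> multilinear_part F" if "c \<in> ?C" for c
    using left_normed_multilinear[of c] full_cycles_props[OF that] by simp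
  have z: "z = lie_class F (\<Sum>c\<in>?C. pm_scale (k c) (gen (left_normed c)))"
    using k by (simp add: x(2) residue_class_eq_iff[OF subspace_lie_ideal])
  have letter: "gen ((u @ v) @ [(F, lie_class F (gen (left_normed c)))]) \<in> ?S (Suc n) I" if c: "c \<in> ?C" for c
  proof -
    let ?l = "(F, lie_class F (gen (left_normed c)) :: (_ \<Rightarrow>\<^sub>0 'k) set)"
    have F': "set c = F" "(I - F) \<inter> F = {}" "(I - F) \<union> F = I" using full_cycles_props[OF c] F(2) by auto
    have cy: "c \<in> cycles_from (pick I) I"
      using c F(2) by (auto simp: full_cycles_def cycles_from_def a_def)
    have l: "[?l] \<in> sym_words Lie_species 1 F"
      using bracket_letter_sym_words[of c, where ?'b = 'k] full_cycles_props[OF c] by simp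
    have "gen (u @ v) * gen [?l] \<in> ?S (Suc n) I"
    proof (rule span_mod_linear_image[OF linear_map_mult_right subspace_sym_relations, of "?R (int n) (I - F)"])
      show "gen (u @ v) \<in> ?S n (I - F)" using Suc.IH[OF _ uv] Suc.prems(1) by simp
    next
      fix r assume "r \<in> ?R (int n) (I - F)"
      from sym_relations_mult(1)[OF this, of "gen [?l]" 1 F] l F'
      show "r * gen [?l] \<in> ?S (Suc n) I"
        by (intro span_mod_submodule) (simp add: gen_in_free_on add.commute)
    next
      fix y :: "('a set \<times> ('a magma \<Rightarrow>\<^sub>0 'k) set) list"
      assume "y \<in> sym_cycles ` cycle_lists n (I - F)"
      then obtain cs where cs: "cs \<in> cycle_lists n (I - set c)" "y = sym_cycles cs"
        using F' by auto
      then have "c # cs \<in> cycle_lists (Suc n) I" using cy \<open>I \<noteq> {}\<close> by auto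
      then have "sym_cycles (c # cs) \<in> sym_cycles ` cycle_lists (Suc n) I" by (rule imageI)
      then have "y @ [?l] \<in> sym_cycles ` cycle_lists (Suc n) I"
        by (simp only: sym_cycles_simps cs F'(1))
      then show "gen y * gen [?l] \<in> ?S (Suc n) I"
        by (simp only: gen_mult mult_1) (intro span_mod_gen subspace_sym_relations)
    qed
    then show ?thesis by simp
  qed
  have 1: "(\<Sum>c\<in>?C. pm_scale (k c) (gen ((u @ v) @ [(F, lie_class F (gen (left_normed c)))]))) \<in> ?S (Suc n) I"
    by (rule free_mod.subspace_sum[OF sub], rule free_mod.subspace_scale[OF sub], rule letter)
  have 2: "gen ((u @ v) @ [(F, z)])
      - (\<Sum>c\<in>?C. pm_scale (k c) (gen ((u @ v) @ [(F, lie_class F (gen (left_normed c)))])))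
      \<in> ?R (int (Suc n)) I"
    unfolding z by (rule sym_expand_factor[OF wl C ln])
  from free_mod.subspace_scale[OF sub span_mod_diff[OF subspace_sym_relations 2 1], of "(- 1) ^ length v"]
  have 3: "pm_scale ((- 1) ^ length v) (gen (u @ v @ [(F, z)])) \<in> ?S (Suc n) I"
    by (simp only: append_assoc)
  have 4: "gen w - pm_scale ((- 1) ^ length v) (gen (u @ v @ [(F, z)])) \<in> ?R (int (Suc n)) I"
    unfolding w by (rule sym_move_last) (use Suc.prems(2) w in simp)
  show ?case by (rule span_mod_diff[OF subspace_sym_relations 4 3])
qed

section \<open>The comparison map\<close>

lemma compositions_append_split:
  assumes "Fs @ Gs \<in> compositions I"
  shows "Fs \<in> compositions (\<Union>(set Fs))" "Gs \<in> compositions (\<Union>(set Gs))"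
    "\<Union>(set Fs) \<inter> \<Union>(set Gs) = {}" "\<Union>(set Fs) \<union> \<Union>(set Gs) = I"
proof -
  have p: "partition_on I (set Fs \<union> set Gs)" and d: "distinct Fs" "distinct Gs" "set Fs \<inter> set Gs = {}"
    using assms by (auto simp: compositions_def)
  have pw: "A \<inter> B = {}" if "A \<in> set Fs \<union> set Gs" "B \<in> set Fs \<union> set Gs" "A \<noteq> B" for A B
    using p that unfolding partition_on_def disjoint_def by metis
  have ne: "{} \<notin> set Fs \<union> set Gs" using p by (simp add: partition_on_def)
  show "Fs \<in> compositions (\<Union>(set Fs))" "Gs \<in> compositions (\<Union>(set Gs))"
    using d pw ne by (simp_all add: compositions_def partition_on_def disjoint_def)
  have "F \<inter> G = {}" if "F \<in> set Fs" "G \<in> set Gs" for F G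
    using pw[of F G] d(3) that by blast
  then show "\<Union>(set Fs) \<inter> \<Union>(set Gs) = {}" by blast
  show "\<Union>(set Fs) \<union> \<Union>(set Gs) = I" using p by (auto simp: partition_on_def)
qed

definition blocks_union :: "('a set \<times> 'v) list \<Rightarrow> 'a set" where
  "blocks_union w = \<Union>(set (map fst w))"

lemma sym_words_append_split:
  assumes "u @ v \<in> sym_words V n I"
  shows "u \<in> sym_words V (int (length u)) (blocks_union u)" "v \<in> sym_words V (int (length v)) (blocks_union v)"
    "blocks_union u \<inter> blocks_union v = {}" "blocks_union u \<union> blocks_union v = I"
  using assms compositions_append_split[of "map fst u" "map fst v" I]
  by (auto simp: sym_words_def blocks_union_def)

definition lie_rep :: "('a magma \<Rightarrow>\<^sub>0 'k::comm_ring_1) set \<Rightarrow> ('a list \<Rightarrow>\<^sub>0 'k)" where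
  "lie_rep z = lie_poly (SOME x. x \<in> z)"

text \<open>The arbitrary choice of a representative is harmless, since Lie polynomials vanish on the ideal.\<close>

lemma lie_rep_class [simp]: "lie_rep (lie_class F x) = lie_poly x"
proof -
  have "(SOME y. y \<in> lie_class F x) \<in> lie_class F x"
    by (rule someI) (rule in_residue_class[OF subspace_lie_ideal])
  then have "lie_poly ((SOME y. y \<in> lie_class F x) - x) = 0"
    by (intro lie_poly_lie_ideal[of _ F]) (simp add: residue_class_def)
  then show ?thesis by (simp add: lie_rep_def lie_poly_simps)
qed

primrec comparison_word :: "('a set \<times> ('a magma \<Rightarrow>\<^sub>0 'k::comm_ring_1) set) list \<Rightarrow> ('a list list \<Rightarrow>\<^sub>0 'k)" where
  "comparison_word [] = 1"
| "comparison_word (p # w) = block (lie_rep (snd p)) * comparison_word w"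

definition comparison ::
  "(('a set \<times> ('a magma \<Rightarrow>\<^sub>0 'k::comm_ring_1) set) list \<Rightarrow>\<^sub>0 'k) \<Rightarrow> ('a list list \<Rightarrow>\<^sub>0 'k)" where
  "comparison = lin_ext comparison_word"

lemma linear_map_comparison: "linear_map comparison"
  unfolding comparison_def by (rule linear_map_lin_ext)

lemmas linear_map_comparisonI [linear_intros] = linear_map_compose[OF linear_map_comparison]
lemmas comparison_simps = linear_map_simps[OF linear_map_comparison]

lemma comparison_single [simp]: "comparison (Poly_Mapping.single w c) = pm_scale c (comparison_word w)"
  by (simp add: comparison_def)

lemma comparison_one [simp]: "comparison 1 = (1 :: 'a list list \<Rightarrow>\<^sub>0 'k::comm_ring_1)"
  using comparison_single[of "[] :: ('a set \<times> ('a magma \<Rightarrow>\<^sub>0 'k) set) list" 1] by simp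

lemma comparison_word_append: "comparison_word (u @ v) = comparison_word u * comparison_word v"
  by (induction u) (simp_all add: mult.assoc)

lemma comparison_mult: "comparison (x * y) = comparison x * comparison y"
  by (rule bilinear_map_eqI[of _ _ x UNIV y UNIV])
     (auto intro!: linear_intros simp: comparison_word_append)

lemma comparison_sym_cycles: "comparison_word (sym_cycles cs) = bracket_product cs"
  by (induction cs) (simp_all add: sym_cycles_simps comparison_word_append left_normed_poly_def)

lemma cdiff_comparison_word [simp]: "cdiff (comparison_word w) = 0"
  by (induction w) (simp_all add: cdiff_mult lie_rep_def cdiff_block_primitive primitive_lie_poly)

lemma cdiff_comparison: "cdiff (comparison x) = 0"
  by (rule linear_map_eqI[of _ _ x UNIV]) (auto intro!: linear_intros)

lemma comparison_word_cobar:
  fixes w :: "('a set \<times> ('a magma \<Rightarrow>\<^sub>0 'k::comm_ring_1) set) list"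
  shows "w \<in> sym_words Lie_species n I \<Longrightarrow> comparison_word w \<in> cobar n I"
proof (induction w arbitrary: n I rule: rev_induct)
  case Nil
  then show ?case by (simp add: sym_words_def compositions_empty one_cobar)
next
  case (snoc p w)
  obtain F z where p: "p = (F, z)" by force
  have c: "map fst w @ [F] \<in> compositions I" using snoc.prems by (simp add: sym_words_def p)
  obtain x where x: "x \<in> multilinear_part F" "z = lie_class F x"
    using snoc.prems by (auto simp: sym_words_def p Lie_simps)
  have n: "n = int (length w) + 1" using snoc.prems by (simp add: sym_words_def)
  have "w \<in> sym_words Lie_species (int (length w)) (I - F)"
    using snoc.prems compositions_snoc(3)[OF c] by (auto simp: sym_words_def)
  then have "comparison_word w * block (lie_poly x) \<in> cobar (int (length w) + 1) ((I - F) \<union> F)"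
    using compositions_snoc(1)[OF c]
    by (intro cobar_mult snoc.IH block_in_cobar lie_poly_in_lin_orders x) auto
  moreover have "(I - F) \<union> F = I" using compositions_snoc(2)[OF c] by auto
  ultimately show ?case by (simp add: comparison_word_append p x(2) n)
qed

lemma comparison_cobar: "x \<in> free_on (sym_words Lie_species n I) \<Longrightarrow> comparison x \<in> cobar n I"
  by (rule linear_map_in_subspace[OF linear_map_comparison subspace_cobar]) (auto simp: comparison_word_cobar)

text \<open>The sum of the two products contains the anticommutator of two primitive elements, a coboundary,
  between cocycles.\<close>

lemma comparison_anticommute:
  fixes u v :: "('a set \<times> ('a magma \<Rightarrow>\<^sub>0 'k::comm_ring_1) set) list"
  assumes w: "u @ a # b # v \<in> sym_words Lie_species n I"
  shows "comparison_word (u @ a # b # v) + comparison_word (u @ b # a # v) \<in> boundaries n I"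
proof -
  obtain F y G z where ab: "a = (F, y)" "b = (G, z)" by force
  obtain p q where pq: "p \<in> multilinear_part F" "y = lie_class F p" "q \<in> multilinear_part G" "z = lie_class G q"
    using w by (auto simp: sym_words_def ab Lie_simps)
  note u = sym_words_append_split[OF w]
  have "[a, b] @ v \<in> sym_words Lie_species (int (length (a # b # v))) (blocks_union (a # b # v))"
    using u(2) by simp
  note v = sym_words_append_split[OF this]
  have "[a] @ [b] \<in> sym_words Lie_species (int (length [a, b])) (blocks_union [a, b])"
    using v(1) by simp
  note ab' = sym_words_append_split[OF this]
  have FG: "blocks_union [a, b] = F \<union> G" "F \<inter> G = {}" "F \<noteq> {}"
    using ab'(1,3) by (auto simp: blocks_union_def ab sym_words_def compositions_def partition_on_def)
  define c where "c = cdiff (block (lie_poly p * lie_poly q))"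
  have c: "c = - (block (lie_poly p) * block (lie_poly q) + block (lie_poly q) * block (lie_poly p))"
    unfolding c_def by (rule cdiff_block_mult_primitive[OF primitive_lie_poly primitive_lie_poly])
  have "c \<in> boundaries 2 (F \<union> G)"
    unfolding c_def boundaries_def using FG
    by (intro imageI) (auto intro!: block_in_cobar lin_orders_mult lie_poly_in_lin_orders pq)
  moreover have "(F \<union> G) \<inter> blocks_union v = {}" using v(3) FG(1) by auto
  ultimately have cv: "c * comparison_word v \<in> boundaries (2 + int (length v)) ((F \<union> G) \<union> blocks_union v)"
    by (rule boundaries_mult_cocycle[OF _ comparison_word_cobar[OF v(2)] cdiff_comparison_word])
  have "((F \<union> G) \<union> blocks_union v) \<inter> blocks_union u = {}"
    using u(3) v(4) FG(1) by auto
  then have "comparison_word u * (c * comparison_word v) \<in>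
      boundaries (int (length u) + (2 + int (length v))) (blocks_union u \<union> ((F \<union> G) \<union> blocks_union v))"
    by (rule cocycle_mult_boundaries[OF comparison_word_cobar[OF u(1)] cdiff_comparison_word cv])
  moreover have "blocks_union u \<union> ((F \<union> G) \<union> blocks_union v) = I"
    using u(4) v(4) FG(1) by simp
  moreover have "int (length u) + (2 + int (length v)) = n"
    using w by (simp add: sym_words_def)
  ultimately have "- (comparison_word u * (c * comparison_word v)) \<in> boundaries n I"
    by (metis free_mod.subspace_neg[OF subspace_boundaries])
  then show ?thesis
    by (simp add: comparison_word_append ab pq(2,4) c algebra_simps)
qed

lemma comparison_sym_relators:
  fixes r :: "('a set \<times> ('a magma \<Rightarrow>\<^sub>0 'k::comm_ring_1) set) list \<Rightarrow>\<^sub>0 'k"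
  assumes "r \<in> sym_relators Lie_species n I"
  shows "comparison r \<in> boundaries n I"
  using assms
proof cases
  case (additive u F x v y)
  then obtain p q where "x = lie_class F p" "y = lie_class F q"
    by (auto simp: sym_words_def Lie_simps)
  then have "comparison r = 0"
    by (simp add: additive(1) comparison_simps comparison_word_append Lie_simps lie_poly_simps block_simps algebra_simps)
  then show ?thesis by (simp add: free_mod.subspace_0[OF subspace_boundaries])
next
  case (homogeneous u F x v c)
  then obtain p where "x = lie_class F p"
    by (auto simp: sym_words_def Lie_simps)
  then have "comparison r = 0"
    by (simp add: homogeneous(1) comparison_simps comparison_word_append Lie_simps lie_poly_simps block_simps
        scale_mult_left scale_mult_right)
  then show ?thesis by (simp add: free_mod.subspace_0[OF subspace_boundaries])
next
  case (anticommutative u a b v)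
  then show ?thesis
    using comparison_anticommute[OF anticommutative(2)] by (simp add: comparison_simps)
qed

lemma comparison_sym_relations:
  "x \<in> sym_relations Lie_species n I \<Longrightarrow> comparison x \<in> boundaries n I"
  by (rule sym_relations_linear_image[OF linear_map_comparison subspace_boundaries comparison_sym_relators])

text \<open>Equal words would have equal images, but the images of different indices are independent.\<close>

lemma inj_on_sym_cycles:
  assumes "finite I"
  shows "inj_on (sym_cycles :: _ \<Rightarrow> ('a set \<times> ('a magma \<Rightarrow>\<^sub>0 'k::comm_ring_1) set) list) (cycle_lists n I)"
proof (rule inj_onI, rule ccontr)
  fix cs ds
  assume *: "cs \<in> cycle_lists n I" "ds \<in> cycle_lists n I" "cs \<noteq> ds"
    and eq: "sym_cycles cs = (sym_cycles ds :: ('a set \<times> ('a magma \<Rightarrow>\<^sub>0 'k) set) list)"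
  let ?f = "\<lambda>es. (if es = cs then 1 else 0) - (if es = ds then 1 else 0) :: 'k"
  have "(\<Sum>es\<in>cycle_lists n I. pm_scale (?f es) (bracket_product es)) =
      (\<Sum>es\<in>cycle_lists n I. (if es = cs then bracket_product es else 0)
         - (if es = ds then bracket_product es else 0 :: _ \<Rightarrow>\<^sub>0 'k))"
    by (intro sum.cong refl) (auto simp: free_mod.scale_left_diff_distrib)
  also have "\<dots> = bracket_product cs - bracket_product ds"
    using * finite_cycle_lists[OF assms, of n] by (simp add: sum_subtractf)
  also have "\<dots> = 0"
    using arg_cong[OF eq, of comparison_word] by (simp add: comparison_sym_cycles)
  finally have "?f cs = 0"
    using * by (intro bracket_products_independent[OF assms, of ?f n])
      (auto simp: free_mod.subspace_0[OF subspace_boundaries])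
  then show False using *(3) by simp
qed

lemma sym_cycles_express:
  fixes x :: "('a set \<times> ('a magma \<Rightarrow>\<^sub>0 'k::comm_ring_1) set) list \<Rightarrow>\<^sub>0 'k"
  assumes "finite I" "x \<in> free_on (sym_words Lie_species (int n) I)"
  obtains f where "x - (\<Sum>cs\<in>cycle_lists n I. pm_scale (f cs) (gen (sym_cycles cs)))
    \<in> sym_relations Lie_species (int n) I"
proof -
  have "x \<in> span_mod (sym_relations Lie_species (int n) I) (sym_cycles ` cycle_lists n I)"
    by (rule linear_map_in_subspace[OF linear_map_basic(1) subspace_span_mod[OF subspace_sym_relations] assms(2)])
       (rule sym_cycles_span[OF assms(1)])
  from span_mod_sum[OF finite_cycle_lists[OF assms(1)] inj_on_sym_cycles[OF assms(1)] this] that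
  show ?thesis by blast
qed

lemma sym_cycles_independent:
  fixes f :: "'a list list \<Rightarrow> 'k::comm_ring_1"
  assumes "finite I" "(\<Sum>cs\<in>cycle_lists n I. pm_scale (f cs) (comparison (gen (sym_cycles cs)))) \<in> boundaries (int n) I"
    and "cs \<in> cycle_lists n I"
  shows "f cs = 0"
  using bracket_products_independent[OF assms(1) _ assms(3), of f] assms(2) by (simp add: comparison_sym_cycles)

lemma sym_words_negative: "n < 0 \<Longrightarrow> sym_words V n I = {}"
  by (auto simp: sym_words_def)

text \<open>An element is a combination of the spanning words modulo the relations; if its image is a coboundary,
  all coefficients vanish.\<close>

theorem comparison_injective:
  fixes x :: "('a set \<times> ('a magma \<Rightarrow>\<^sub>0 'k::comm_ring_1) set) list \<Rightarrow>\<^sub>0 'k"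
  assumes "finite I" "x \<in> free_on (sym_words Lie_species n I)" "comparison x \<in> boundaries n I"
  shows "x \<in> sym_relations Lie_species n I"
proof (cases "n < 0")
  case True
  then have "x = 0" using assms(2) by (simp add: sym_words_negative free_on_def)
  then show ?thesis by (simp add: free_mod.subspace_0[OF subspace_sym_relations])
next
  case False
  then obtain m where n: "n = int m" by (metis nonneg_int_cases not_less)
  obtain f where f: "x - (\<Sum>cs\<in>cycle_lists m I. pm_scale (f cs) (gen (sym_cycles cs)))
    \<in> sym_relations Lie_species n I"
    using sym_cycles_express[OF assms(1), of x m] assms(2) n by blast
  have e: "comparison x - comparison (x - (\<Sum>cs\<in>cycle_lists m I. pm_scale (f cs) (gen (sym_cycles cs))))
      = (\<Sum>cs\<in>cycle_lists m I. pm_scale (f cs) (comparison (gen (sym_cycles cs))))"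
    by (simp only: comparison_simps) simp
  have "comparison x - comparison (x - (\<Sum>cs\<in>cycle_lists m I. pm_scale (f cs) (gen (sym_cycles cs)))) \<in> boundaries n I"
    by (intro free_mod.subspace_diff[OF subspace_boundaries] assms(3) comparison_sym_relations f)
  then have "(\<Sum>cs\<in>cycle_lists m I. pm_scale (f cs) (comparison (gen (sym_cycles cs)))) \<in> boundaries (int m) I"
    unfolding e n .
  then have "f cs = 0" if "cs \<in> cycle_lists m I" for cs
    using sym_cycles_independent[OF assms(1)] that by blast
  then show ?thesis using f by simp
qed

theorem comparison_surjective:
  fixes x :: "'a list list \<Rightarrow>\<^sub>0 'k::comm_ring_1"
  assumes "finite I" "x \<in> cobar n I" "cdiff x = 0"
  obtains y where "y \<in> free_on (sym_words Lie_species n I)" "x - comparison y \<in> boundaries n I"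
proof (cases "n < 0")
  case True
  then have "x = 0" using assms(2) cobar_trivial(3) by blast
  then show ?thesis
    using that[of 0] by (simp add: comparison_simps free_mod.subspace_0[OF subspace_free_on]
        free_mod.subspace_0[OF subspace_boundaries])
next
  case False
  then obtain m where n: "n = int m" by (metis nonneg_int_cases not_less)
  obtain f where f: "x - (\<Sum>cs\<in>cycle_lists m I. pm_scale (f cs) (bracket_product cs)) \<in> boundaries (int m) I"
    using bracket_products_span[OF assms(1), of x m] assms(2,3) n by blast
  show ?thesis
  proof (rule that)
    show "(\<Sum>cs\<in>cycle_lists m I. pm_scale (f cs) (gen (sym_cycles cs))) \<in> free_on (sym_words Lie_species n I)"
      unfolding n
      by (intro free_mod.subspace_sum free_mod.subspace_scale subspace_free_on gen_in_free_on sym_cycles_sym_words)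
    show "x - comparison (\<Sum>cs\<in>cycle_lists m I. pm_scale (f cs) (gen (sym_cycles cs))) \<in> boundaries n I"
      using f by (simp add: comparison_simps comparison_sym_cycles n)
  qed
qed

subsection \<open>Naturality\<close>

definition relabel_magma :: "('a \<Rightarrow> 'b) \<Rightarrow> ('a magma \<Rightarrow>\<^sub>0 'k::comm_ring_1) \<Rightarrow> ('b magma \<Rightarrow>\<^sub>0 'k)" where
  "relabel_magma \<sigma> = lin_ext (\<lambda>t. gen (map_magma \<sigma> t))"

lemma linear_map_relabel_magma: "linear_map (relabel_magma \<sigma>)"
  unfolding relabel_magma_def by (rule linear_map_lin_ext)

lemmas linear_map_relabel_magmaI [linear_intros] = linear_map_compose[OF linear_map_relabel_magma]
lemmas relabel_magma_simps = linear_map_simps[OF linear_map_relabel_magma]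

lemma relabel_magma_bracket:
  "relabel_magma \<sigma> (bracket p q) = bracket (relabel_magma \<sigma> p) (relabel_magma \<sigma> q)"
  by (rule bilinear_map_eqI[of "\<lambda>p q. relabel_magma \<sigma> (bracket p q)" _ p UNIV q UNIV])
     (auto intro!: linear_intros linear_map_compose[OF linear_map_bilin_ext(1)]
        linear_map_compose[OF linear_map_bilin_ext(2)] simp: relabel_magma_def)

lemma relabel_magma_nonassoc_alg:
  "p \<in> nonassoc_alg I \<Longrightarrow> relabel_magma \<sigma> p \<in> nonassoc_alg (\<sigma> ` I)"
  unfolding nonassoc_alg_def
  by (rule linear_map_in_subspace[OF linear_map_relabel_magma subspace_free_on])
     (auto simp: relabel_magma_def magma.set_map intro!: gen_in_free_on, blast)

lemma relabel_magma_lie_ideal: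
  "x \<in> lie_ideal I \<Longrightarrow> relabel_magma \<sigma> x \<in> lie_ideal (\<sigma> ` I)"
  by (induction rule: lie_ideal.induct)
     (auto simp: relabel_magma_simps relabel_magma_bracket
       intro: lie_ideal.intros relabel_magma_nonassoc_alg)

lemma leaves_map_magma: "leaves (map_magma \<sigma> t) = map \<sigma> (leaves t)"
  by (induction t) auto

lemma relabel_magma_multilinear:
  "x \<in> multilinear_part I \<Longrightarrow> inj_on \<sigma> I \<Longrightarrow> relabel_magma \<sigma> x \<in> multilinear_part (\<sigma> ` I)"
  unfolding multilinear_part_def
  by (rule linear_map_in_subspace[OF linear_map_relabel_magma subspace_free_on])
     (auto simp: relabel_magma_def leaves_map_magma permutations_of_set_def distinct_map
       intro!: gen_in_free_on)

lemma Lie_map_class: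
  "sp_map Lie_species \<sigma> F (lie_class F x) = lie_class (\<sigma> ` F) (relabel_magma \<sigma> x)"
  unfolding Lie_species_def
  by (simp flip: relabel_magma_def)
     (rule on_classes_residue_class[OF subspace_lie_ideal subspace_lie_ideal linear_map_relabel_magma
        relabel_magma_lie_ideal])

lemma block_lie_poly_relabel:
  fixes x :: "'a magma \<Rightarrow>\<^sub>0 'c::comm_ring_1" and \<sigma> :: "'a \<Rightarrow> 'b"
  shows "block (lie_poly (relabel_magma \<sigma> x)) = relabel \<sigma> (block (lie_poly x))"
proof (rule linear_map_eqI[of "\<lambda>x. block (lie_poly (relabel_magma \<sigma> x))" _ x UNIV])
  define rel where "rel = (lin_ext (\<lambda>l. gen (map \<sigma> l)) :: ('a list \<Rightarrow>\<^sub>0 'c) \<Rightarrow> _)"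
  have lin: "linear_map rel" unfolding rel_def by (rule linear_map_lin_ext)
  have mult: "rel (x * y) = rel x * rel y" for x y
    by (rule bilinear_map_eqI[of _ _ x UNIV y UNIV])
       (auto intro!: linear_intros linear_map_compose[OF lin] simp: rel_def)
  have rel_block: "relabel \<sigma> (block x) = block (rel x)" for x
    by (rule linear_map_eqI[of _ _ x UNIV])
       (auto intro!: linear_intros linear_map_compose[OF lin] simp: rel_def)
  fix t :: "'a magma"
  have "magma_poly (map_magma \<sigma> t) = rel (magma_poly t)"
    by (induction t) (simp_all add: mult linear_map_simps[OF lin], simp add: rel_def)
  then show "block (lie_poly (relabel_magma \<sigma> (gen t))) = relabel \<sigma> (block (lie_poly (gen t :: _ \<Rightarrow>\<^sub>0 'c)))"
    by (simp add: rel_block relabel_magma_def)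
qed (auto intro!: linear_intros)

section \<open>Quotient modules\<close>

lemma module_quotient_module:
  fixes M N :: "('x \<Rightarrow>\<^sub>0 'k::comm_ring_1) set"
  assumes M: "free_mod.subspace M" and N: "free_mod.subspace N"
  shows "Module.module class_ring (quotient_module M N)"
proof (rule moduleI)
  let ?Q = "quotient_module M N"
  note add = quotient_module_add[OF N] and smult = quotient_module_smult[OF N]
  show "cring (class_ring :: 'k ring)"
    by (unfold_locales) (auto simp: algebra_simps intro: exI[of _ "- _"] simp: Units_def)
  have zero: "\<zero>\<^bsub>?Q\<^esub> = residue_class N 0" by (simp add: quotient_module_simps residue_class_zero)
  show "abelian_group ?Q"
  proof (rule abelian_groupI)
    fix x assume "x \<in> carrier ?Q"
    then obtain p where "p \<in> M" "x = residue_class N p" by (auto simp: quotient_module_simps)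
    then show "\<exists>y\<in>carrier ?Q. y \<oplus>\<^bsub>?Q\<^esub> x = \<zero>\<^bsub>?Q\<^esub>"
      using free_mod.subspace_neg[OF M]
      by (intro bexI[of _ "residue_class N (- p)"]) (auto simp: quotient_module_simps(1) zero add)
  qed (auto simp: quotient_module_simps(1) zero add algebra_simps
      free_mod.subspace_0[OF M] free_mod.subspace_add[OF M])
qed (auto simp: quotient_module_simps(1) quotient_module_add[OF N] quotient_module_smult[OF N]
    free_mod.subspace_scale[OF M] free_mod.scale_left_distrib free_mod.scale_right_distrib)

lemma finsum_quotient_module:
  assumes M: "free_mod.subspace M" and N: "free_mod.subspace N"
    and "finite A" "\<And>i. i \<in> A \<Longrightarrow> g i \<in> M"
  shows "(\<Oplus>\<^bsub>quotient_module M N\<^esub>i\<in>A. residue_class N (g i)) = residue_class N (\<Sum>i\<in>A. g i)"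
proof -
  interpret Q: Module.module class_ring "quotient_module M N"
    by (rule module_quotient_module[OF M N])
  show ?thesis
    using assms(3,4)
  proof (induction A)
    case empty
    then show ?case by (simp add: residue_class_zero quotient_module_simps)
  next
    case (insert i A)
    then have "(\<lambda>i. residue_class N (g i)) \<in> A \<rightarrow> carrier (quotient_module M N)"
      by (auto simp: quotient_module_simps)
    with insert show ?case
      by (simp add: Q.finsum_insert quotient_module_simps(1) quotient_module_add[OF N])
  qed
qed

text \<open>Linear combinations in the quotient are classes of sums in the free module, so spanning and
  independence can be checked there, modulo \<open>N\<close>.\<close>

lemma module_basis_quotient_module:
  fixes M N :: "('x \<Rightarrow>\<^sub>0 'k::comm_ring_1) set"
  assumes M: "free_mod.subspace M" and N: "free_mod.subspace N"
    and C: "finite C" and e: "\<And>c. c \<in> C \<Longrightarrow> e c \<in> M"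
    and span: "\<And>x. x \<in> M \<Longrightarrow> \<exists>f. x - (\<Sum>c\<in>C. pm_scale (f c) (e c)) \<in> N"
    and indep: "\<And>f c. (\<Sum>c\<in>C. pm_scale (f c) (e c)) \<in> N \<Longrightarrow> c \<in> C \<Longrightarrow> f c = 0"
  shows "module_basis (quotient_module M N) ((\<lambda>c. residue_class N (e c)) ` C)"
    and "inj_on (\<lambda>c. residue_class N (e c)) C"
proof -
  let ?Q = "quotient_module M N"
  let ?b = "\<lambda>c. residue_class N (e c)"
  interpret Q: Module.module class_ring ?Q by (rule module_quotient_module[OF M N])
  show inj: "inj_on ?b C"
  proof (rule inj_onI, rule ccontr)
    fix c d assume cd: "c \<in> C" "d \<in> C" "?b c = ?b d" "c \<noteq> d"
    let ?f = "\<lambda>x. (if x = c then 1 else 0) - (if x = d then 1 else 0) :: 'k"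
    have "(\<Sum>x\<in>C. pm_scale (?f x) (e x)) = (\<Sum>x\<in>C. (if x = c then e x else 0) - (if x = d then e x else 0))"
      by (intro sum.cong refl) (auto simp: free_mod.scale_left_diff_distrib)
    also have "\<dots> = e c - e d" using C cd by (simp add: sum_subtractf)
    also have "\<dots> \<in> N" using cd(3) by (simp add: residue_class_eq_iff[OF N])
    finally have "?f c = 0" using cd(1) by (rule indep)
    with cd(4) show False by simp
  qed
  have lincomb: "Q.lincomb a (?b ` C) = residue_class N (\<Sum>c\<in>C. pm_scale (a (?b c)) (e c))" for a
  proof -
    define g where "g v = pm_scale (a v) (e (inv_into C ?b v))" for v
    have g: "a v \<odot>\<^bsub>?Q\<^esub> v = residue_class N (g v)" "g v \<in> M" if "v \<in> ?b ` C" for v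
      using that e by (auto simp: g_def inv_into_f_f[OF inj] quotient_module_smult[OF N]
          intro: free_mod.subspace_scale[OF M])
    have "Q.lincomb a (?b ` C) = (\<Oplus>\<^bsub>?Q\<^esub>v\<in>?b ` C. residue_class N (g v))"
      unfolding Q.lincomb_def using g by (intro Q.finsum_cong') (auto simp: quotient_module_simps)
    also have "\<dots> = residue_class N (\<Sum>v\<in>?b ` C. g v)"
      using g C by (intro finsum_quotient_module[OF M N]) auto
    also have "(\<Sum>v\<in>?b ` C. g v) = (\<Sum>c\<in>C. pm_scale (a (?b c)) (e c))"
      using inj by (simp add: sum.reindex g_def inv_into_f_f[OF inj])
    finally show ?thesis .
  qed
  have sub: "?b ` C \<subseteq> carrier ?Q" using e by (auto simp: quotient_module_simps)
  have fin: "finite (?b ` C)" using C by simp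
  have "Q.lin_indpt (?b ` C)"
  proof (rule Q.finite_lin_indpt2[OF fin sub])
    fix a assume "Q.lincomb a (?b ` C) = \<zero>\<^bsub>?Q\<^esub>"
    then have "residue_class N (\<Sum>c\<in>C. pm_scale (a (?b c)) (e c)) = residue_class N 0"
      unfolding lincomb by (simp add: quotient_module_simps residue_class_zero)
    then have "(\<Sum>c\<in>C. pm_scale (a (?b c)) (e c)) \<in> N"
      by (simp add: residue_class_eq_iff[OF N])
    then show "\<forall>v\<in>?b ` C. a v = \<zero>\<^bsub>class_ring\<^esub>"
      using indep[of "\<lambda>c. a (?b c)"] by auto
  qed
  moreover have "Q.span (?b ` C) = carrier ?Q"
  proof
    show "Q.span (?b ` C) \<subseteq> carrier ?Q"
      unfolding Q.finite_span[OF fin sub] using sub by auto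
    show "carrier ?Q \<subseteq> Q.span (?b ` C)"
    proof
      fix v assume "v \<in> carrier ?Q"
      then obtain x where x: "x \<in> M" "v = residue_class N x" by (auto simp: quotient_module_simps)
      obtain f where "x - (\<Sum>c\<in>C. pm_scale (f c) (e c)) \<in> N" using span[OF x(1)] by blast
      then have "v = residue_class N (\<Sum>c\<in>C. pm_scale (f c) (e c))"
        using x(2) by (simp add: residue_class_eq_iff[OF N])
      also have "\<dots> = Q.lincomb (\<lambda>v. f (inv_into C ?b v)) (?b ` C)"
        unfolding lincomb by (simp add: inv_into_f_f[OF inj] cong: sum.cong)
      finally show "v \<in> Q.span (?b ` C)"
        unfolding Q.finite_span[OF fin sub] by auto
    qed
  qed
  ultimately show "module_basis ?Q (?b ` C)"
    using sub by (simp add: module_basis_def)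
qed

section \<open>Rank of free modules over commutative rings\<close>

text \<open>If \<open>m < n\<close>, then a product of an \<open>n \<times> m\<close> and an \<open>m \<times> n\<close> matrix is a product of square
  matrices, one of which has a zero row, so its determinant vanishes.\<close>

lemma left_inverse_matrix_bound:
  fixes P Q :: "nat \<Rightarrow> nat \<Rightarrow> 'k::comm_ring_1"
  assumes "\<And>i j. i < n \<Longrightarrow> j < n \<Longrightarrow> (\<Sum>k<m. P i k * Q k j) = (if i = j then 1 else 0)"
  shows "n \<le> m"
proof (rule ccontr)
  assume "\<not> n \<le> m"
  then have mn: "m < n" by simp
  define A where "A = mat n n (\<lambda>(i, k). if k < m then P i k else 0)"
  define B where "B = mat n n (\<lambda>(k, j). if k < m then Q k j else 0)"
  have A: "A \<in> carrier_mat n n" and B: "B \<in> carrier_mat n n" by (auto simp: A_def B_def)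
  have "A * B = 1\<^sub>m n"
  proof (rule eq_matI)
    fix i j assume "i < dim_row (1\<^sub>m n :: 'k mat)" "j < dim_col (1\<^sub>m n :: 'k mat)"
    then have ij: "i < n" "j < n" by auto
    have "(A * B) $$ (i, j) = (\<Sum>k<n. (if k < m then P i k * Q k j else 0))"
      using ij by (auto simp: A_def B_def scalar_prod_def lessThan_atLeast0 intro!: sum.cong)
    also have "\<dots> = (\<Sum>k<m. P i k * Q k j)"
      using mn by (intro sum.mono_neutral_cong_right) auto
    finally show "(A * B) $$ (i, j) = 1\<^sub>m n $$ (i, j)" using assms[OF ij] ij by simp
  qed (use A B in auto)
  then have "det A * det B = 1" using det_mult[OF A B] by simp
  moreover have "det B = 0"
  proof -
    have "B = mat\<^sub>r n n (\<lambda>i. if i = m then 0\<^sub>v n else row B i)"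
      by (rule eq_matI) (auto simp: B_def)
    then show ?thesis
      using det_row_0[OF mn, of "row B"] B by auto
  qed
  ultimately show False by simp
qed

definition class_rep :: "('x \<Rightarrow>\<^sub>0 'k::comm_ring_1) set \<Rightarrow> ('x \<Rightarrow>\<^sub>0 'k) set \<Rightarrow> ('x \<Rightarrow>\<^sub>0 'k) set \<Rightarrow> ('x \<Rightarrow>\<^sub>0 'k)" where
  "class_rep M N v = (SOME x. x \<in> M \<and> residue_class N x = v)"

lemma class_rep:
  assumes "v \<in> carrier (quotient_module M N)"
  shows "class_rep M N v \<in> M" "residue_class N (class_rep M N v) = v"
proof -
  have "\<exists>x. x \<in> M \<and> residue_class N x = v" using assms by (auto simp: quotient_module_simps)
  from someI_ex[OF this] show "class_rep M N v \<in> M" "residue_class N (class_rep M N v) = v"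
    unfolding class_rep_def by auto
qed

lemma module_basis_quotient_moduleD:
  fixes M N :: "('x \<Rightarrow>\<^sub>0 'k::comm_ring_1) set"
  assumes M: "free_mod.subspace M" and N: "free_mod.subspace N"
    and B: "module_basis (quotient_module M N) B"
  shows "x \<in> M \<Longrightarrow> \<exists>F f. finite F \<and> F \<subseteq> B \<and> x - (\<Sum>v\<in>F. pm_scale (f v) (class_rep M N v)) \<in> N"
    and "finite F \<Longrightarrow> F \<subseteq> B \<Longrightarrow> (\<Sum>v\<in>F. pm_scale (f v) (class_rep M N v)) \<in> N \<Longrightarrow> v \<in> F \<Longrightarrow> f v = 0"
proof -
  let ?Q = "quotient_module M N"
  interpret Q: Module.module class_ring ?Q by (rule module_quotient_module[OF M N])
  have sub: "B \<subseteq> carrier ?Q" using B by (simp add: module_basis_def)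
  have lincomb: "Q.lincomb a F = residue_class N (\<Sum>v\<in>F. pm_scale (a v) (class_rep M N v))"
    if "finite F" "F \<subseteq> B" for a F
  proof -
    have rep: "class_rep M N v \<in> M" "residue_class N (class_rep M N v) = v" if "v \<in> F" for v
      using that \<open>F \<subseteq> B\<close> sub class_rep[of v M N] by auto
    have e: "a v \<odot>\<^bsub>?Q\<^esub> v = residue_class N (pm_scale (a v) (class_rep M N v))" if "v \<in> F" for v
      using rep[OF that] quotient_module_smult[OF N, where c = "a v" and M = M and x = "class_rep M N v"] by simp
    have "Q.lincomb a F = (\<Oplus>\<^bsub>?Q\<^esub>v\<in>F. residue_class N (pm_scale (a v) (class_rep M N v)))"
      unfolding Q.lincomb_def using rep(1)
      by (intro Q.finsum_cong') (auto simp: e quotient_module_simps intro!: free_mod.subspace_scale[OF M])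
    also have "\<dots> = residue_class N (\<Sum>v\<in>F. pm_scale (a v) (class_rep M N v))"
      using rep(1) \<open>finite F\<close> by (intro finsum_quotient_module[OF M N]) (auto intro!: free_mod.subspace_scale[OF M])
    finally show ?thesis .
  qed
  show "\<exists>F f. finite F \<and> F \<subseteq> B \<and> x - (\<Sum>v\<in>F. pm_scale (f v) (class_rep M N v)) \<in> N" if "x \<in> M"
  proof -
    have "residue_class N x \<in> Q.span B"
      using B that by (auto simp: module_basis_def quotient_module_simps)
    then obtain F f where F: "finite F" "F \<subseteq> B" "residue_class N x = Q.lincomb f F"
      by (auto simp: Q.span_def)
    then show ?thesis using lincomb[of F f] by (auto simp: residue_class_eq_iff[OF N])
  qed
  show "f v = 0" if F: "finite F" "F \<subseteq> B" "(\<Sum>v\<in>F. pm_scale (f v) (class_rep M N v)) \<in> N" "v \<in> F"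
  proof (rule ccontr)
    assume "f v \<noteq> 0"
    have "Q.lincomb f F = residue_class N 0"
      using lincomb[OF F(1,2)] F(3) by (simp add: residue_class_eq_iff[OF N])
    then have "Q.lincomb f F = \<zero>\<^bsub>?Q\<^esub>" by (simp add: residue_class_zero quotient_module_simps)
    with F \<open>f v \<noteq> 0\<close> have "Q.lin_dep B"
      by (intro Q.lin_dep_crit[OF F(1,2) _ F(4)]) auto
    with B show False by (simp add: module_basis_def)
  qed
qed

lemma module_basis_span_finite:
  fixes M N :: "('x \<Rightarrow>\<^sub>0 'k::comm_ring_1) set"
  assumes M: "free_mod.subspace M" and N: "free_mod.subspace N"
    and B: "module_basis (quotient_module M N) B" "finite B" and x: "x \<in> M"
  shows "\<exists>f. x - (\<Sum>v\<in>B. pm_scale (f v) (class_rep M N v)) \<in> N"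
proof -
  obtain F f where F: "finite F" "F \<subseteq> B" "x - (\<Sum>v\<in>F. pm_scale (f v) (class_rep M N v)) \<in> N"
    using module_basis_quotient_moduleD(1)[OF M N B(1) x] by blast
  have "(\<Sum>v\<in>F. pm_scale (f v) (class_rep M N v))
      = (\<Sum>v\<in>B. pm_scale (if v \<in> F then f v else 0) (class_rep M N v))"
    using F(2) B(2) by (intro sum.mono_neutral_cong_left) auto
  with F(3) show ?thesis by (intro exI[of _ "\<lambda>v. if v \<in> F then f v else 0"]) simp
qed

text \<open>Substituting one expansion into another multiplies the coefficient matrices.\<close>

lemma sum_scale_comp:
  fixes r :: "'b \<Rightarrow> ('x \<Rightarrow>\<^sub>0 'k::comm_ring_1)"
  assumes "free_mod.subspace N" "finite A"
    and x: "x - (\<Sum>a\<in>A. pm_scale (p a) (s a)) \<in> N"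
    and s: "\<And>a. a \<in> A \<Longrightarrow> s a - (\<Sum>w\<in>B. pm_scale (q a w) (r w)) \<in> N"
  shows "x - (\<Sum>w\<in>B. pm_scale (\<Sum>a\<in>A. p a * q a w) (r w)) \<in> N"
proof -
  have "(\<Sum>a\<in>A. pm_scale (p a) (s a - (\<Sum>w\<in>B. pm_scale (q a w) (r w)))) \<in> N"
    using assms(1) s by (intro free_mod.subspace_sum free_mod.subspace_scale) auto
  from free_mod.subspace_add[OF assms(1) x this]
  have "x - (\<Sum>a\<in>A. \<Sum>w\<in>B. pm_scale (p a * q a w) (r w)) \<in> N"
    by (simp add: free_mod.scale_right_diff_distrib sum_subtractf free_mod.scale_sum_right)
  then show ?thesis
    by (subst (asm) sum.swap) (simp add: free_mod.scale_sum_left)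
qed

text \<open>Finitely many elements of \<open>B\<close> suffice to express \<open>A\<close>, hence everything; any other element of \<open>B\<close>
  would depend on them.\<close>

lemma module_basis_finite:
  fixes M N :: "('x \<Rightarrow>\<^sub>0 'k::comm_ring_1) set"
  assumes M: "free_mod.subspace M" and N: "free_mod.subspace N"
    and A: "module_basis (quotient_module M N) A" "finite A" and B: "module_basis (quotient_module M N) B"
  shows "finite B"
proof -
  let ?r = "class_rep M N"
  have rep: "?r v \<in> M" if "v \<in> A \<or> v \<in> B" for v
    using that A B class_rep(1)[of v M N] by (auto simp: module_basis_def)
  have "\<forall>a\<in>A. \<exists>F f. finite F \<and> F \<subseteq> B \<and> ?r a - (\<Sum>v\<in>F. pm_scale (f v) (?r v)) \<in> N"
    using module_basis_quotient_moduleD(1)[OF M N B] rep by blast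
  then obtain F q where F: "\<And>a. a \<in> A \<Longrightarrow> finite (F a)" "\<And>a. a \<in> A \<Longrightarrow> F a \<subseteq> B"
    and q: "\<And>a. a \<in> A \<Longrightarrow> ?r a - (\<Sum>v\<in>F a. pm_scale (q a v) (?r v)) \<in> N"
    by metis
  define G where "G = \<Union>(F ` A)"
  have G: "finite G" "G \<subseteq> B" using F A(2) by (auto simp: G_def)
  have q': "?r a - (\<Sum>v\<in>G. pm_scale (if v \<in> F a then q a v else 0) (?r v)) \<in> N" if "a \<in> A" for a
  proof -
    have "(\<Sum>v\<in>F a. pm_scale (q a v) (?r v)) = (\<Sum>v\<in>G. pm_scale (if v \<in> F a then q a v else 0) (?r v))"
      using G(1) that by (intro sum.mono_neutral_cong_left) (auto simp: G_def)
    with q[OF that] show ?thesis by simp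
  qed
  have "B \<subseteq> G"
  proof
    fix b assume b: "b \<in> B"
    obtain p where p: "?r b - (\<Sum>a\<in>A. pm_scale (p a) (?r a)) \<in> N"
      using module_basis_span_finite[OF M N A] rep b by blast
    define c where "c v = (\<Sum>a\<in>A. p a * (if v \<in> F a then q a v else 0))" for v
    have c: "?r b - (\<Sum>v\<in>G. pm_scale (c v) (?r v)) \<in> N"
      unfolding c_def by (rule sum_scale_comp[OF N A(2) p]) (rule q')
    show "b \<in> G"
    proof (rule ccontr)
      assume nb: "b \<notin> G"
      let ?c = "\<lambda>v. if v = b then 1 else - c v"
      have "(\<Sum>v\<in>insert b G. pm_scale (?c v) (?r v)) = ?r b + (\<Sum>v\<in>G. pm_scale (- c v) (?r v))"
        using G(1) nb by (auto intro!: sum.cong)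
      also have "\<dots> \<in> N" using c by (simp add: sum_negf)
      finally have "?c b = 0"
        using G b by (intro module_basis_quotient_moduleD(2)[OF M N B, of "insert b G" ?c]) auto
      then show False by simp
    qed
  qed
  then show ?thesis using G(1) by (rule finite_subset)
qed

text \<open>The two matrices of coefficients are inverse to each other.\<close>

lemma module_basis_card_le:
  fixes M N :: "('x \<Rightarrow>\<^sub>0 'k::comm_ring_1) set"
  assumes M: "free_mod.subspace M" and N: "free_mod.subspace N"
    and A: "module_basis (quotient_module M N) A" "finite A"
    and B: "module_basis (quotient_module M N) B" "finite B"
  shows "card B \<le> card A"
proof -
  let ?r = "class_rep M N"
  have rep: "?r v \<in> M" if "v \<in> A \<or> v \<in> B" for v
    using that A B class_rep(1)[of v M N] by (auto simp: module_basis_def)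
  have "\<forall>b\<in>B. \<exists>f. ?r b - (\<Sum>a\<in>A. pm_scale (f a) (?r a)) \<in> N"
    using module_basis_span_finite[OF M N A] rep by blast
  then obtain p where p: "\<And>b. b \<in> B \<Longrightarrow> ?r b - (\<Sum>a\<in>A. pm_scale (p b a) (?r a)) \<in> N" by metis
  have "\<forall>a\<in>A. \<exists>f. ?r a - (\<Sum>b\<in>B. pm_scale (f b) (?r b)) \<in> N"
    using module_basis_span_finite[OF M N B] rep by blast
  then obtain q where q: "\<And>a. a \<in> A \<Longrightarrow> ?r a - (\<Sum>b\<in>B. pm_scale (q a b) (?r b)) \<in> N" by metis
  have pq: "(\<Sum>a\<in>A. p b a * q a w) = (if b = w then 1 else 0)" if b: "b \<in> B" and w: "w \<in> B" for b w
  proof -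
    \<comment> \<open>Expanding \<open>b\<close> in \<open>A\<close> and back in \<open>B\<close> gives a relation between elements of \<open>B\<close>.\<close>
    let ?c = "\<lambda>w. (if b = w then 1 else 0) - (\<Sum>a\<in>A. p b a * q a w)"
    have "(\<Sum>w\<in>B. pm_scale (?c w) (?r w)) =
        (\<Sum>w\<in>B. (if b = w then ?r w else 0)) - (\<Sum>w\<in>B. pm_scale (\<Sum>a\<in>A. p b a * q a w) (?r w))"
      unfolding sum_subtractf[symmetric]
      by (intro sum.cong refl) (auto simp: free_mod.scale_left_diff_distrib)
    also have "\<dots> = ?r b - (\<Sum>w\<in>B. pm_scale (\<Sum>a\<in>A. p b a * q a w) (?r w))"
      using b B(2) by simp
    also have "\<dots> \<in> N" by (rule sum_scale_comp[OF N A(2) p[OF b] q])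
    finally have "?c w = 0"
      by (rule module_basis_quotient_moduleD(2)[OF M N B(1) B(2) subset_refl]) (rule w)
    then show ?thesis by simp
  qed
  obtain \<alpha> \<beta> where ab: "bij_betw \<alpha> {..<card A} A" "bij_betw \<beta> {..<card B} B"
    using ex_bij_betw_nat_finite[OF A(2)] ex_bij_betw_nat_finite[OF B(2)]
    unfolding lessThan_atLeast0 by blast
  show ?thesis
  proof (rule left_inverse_matrix_bound[where P = "\<lambda>i k. p (\<beta> i) (\<alpha> k)" and Q = "\<lambda>k j. q (\<alpha> k) (\<beta> j)"])
    fix i j assume ij: "i < card B" "j < card B"
    have "(\<Sum>k<card A. p (\<beta> i) (\<alpha> k) * q (\<alpha> k) (\<beta> j)) = (\<Sum>a\<in>A. p (\<beta> i) a * q a (\<beta> j))"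
      by (rule sum.reindex_bij_betw[OF ab(1)])
    also have "\<dots> = (if i = j then 1 else 0)"
      using ij pq[of "\<beta> i" "\<beta> j"] ab(2) bij_betwE[OF ab(2)] inj_on_eq_iff[OF bij_betw_imp_inj_on[OF ab(2)], of i j]
      by auto
    finally show "(\<Sum>k<card A. p (\<beta> i) (\<alpha> k) * q (\<alpha> k) (\<beta> j)) = (if i = j then 1 else 0)" .
  qed
qed

theorem module_dim_quotient_module:
  fixes M N :: "('x \<Rightarrow>\<^sub>0 'k::comm_ring_1) set"
  assumes "free_mod.subspace M" "free_mod.subspace N"
    and A: "module_basis (quotient_module M N) A" "finite A"
  shows "module_dim (quotient_module M N) = card A"
proof -
  let ?B = "SOME B. module_basis (quotient_module M N) B"
  have B: "module_basis (quotient_module M N) ?B" using A(1) by (rule someI)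
  then have "finite ?B" by (rule module_basis_finite[OF assms])
  then have "card ?B = card A"
    using module_basis_card_le[OF assms B] module_basis_card_le[OF assms(1,2) B _ A] by simp
  then show ?thesis by (simp add: module_dim_def)
qed

section \<open>The isomorphism of algebras\<close>

lemma module_iso_inverse:
  fixes M :: "('k::comm_ring_1, 'v) module" and N :: "('k, 'w) module"
  assumes "module_iso M N f" shows "module_iso N M (inv_into (carrier M) f)"
proof -
  let ?g = "inv_into (carrier M) f"
  have f: "mod_hom class_ring M N f" and bij: "bij_betw f (carrier M) (carrier N)"
    using assms by (auto simp: module_iso_def)
  interpret mod_hom class_ring M N f by (rule f)
  note inj = bij_betw_imp_inj_on[OF bij]
  have fg: "f (?g y) = y" "?g y \<in> carrier M" if "y \<in> carrier N" for y
    using that bij bij_betw_inv_into_right[OF bij] bij_betwE[OF bij_betw_inv_into[OF bij]] by auto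
  have gf: "?g y = x" if "x \<in> carrier M" "f x = y" for x y
    using inv_into_f_f[OF inj that(1)] that(2) by simp
  have "mod_hom class_ring N M ?g"
  proof (intro mod_hom.intro mod_hom_axioms.intro)
    show "Module.module class_ring N" "Module.module class_ring M" by unfold_locales
    show "?g \<in> module_hom class_ring N M"
      unfolding module_hom_def
    proof (intro CollectI conjI allI impI Pi_I)
      fix x y assume xy: "x \<in> carrier N \<and> y \<in> carrier N"
      then show "?g (x \<oplus>\<^bsub>N\<^esub> y) = ?g x \<oplus>\<^bsub>M\<^esub> ?g y" by (intro gf) (simp_all add: fg)
    next
      fix c :: 'k and x assume x: "c \<in> carrier class_ring \<and> x \<in> carrier N"
      then show "?g (c \<odot>\<^bsub>N\<^esub> x) = c \<odot>\<^bsub>M\<^esub> ?g x" by (intro gf) (simp_all add: fg)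
    qed (use fg in auto)
  qed
  then show ?thesis using bij_betw_inv_into[OF bij] by (simp add: module_iso_def)
qed

text \<open>The closure of the operations of \<open>X\<close> is needed because the inverse is only determined on carriers.\<close>

lemma graded_species_algebra_iso_inverse:
  fixes X :: "('a, 'k::comm_ring_1, 'v) graded_species_algebra"
    and Y :: "('a, 'k, 'w) graded_species_algebra"
  assumes iso: "graded_species_algebra_iso X Y \<Phi>"
    and map: "\<And>I n \<sigma> x. finite I \<Longrightarrow> inj_on \<sigma> I \<Longrightarrow> x \<in> carrier (gr_val X I n) \<Longrightarrow>
      gr_map X \<sigma> I n x \<in> carrier (gr_val X (\<sigma> ` I) n)"
    and mult: "\<And>A m B n x y. finite A \<Longrightarrow> finite B \<Longrightarrow> A \<inter> B = {} \<Longrightarrow>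
      x \<in> carrier (gr_val X A m) \<Longrightarrow> y \<in> carrier (gr_val X B n) \<Longrightarrow>
      gr_mult X A m B n x y \<in> carrier (gr_val X (A \<union> B) (m + n))"
    and unit: "gr_unit X \<in> carrier (gr_val X {} 0)"
  shows "graded_species_algebra_iso Y X (\<lambda>I n. inv_into (carrier (gr_val X I n)) (\<Phi> I n))"
proof -
  let ?inverse = "\<lambda>I n. inv_into (carrier (gr_val X I n)) (\<Phi> I n)"
  have mod: "module_iso (gr_val X I n) (gr_val Y I n) (\<Phi> I n)" if "finite I" for I n
    using iso that by (simp add: graded_species_algebra_iso_def)
  then have bij: "bij_betw (\<Phi> I n) (carrier (gr_val X I n)) (carrier (gr_val Y I n))" if "finite I" for I n
    using that by (simp add: module_iso_def)
  have inv: "?inverse I n (\<Phi> I n x) = x" if "finite I" "x \<in> carrier (gr_val X I n)" for I n x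
    using that bij_betw_inv_into_left[OF bij] by simp
  have surj: "\<exists>x\<in>carrier (gr_val X I n). y = \<Phi> I n x" if "finite I" "y \<in> carrier (gr_val Y I n)" for I n y
    using bij_betw_imp_surj_on[OF bij[OF that(1)], of n] that(2) by blast
  show ?thesis
    unfolding graded_species_algebra_iso_def
  proof (intro conjI allI impI ballI)
    fix I :: "'a set" and n assume "finite I"
    then show "module_iso (gr_val Y I n) (gr_val X I n) (?inverse I n)"
      by (intro module_iso_inverse mod)
  next
    fix I :: "'a set" and n y and \<sigma> :: "'a \<Rightarrow> 'a" assume I: "finite I \<and> inj_on \<sigma> I" and "y \<in> carrier (gr_val Y I n)"
    then obtain x where x: "x \<in> carrier (gr_val X I n)" "y = \<Phi> I n x" using surj[of I y n] by auto
    have "gr_map Y \<sigma> I n y = \<Phi> (\<sigma> ` I) n (gr_map X \<sigma> I n x)"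
      using iso I x by (simp add: graded_species_algebra_iso_def)
    then show "?inverse (\<sigma> ` I) n (gr_map Y \<sigma> I n y) = gr_map X \<sigma> I n (?inverse I n y)"
      using I x map by (simp add: inv)
  next
    fix A :: "'a set" and m B n y z assume AB: "finite A \<and> finite B \<and> A \<inter> B = {}"
      and yz: "y \<in> carrier (gr_val Y A m)" "z \<in> carrier (gr_val Y B n)"
    obtain u where u: "u \<in> carrier (gr_val X A m)" "y = \<Phi> A m u" using surj[of A y m] AB yz by auto
    obtain v where v: "v \<in> carrier (gr_val X B n)" "z = \<Phi> B n v" using surj[of B z n] AB yz by auto
    note uv = u v
    have "gr_mult Y A m B n y z = \<Phi> (A \<union> B) (m + n) (gr_mult X A m B n u v)"
      using iso AB uv by (simp add: graded_species_algebra_iso_def)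
    then show "?inverse (A \<union> B) (m + n) (gr_mult Y A m B n y z) = gr_mult X A m B n (?inverse A m y) (?inverse B n z)"
      using AB uv mult by (simp add: inv)
  next
    have "gr_unit Y = \<Phi> {} 0 (gr_unit X)" using iso by (simp add: graded_species_algebra_iso_def)
    then show "?inverse {} 0 (gr_unit Y) = gr_unit X" using unit by (simp add: inv)
  qed
qed

abbreviation L_dual :: "('a, 'k::comm_ring_1, ('a list list \<Rightarrow>\<^sub>0 'k) set) graded_species_algebra" where
  "L_dual \<equiv> koszul_dual_L"

abbreviation sym_Lie ::
  "('a, 'k::comm_ring_1, (('a set \<times> ('a magma \<Rightarrow>\<^sub>0 'k) set) list \<Rightarrow>\<^sub>0 'k) set) graded_species_algebra" where
  "sym_Lie \<equiv> sym_desusp Lie_species"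

abbreviation cobar_class :: "int \<Rightarrow> 'a set \<Rightarrow> ('a list list \<Rightarrow>\<^sub>0 'k::comm_ring_1) \<Rightarrow> ('a list list \<Rightarrow>\<^sub>0 'k) set" where
  "cobar_class n I \<equiv> residue_class (boundaries n I)"

abbreviation sym_class :: "int \<Rightarrow> 'a set \<Rightarrow> (('a set \<times> ('a magma \<Rightarrow>\<^sub>0 'k::comm_ring_1) set) list \<Rightarrow>\<^sub>0 'k) \<Rightarrow>
    (('a set \<times> ('a magma \<Rightarrow>\<^sub>0 'k) set) list \<Rightarrow>\<^sub>0 'k) set" where
  "sym_class n I \<equiv> residue_class (sym_relations Lie_species n I)"

lemma subspace_cocycles: "free_mod.subspace (cobar_cocycles n I)"
  unfolding cobar_cocycles_eq
  by (auto simp: free_mod.subspace_def cdiff_simps free_mod.subspace_0[OF subspace_cobar]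
      free_mod.subspace_add[OF subspace_cobar] free_mod.subspace_scale[OF subspace_cobar])

lemma L_dual_val: "gr_val L_dual I n = quotient_module (cobar_cocycles n I) (boundaries n I)"
  by (simp add: koszul_dual_L_def cobar_coboundaries_eq)

lemma sym_Lie_val:
  "gr_val sym_Lie I n = quotient_module (free_on (sym_words Lie_species n I)) (sym_relations Lie_species n I)"
  by (simp add: sym_desusp_def)

lemma carrier_L_dual: "carrier (gr_val L_dual I n) = cobar_class n I ` cobar_cocycles n I"
  by (simp add: L_dual_val quotient_module_simps)

lemma carrier_sym_Lie:
  "carrier (gr_val sym_Lie I n) = sym_class n I ` free_on (sym_words Lie_species n I)"
  by (simp add: sym_Lie_val quotient_module_simps)

lemma boundaries_cocycles: "x \<in> boundaries n I \<Longrightarrow> x \<in> cobar n I \<and> cdiff x = 0"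
  using cdiff_cobar[of _ "n - 1" I] by (auto simp: boundaries_def cdiff_cdiff)

lemma L_dual_mult:
  assumes "A \<inter> B = {}" and x: "x \<in> cobar m A" "cdiff x = 0" and y: "y \<in> cobar n B" "cdiff y = 0"
  shows "gr_mult L_dual A m B n (cobar_class m A x) (cobar_class n B y) = cobar_class (m + n) (A \<union> B) (x * y)"
proof -
  have key: "bilin_ext (@) x' y' - bilin_ext (@) x y \<in> boundaries (m + n) (A \<union> B)"
    if *: "x' - x \<in> boundaries m A" "y' - y \<in> boundaries n B" for x' y'
  proof -
    have y': "y' \<in> cobar n B" "cdiff y' = 0"
      using free_mod.subspace_add[OF subspace_cobar y(1), of "y' - y"] boundaries_cocycles[OF *(2)] y(2)
      by (auto simp: cdiff_simps)
    have "(x' - x) * y' \<in> boundaries (m + n) (A \<union> B)"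
      by (rule boundaries_mult_cocycle[OF *(1) y' assms(1)])
    moreover have "x * (y' - y) \<in> boundaries (m + n) (A \<union> B)"
      by (rule cocycle_mult_boundaries[OF x *(2)]) (use assms(1) in auto)
    ultimately have "(x' - x) * y' + x * (y' - y) \<in> boundaries (m + n) (A \<union> B)"
      by (rule free_mod.subspace_add[OF subspace_boundaries])
    then show ?thesis by (simp add: bilin_ext_append algebra_simps)
  qed
  from on_classes2_residue_class[where f = "bilin_ext (@)" and x = x and y = y, OF subspace_boundaries subspace_boundaries subspace_boundaries key]
  show ?thesis by (simp add: koszul_dual_L_def cobar_coboundaries_eq bilin_ext_append)
qed

lemma sym_Lie_mult:
  assumes "A \<inter> B = {}" and x: "x \<in> free_on (sym_words Lie_species m A)"
    and y: "y \<in> free_on (sym_words Lie_species n B)"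
  shows "gr_mult sym_Lie A m B n (sym_class m A x) (sym_class n B y) = sym_class (m + n) (A \<union> B) (x * y)"
proof -
  have key: "bilin_ext (@) x' y' - bilin_ext (@) x y \<in> sym_relations Lie_species (m + n) (A \<union> B)"
    if *: "x' - x \<in> sym_relations Lie_species m A" "y' - y \<in> sym_relations Lie_species n B" for x' y'
  proof -
    have y': "y' \<in> free_on (sym_words Lie_species n B)"
      using free_mod.subspace_add[OF subspace_free_on y sym_relations_Lie_free_on[OF *(2)]] by simp
    have "(x' - x) * y' \<in> sym_relations Lie_species (m + n) (A \<union> B)"
      by (rule sym_relations_mult(1)[OF *(1) y' assms(1)])
    moreover have "x * (y' - y) \<in> sym_relations Lie_species (m + n) (A \<union> B)"
      by (rule sym_relations_mult(2)[OF *(2) x]) (use assms(1) in auto)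
    ultimately have "(x' - x) * y' + x * (y' - y) \<in> sym_relations Lie_species (m + n) (A \<union> B)"
      by (rule free_mod.subspace_add[OF subspace_sym_relations])
    then show ?thesis by (simp add: bilin_ext_append algebra_simps)
  qed
  from on_classes2_residue_class[where f = "bilin_ext (@)" and x = x and y = y, OF subspace_sym_relations subspace_sym_relations subspace_sym_relations key]
  show ?thesis by (simp add: sym_desusp_def bilin_ext_append)
qed

lemma sym_words_free_on_mult:
  assumes "A \<inter> B = {}" and x: "x \<in> free_on (sym_words V m A)" and y: "y \<in> free_on (sym_words V n B)"
  shows "x * y \<in> free_on (sym_words V (m + n) (A \<union> B))"
proof -
  have *: "gen u * y \<in> free_on (sym_words V (m + n) (A \<union> B))" if "u \<in> sym_words V m A" for u
    by (rule linear_map_in_subspace[OF linear_map_mult_left subspace_free_on y])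
       (use that assms(1) in \<open>auto intro!: gen_in_free_on sym_words_append\<close>)
  show ?thesis by (rule linear_map_in_subspace[OF linear_map_mult_right subspace_free_on x *])
qed

lemma relabel_cobar:
  assumes "inj_on \<sigma> I" "x \<in> cobar n I" shows "relabel \<sigma> x \<in> cobar n (\<sigma> ` I)"
  using assms(2) unfolding cobar_def[of n I]
proof (rule linear_map_in_subspace[OF linear_map_relabel subspace_cobar])
  fix w assume "w \<in> cobar_words n I"
  then have "int (length w) = n" "[] \<notin> set w" "distinct (concat w)" "set (concat w) = I"
    by (auto simp: cobar_words_iff)
  moreover from this have "distinct (map \<sigma> (concat w))"
    using assms(1) by (simp add: distinct_map del: set_concat)
  ultimately have "map (map \<sigma>) w \<in> cobar_words n (\<sigma> ` I)"
    by (auto simp: cobar_words_iff map_concat[symmetric] simp flip: set_concat)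
  then show "relabel \<sigma> (gen w) \<in> cobar n (\<sigma> ` I)" by (simp add: cobar_gen)
qed

lemma L_dual_map:
  assumes "inj_on \<sigma> I"
  shows "gr_map L_dual \<sigma> I n (cobar_class n I x) = cobar_class n (\<sigma> ` I) (relabel \<sigma> x)"
proof -
  have "relabel \<sigma> z \<in> boundaries n (\<sigma> ` I)" if "z \<in> boundaries n I" for z
  proof -
    from that obtain y where "y \<in> cobar (n - 1) I" "z = cdiff y" by (auto simp: boundaries_def)
    with relabel_cobar[OF assms, of y "n - 1"] show ?thesis
      by (simp add: boundaries_def flip: cdiff_relabel)
  qed
  then show ?thesis
    unfolding koszul_dual_L_def cobar_coboundaries_eq graded_species_algebra.simps relabel_def[symmetric]
    by (intro on_classes_residue_class subspace_boundaries linear_map_relabel)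
qed

definition sym_relabel_word ::
  "('a \<Rightarrow> 'a) \<Rightarrow> ('a set \<times> ('a magma \<Rightarrow>\<^sub>0 'k::comm_ring_1) set) list \<Rightarrow> ('a set \<times> ('a magma \<Rightarrow>\<^sub>0 'k) set) list" where
  "sym_relabel_word \<sigma> = map (\<lambda>(F, z). (\<sigma> ` F, sp_map Lie_species \<sigma> F z))"

definition sym_relabel ::
  "('a \<Rightarrow> 'a) \<Rightarrow> (('a set \<times> ('a magma \<Rightarrow>\<^sub>0 'k::comm_ring_1) set) list \<Rightarrow>\<^sub>0 'k) \<Rightarrow>
    (('a set \<times> ('a magma \<Rightarrow>\<^sub>0 'k) set) list \<Rightarrow>\<^sub>0 'k)" where
  "sym_relabel \<sigma> = lin_ext (\<lambda>w. gen (sym_relabel_word \<sigma> w))"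

lemma linear_map_sym_relabel: "linear_map (sym_relabel \<sigma>)"
  unfolding sym_relabel_def by (rule linear_map_lin_ext)

lemma sym_relabel_single [simp]:
  "sym_relabel \<sigma> (Poly_Mapping.single w c) = Poly_Mapping.single (sym_relabel_word \<sigma> w) c"
  by (simp add: sym_relabel_def)

lemma sym_relabel_word_simps [simp]:
  "sym_relabel_word \<sigma> (u @ v) = sym_relabel_word \<sigma> u @ sym_relabel_word \<sigma> v"
  "sym_relabel_word \<sigma> ((F, lie_class F x) # v) =
     (\<sigma> ` F, lie_class (\<sigma> ` F) (relabel_magma \<sigma> x)) # sym_relabel_word \<sigma> v"
  by (simp_all add: sym_relabel_word_def Lie_map_class)

lemma compositions_image:
  assumes "inj_on \<sigma> I" "Fs \<in> compositions I"
  shows "map ((`) \<sigma>) Fs \<in> compositions (\<sigma> ` I)"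
proof -
  have p: "partition_on I (set Fs)" "distinct Fs" using assms(2) by (auto simp: compositions_def)
  have "inj_on ((`) \<sigma>) (set Fs)"
    using p(1) assms(1) unfolding partition_on_def
    by (intro inj_on_subset[OF inj_on_image_Pow[OF assms(1)]]) auto
  moreover have "partition_on (\<sigma> ` I) ((`) \<sigma> ` set Fs - {{}})"
    by (rule partition_on_inj_image[OF p(1) assms(1)])
  moreover have "(`) \<sigma> ` set Fs - {{}} = (`) \<sigma> ` set Fs"
    using p(1) by (auto simp: partition_on_def)
  ultimately show ?thesis using p(2) by (simp add: compositions_def distinct_map)
qed

lemma sym_relabel_word_sym_words:
  assumes \<sigma>: "inj_on \<sigma> I" and w: "w \<in> sym_words Lie_species n I"
  shows "sym_relabel_word \<sigma> w \<in> sym_words Lie_species n (\<sigma> ` I)"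
proof -
  have carr: "sp_map Lie_species \<sigma> F z \<in> carrier (sp_val Lie_species (\<sigma> ` F))" if Fz: "(F, z) \<in> set w" for F z
  proof -
    have "F \<subseteq> I" using w Fz by (force simp: sym_words_def compositions_def partition_on_def)
    then have "inj_on \<sigma> F" using \<sigma> inj_on_subset by blast
    moreover obtain x where "x \<in> multilinear_part F" "z = lie_class F x"
      using w Fz by (auto simp: sym_words_def Lie_simps)
    ultimately show ?thesis
      by (auto simp: Lie_map_class Lie_simps intro: relabel_magma_multilinear)
  qed
  have "z \<in> carrier (sp_val Lie_species F)" if "(F, z) \<in> set (sym_relabel_word \<sigma> w)" for F z
  proof -
    from that obtain G y where *: "(G, y) \<in> set w" "F = \<sigma> ` G" "z = sp_map Lie_species \<sigma> G y"
      by (auto simp: sym_relabel_word_def)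
    from carr[OF *(1)] show ?thesis by (simp only: *)
  qed
  then have "\<forall>(F, z)\<in>set (sym_relabel_word \<sigma> w). z \<in> carrier (sp_val Lie_species F)" by auto
  moreover have "map fst (sym_relabel_word \<sigma> w) = map ((`) \<sigma>) (map fst w)"
    by (simp add: sym_relabel_word_def comp_def case_prod_beta)
  then have "map fst (sym_relabel_word \<sigma> w) \<in> compositions (\<sigma> ` I)"
    using w compositions_image[OF \<sigma>, of "map fst w"] by (simp add: sym_words_def)
  moreover have "int (length (sym_relabel_word \<sigma> w)) = n"
    using w by (simp add: sym_words_def sym_relabel_word_def)
  ultimately show ?thesis unfolding sym_words_def by (intro CollectI conjI)
qed

lemma sym_relabel_relators:
  fixes r :: "('a set \<times> ('a magma \<Rightarrow>\<^sub>0 'k::comm_ring_1) set) list \<Rightarrow>\<^sub>0 'k"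
  assumes \<sigma>: "inj_on \<sigma> I" and r: "r \<in> sym_relators Lie_species n I"
  shows "sym_relabel \<sigma> r \<in> sym_relators Lie_species n (\<sigma> ` I)"
  using r
proof cases
  case (additive u F x v y)
  then obtain p q where pq: "x = lie_class F p" "y = lie_class F q"
    by (auto simp: sym_words_def Lie_simps)
  show ?thesis
    using sym_relators.additive[OF sym_relabel_word_sym_words[OF \<sigma> additive(2), unfolded pq sym_relabel_word_simps]
        sym_relabel_word_sym_words[OF \<sigma> additive(3), unfolded pq sym_relabel_word_simps]]
    by (simp add: additive(1) pq Lie_simps linear_map_simps[OF linear_map_sym_relabel] relabel_magma_simps)
next
  case (homogeneous u F x v c)
  then obtain p where p: "x = lie_class F p"
    by (auto simp: sym_words_def Lie_simps)
  show ?thesis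
    using sym_relators.homogeneous[OF sym_relabel_word_sym_words[OF \<sigma> homogeneous(2), unfolded p sym_relabel_word_simps], of c]
    by (simp add: homogeneous(1) p Lie_simps linear_map_simps[OF linear_map_sym_relabel] relabel_magma_simps)
next
  case (anticommutative u a b v)
  define f where "f = (\<lambda>(F, z). (\<sigma> ` F, sp_map (Lie_species :: ('a, 'k, _) species) \<sigma> F z))"
  have e: "sym_relabel_word \<sigma> w = map f w" for w
    by (simp add: sym_relabel_word_def f_def)
  have "map f u @ f a # f b # map f v \<in> sym_words Lie_species n (\<sigma> ` I)"
    using sym_relabel_word_sym_words[OF \<sigma> anticommutative(2)] by (simp add: e)
  from sym_relators.anticommutative[OF this] show ?thesis
    by (simp add: anticommutative(1) linear_map_simps(1)[OF linear_map_sym_relabel] e)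
qed

lemma sym_Lie_map:
  assumes "inj_on \<sigma> I"
  shows "gr_map sym_Lie \<sigma> I n (sym_class n I x) = sym_class n (\<sigma> ` I) (sym_relabel \<sigma> x)"
proof -
  have "sym_relabel \<sigma> z \<in> sym_relations Lie_species n (\<sigma> ` I)" if "z \<in> sym_relations Lie_species n I" for z
    by (rule sym_relations_linear_image[OF linear_map_sym_relabel subspace_sym_relations _ that])
       (intro sym_relationsI sym_relabel_relators[OF assms])
  then show ?thesis
    unfolding sym_desusp_def graded_species_algebra.simps sym_relabel_word_def[symmetric] sym_relabel_def[symmetric]
    by (intro on_classes_residue_class subspace_sym_relations linear_map_sym_relabel)
qed

lemma sym_relabel_free_on:
  "inj_on \<sigma> I \<Longrightarrow> x \<in> free_on (sym_words Lie_species n I) \<Longrightarrow>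
    sym_relabel \<sigma> x \<in> free_on (sym_words Lie_species n (\<sigma> ` I))"
  by (rule linear_map_in_subspace[OF linear_map_sym_relabel subspace_free_on])
     (auto intro!: gen_in_free_on sym_relabel_word_sym_words)

lemma comparison_sym_relabel:
  fixes x :: "('a set \<times> ('a magma \<Rightarrow>\<^sub>0 'k::comm_ring_1) set) list \<Rightarrow>\<^sub>0 'k"
  assumes "x \<in> free_on (sym_words Lie_species n I)"
  shows "comparison (sym_relabel \<sigma> x) = relabel \<sigma> (comparison x)"
proof (rule linear_map_eqI[OF _ _ assms])
  fix w :: "('a set \<times> ('a magma \<Rightarrow>\<^sub>0 'k) set) list"
  assume "w \<in> sym_words Lie_species n I"
  then have "\<forall>(F, z)\<in>set w. z \<in> carrier (sp_val Lie_species F)" by (auto simp: sym_words_def)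
  then have "comparison_word (sym_relabel_word \<sigma> w) = relabel \<sigma> (comparison_word w)"
  proof (induction w)
    case Nil
    then show ?case by (simp add: sym_relabel_word_def)
  next
    case (Cons p w)
    obtain F x where "p = (F, lie_class F x)" using Cons.prems by (cases p) (auto simp: Lie_simps)
    with Cons show ?case by (simp add: relabel_mult block_lie_poly_relabel)
  qed
  then show "comparison (sym_relabel \<sigma> (gen w)) = relabel \<sigma> (comparison (gen w))" by simp
qed (auto intro!: linear_intros linear_map_compose[OF linear_map_comparison linear_map_sym_relabel])

definition cohomology_map :: "'a set \<Rightarrow> int \<Rightarrow> (('a set \<times> ('a magma \<Rightarrow>\<^sub>0 'k::comm_ring_1) set) list \<Rightarrow>\<^sub>0 'k) set \<Rightarrow>
    ('a list list \<Rightarrow>\<^sub>0 'k) set" where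
  "cohomology_map I n = on_classes (boundaries n I) comparison"

lemma cohomology_map_class: "cohomology_map I n (sym_class n I x) = cobar_class n I (comparison x)"
  unfolding cohomology_map_def
  by (rule on_classes_residue_class[OF subspace_sym_relations subspace_boundaries linear_map_comparison comparison_sym_relations])

lemma comparison_cocycle: "x \<in> free_on (sym_words Lie_species n I) \<Longrightarrow> comparison x \<in> cobar_cocycles n I"
  by (simp add: cobar_cocycles_eq comparison_cobar cdiff_comparison)

lemma module_iso_cohomology_map:
  assumes "finite I"
  shows "module_iso (gr_val sym_Lie I n) (gr_val L_dual I n :: ('k::comm_ring_1, ('a list list \<Rightarrow>\<^sub>0 'k) set) module) (cohomology_map I n)"
proof -
  let ?S = "gr_val sym_Lie I n :: ('k, _) module" and ?H = "gr_val L_dual I n :: ('k, ('a list list \<Rightarrow>\<^sub>0 'k) set) module"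
  have "cohomology_map I n \<in> module_hom class_ring ?S ?H"
    unfolding module_hom_def
  proof (intro CollectI conjI allI impI Pi_I)
    fix x assume "x \<in> carrier ?S"
    then show "cohomology_map I n x \<in> carrier ?H"
      by (auto simp: carrier_sym_Lie carrier_L_dual cohomology_map_class comparison_cocycle)
  next
    fix x y assume "x \<in> carrier ?S \<and> y \<in> carrier ?S"
    then show "cohomology_map I n (x \<oplus>\<^bsub>?S\<^esub> y) = cohomology_map I n x \<oplus>\<^bsub>?H\<^esub> cohomology_map I n y"
      by (auto simp: sym_Lie_val L_dual_val quotient_module_simps(1) cohomology_map_class comparison_simps
          quotient_module_add[OF subspace_boundaries] quotient_module_add[OF subspace_sym_relations])
  next
    fix c :: 'k and x assume "c \<in> carrier class_ring \<and> x \<in> carrier ?S"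
    then show "cohomology_map I n (c \<odot>\<^bsub>?S\<^esub> x) = c \<odot>\<^bsub>?H\<^esub> cohomology_map I n x"
      by (auto simp: sym_Lie_val L_dual_val quotient_module_simps(1) cohomology_map_class comparison_simps
          quotient_module_smult[OF subspace_boundaries] quotient_module_smult[OF subspace_sym_relations])
  qed
  then have "mod_hom class_ring ?S ?H (cohomology_map I n)"
    by (intro mod_hom.intro mod_hom_axioms.intro)
       (simp_all add: sym_Lie_val L_dual_val module_quotient_module subspace_free_on subspace_sym_relations
         subspace_cocycles subspace_boundaries)
  moreover have "inj_on (cohomology_map I n) (carrier ?S)"
  proof (rule inj_onI)
    fix x y assume xy: "x \<in> carrier ?S" "y \<in> carrier ?S" "cohomology_map I n x = cohomology_map I n y"
    then obtain p q where pq: "p \<in> free_on (sym_words Lie_species n I)" "x = sym_class n I p"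
      "q \<in> free_on (sym_words Lie_species n I)" "y = sym_class n I q"
      by (auto simp: carrier_sym_Lie)
    then have "comparison (p - q) \<in> boundaries n I"
      using xy(3) by (simp add: cohomology_map_class residue_class_eq_iff[OF subspace_boundaries] comparison_simps)
    then have "p - q \<in> sym_relations Lie_species n I"
      using pq by (intro comparison_injective[OF assms] free_mod.subspace_diff[OF subspace_free_on])
    then show "x = y" by (simp add: pq residue_class_eq_iff[OF subspace_sym_relations])
  qed
  moreover have "cohomology_map I n ` carrier ?S = carrier ?H"
  proof
    show "cohomology_map I n ` carrier ?S \<subseteq> carrier ?H"
      by (auto simp: carrier_sym_Lie carrier_L_dual cohomology_map_class comparison_cocycle)
    show "carrier ?H \<subseteq> cohomology_map I n ` carrier ?S"
    proof
      fix v assume "v \<in> carrier ?H"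
      then obtain x where x: "x \<in> cobar n I" "cdiff x = 0" "v = cobar_class n I x"
        by (auto simp: carrier_L_dual cobar_cocycles_eq)
      then obtain y where "y \<in> free_on (sym_words Lie_species n I)" "x - comparison y \<in> boundaries n I"
        using comparison_surjective[OF assms] by blast
      then show "v \<in> cohomology_map I n ` carrier ?S"
        using x(3) by (auto simp: carrier_sym_Lie image_image cohomology_map_class residue_class_eq_iff[OF subspace_boundaries])
    qed
  qed
  ultimately show ?thesis by (simp add: module_iso_def bij_betw_def)
qed

theorem graded_species_algebra_iso_cohomology_map:
  "graded_species_algebra_iso sym_Lie (L_dual :: ('a, 'k::comm_ring_1, _) graded_species_algebra) cohomology_map"
  unfolding graded_species_algebra_iso_def
proof (intro conjI allI impI ballI)
  fix I :: "'a set" and n assume "finite I"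
  then show "module_iso (gr_val sym_Lie I n) (gr_val (L_dual :: ('a, 'k, _) graded_species_algebra) I n) (cohomology_map I n)"
    by (rule module_iso_cohomology_map)
next
  fix I :: "'a set" and n and \<sigma> :: "'a \<Rightarrow> 'a" and x :: "(_ \<Rightarrow>\<^sub>0 'k) set"
  assume I: "finite I \<and> inj_on \<sigma> I" and "x \<in> carrier (gr_val sym_Lie I n)"
  then obtain p where p: "p \<in> free_on (sym_words Lie_species n I)" "x = sym_class n I p"
    by (auto simp: carrier_sym_Lie)
  show "cohomology_map (\<sigma> ` I) n (gr_map sym_Lie \<sigma> I n x) = gr_map L_dual \<sigma> I n (cohomology_map I n x)"
    using I by (simp add: p(2) sym_Lie_map L_dual_map cohomology_map_class comparison_sym_relabel[OF p(1)])
next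
  fix A B :: "'a set" and m n and x y :: "(_ \<Rightarrow>\<^sub>0 'k) set"
  assume AB: "finite A \<and> finite B \<and> A \<inter> B = {}"
    and "x \<in> carrier (gr_val sym_Lie A m)" "y \<in> carrier (gr_val sym_Lie B n)"
  then obtain p q where pq: "p \<in> free_on (sym_words Lie_species m A)" "x = sym_class m A p"
    "q \<in> free_on (sym_words Lie_species n B)" "y = sym_class n B q"
    by (auto simp: carrier_sym_Lie)
  have "gr_mult sym_Lie A m B n x y = sym_class (m + n) (A \<union> B) (p * q)"
    using AB pq by (simp add: sym_Lie_mult)
  moreover have "gr_mult L_dual A m B n (cohomology_map A m x) (cohomology_map B n y) = cobar_class (m + n) (A \<union> B) (comparison p * comparison q)"
    using AB pq by (simp add: cohomology_map_class L_dual_mult comparison_cobar cdiff_comparison)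
  ultimately show "cohomology_map (A \<union> B) (m + n) (gr_mult sym_Lie A m B n x y)
      = gr_mult L_dual A m B n (cohomology_map A m x) (cohomology_map B n y)"
    by (simp add: cohomology_map_class comparison_mult)
next
  show "cohomology_map {} 0 (gr_unit sym_Lie) = (gr_unit L_dual :: ('a list list \<Rightarrow>\<^sub>0 'k) set)"
    using cohomology_map_class[of "{}" 0 "1 :: ('a set \<times> ('a magma \<Rightarrow>\<^sub>0 'k) set) list \<Rightarrow>\<^sub>0 'k"]
    by (simp add: sym_desusp_def koszul_dual_L_def cobar_coboundaries_eq)
qed

theorem ex_graded_species_algebra_iso:
  "\<exists>\<Phi>. graded_species_algebra_iso (L_dual :: ('a, 'k::comm_ring_1, _) graded_species_algebra) sym_Lie \<Phi>"
proof (rule exI, rule graded_species_algebra_iso_inverse[OF graded_species_algebra_iso_cohomology_map])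
  fix I :: "'a set" and n and \<sigma> :: "'a \<Rightarrow> 'a" and x :: "(_ \<Rightarrow>\<^sub>0 'k) set"
  assume "finite I" "inj_on \<sigma> I" "x \<in> carrier (gr_val sym_Lie I n)"
  then show "gr_map sym_Lie \<sigma> I n x \<in> carrier (gr_val sym_Lie (\<sigma> ` I) n)"
    by (auto simp: carrier_sym_Lie sym_Lie_map intro!: imageI sym_relabel_free_on)
next
  fix A B :: "'a set" and m n and x y :: "(_ \<Rightarrow>\<^sub>0 'k) set"
  assume "finite A" "finite B" "A \<inter> B = {}"
    "x \<in> carrier (gr_val sym_Lie A m)" "y \<in> carrier (gr_val sym_Lie B n)"
  then show "gr_mult sym_Lie A m B n x y \<in> carrier (gr_val sym_Lie (A \<union> B) (m + n))"
    by (auto simp: carrier_sym_Lie sym_Lie_mult intro!: imageI sym_words_free_on_mult)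
next
  have "(1 :: _ \<Rightarrow>\<^sub>0 'k) \<in> free_on (sym_words (Lie_species :: ('a, 'k, _) species) 0 {})"
    using gen_in_free_on[of "[]" "sym_words (Lie_species :: ('a, 'k, _) species) 0 {}" "1 :: 'k"]
    by (simp add: sym_words_def compositions_empty)
  then show "gr_unit (sym_Lie :: ('a, 'k, _) graded_species_algebra) \<in> carrier (gr_val sym_Lie {} 0)"
    by (auto simp: sym_desusp_def quotient_module_simps)
qed

section \<open>Counting by Stirling numbers\<close>

definition distinct_lists :: "'a set \<Rightarrow> 'a list set" where
  "distinct_lists S = {xs. set xs \<subseteq> S \<and> distinct xs}"

lemma finite_distinct_lists: "finite S \<Longrightarrow> finite (distinct_lists S)"
  unfolding distinct_lists_def by (rule finite_subset_distinct)

lemma distinct_lists_rec: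
  "distinct_lists S = insert [] (\<Union>x\<in>S. (#) x ` distinct_lists (S - {x}))"
proof (intro equalityI subsetI)
  fix xs assume "xs \<in> distinct_lists S"
  then show "xs \<in> insert [] (\<Union>x\<in>S. (#) x ` distinct_lists (S - {x}))"
    by (cases xs) (auto simp: distinct_lists_def)
qed (auto simp: distinct_lists_def)

text \<open>Splitting off the first letter of a list gives the recursion of the Stirling numbers in the size of \<open>S\<close>:
  the empty list contributes one term, and each of the possible first letters contributes the sum for a
  set with one element less. The list is the remainder of a cycle through a further point.\<close>

lemma sum_distinct_lists_stirling:
  assumes "finite S"
  shows "(\<Sum>xs\<in>distinct_lists S. stirling (card S - length xs) n) = stirling (Suc (card S)) (Suc n)"
  using assms
proof (induction "card S" arbitrary: S)
  case 0
  then have "distinct_lists S = {[]}" by (auto simp: distinct_lists_def)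
  with 0 show ?case by simp
next
  case (Suc r)
  let ?g = "\<lambda>xs. stirling (Suc r - length xs) n"
  have "(\<Sum>xs\<in>distinct_lists S. ?g xs) = ?g [] + (\<Sum>xs\<in>(\<Union>x\<in>S. (#) x ` distinct_lists (S - {x})). ?g xs)"
    by (subst distinct_lists_rec, subst sum.insert) (auto simp: Suc.prems finite_distinct_lists)
  also have "(\<Sum>xs\<in>(\<Union>x\<in>S. (#) x ` distinct_lists (S - {x})). ?g xs)
      = (\<Sum>x\<in>S. \<Sum>xs\<in>(#) x ` distinct_lists (S - {x}). ?g xs)"
    by (intro sum.UNION_disjoint) (auto simp: Suc.prems finite_distinct_lists)
  also have "\<dots> = (\<Sum>x\<in>S. \<Sum>xs\<in>distinct_lists (S - {x}). stirling (r - length xs) n)"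
    by (simp add: sum.reindex)
  also have "\<dots> = (\<Sum>x\<in>S. stirling (Suc r) (Suc n))"
  proof (rule sum.cong[OF refl])
    fix x assume "x \<in> S"
    then have "r = card (S - {x})" using Suc.hyps(2) Suc.prems by simp
    from Suc.hyps(1)[OF this] Suc.prems this
    show "(\<Sum>xs\<in>distinct_lists (S - {x}). stirling (r - length xs) n) = stirling (Suc r) (Suc n)"
      by simp
  qed
  finally show ?case by (simp flip: Suc.hyps(2))
qed

lemma cycles_from_eq:
  assumes "a \<in> I" shows "cycles_from a I = (#) a ` distinct_lists (I - {a})"
proof (intro equalityI subsetI)
  fix c assume "c \<in> cycles_from a I"
  then show "c \<in> (#) a ` distinct_lists (I - {a})"
    by (cases c) (auto simp: cycles_from_def distinct_lists_def)
qed (use assms in \<open>auto simp: cycles_from_def distinct_lists_def\<close>)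

theorem card_cycle_lists: "finite I \<Longrightarrow> card (cycle_lists n I) = stirling (card I) n"
proof (induction n arbitrary: I)
  case 0
  show ?case
  proof (cases "I = {}")
    case False
    with 0 have "card I \<noteq> 0" by simp
    with False show ?thesis by (cases "card I") simp_all
  qed simp
next
  case (Suc n)
  show ?case
  proof (cases "I = {}")
    case False
    let ?S = "I - {pick I}"
    have a: "pick I \<in> I" using False by (rule pick_in)
    have cI: "card I = Suc (card ?S)" by (rule card.remove[OF Suc.prems a])
    have "card (cycle_lists (Suc n) I) = (\<Sum>c\<in>cycles_from (pick I) I. card (cycle_lists n (I - set c)))"
      unfolding card_eq_sum by (rule sum_cycle_lists[OF Suc.prems False])
    also have "\<dots> = (\<Sum>c\<in>cycles_from (pick I) I. stirling (card I - length c) n)"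
    proof (rule sum.cong[OF refl])
      fix c assume "c \<in> cycles_from (pick I) I"
      note c = cycles_from_props[OF this]
      have "card (I - set c) = card I - length c"
        using c(2,3) finite_subset[OF c(2) Suc.prems] by (simp add: card_Diff_subset distinct_card)
      then show "card (cycle_lists n (I - set c)) = stirling (card I - length c) n"
        using Suc.IH[of "I - set c"] Suc.prems by simp
    qed
    also have "\<dots> = (\<Sum>xs\<in>distinct_lists ?S. stirling (card ?S - length xs) n)"
      unfolding cycles_from_eq[OF a] cI by (simp add: sum.reindex)
    also have "\<dots> = stirling (card I) (Suc n)"
      using sum_distinct_lists_stirling[of ?S n] Suc.prems cI by simp
    finally show ?thesis .
  qed simp
qed

lemma orbit_eq_of_mem:
  assumes "permutation p" "y \<in> orbit p x" shows "orbit p y = orbit p x"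
  by (rule orbit_cyclic_eq3[OF cyclic_on_orbit'[OF assms(1)] assms(2)])

lemma permutes_permutation: "finite S \<Longrightarrow> p permutes S \<Longrightarrow> permutation p"
  unfolding permutation_permutes by blast

text \<open>Composition with a transposition inserts the new point \<open>a\<close> into the cycle of \<open>b\<close>.\<close>

lemma orbit_insert_point:
  assumes S: "finite S" "a \<notin> S" and p: "p permutes S" and b: "b \<in> S" and x: "x \<in> S"
  shows "orbit (transpose a b \<circ> p) x \<inter> S = orbit p x"
proof -
  let ?q = "transpose a b \<circ> p"
  have q: "?q z = (if z = a then b else if p z = b then a else p z)" for z
    using S(2) p b by (auto simp: transpose_def permutes_not_in permutes_in_image[OF p] dest: permutes_in_image[OF p, THEN iffD2])
  have *: "(z \<in> S \<longrightarrow> z \<in> orbit p x) \<and> (z = a \<longrightarrow> b \<in> orbit p x)" if "z \<in> orbit ?q x" for z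
    using that
  proof (induction rule: orbit.induct)
    case base
    show ?case unfolding q using x S(2) orbit.base[of p x] permutes_in_image[OF p, of x] by auto
  next
    case (step z)
    have out: "p z = z" if "z \<notin> S" using p that by (simp add: permutes_not_in)
    show ?case unfolding q using step.IH S(2) b orbit.step[of z p x] out permutes_in_image[OF p, of z] by auto
  qed
  have sub: "orbit p x \<subseteq> S" by (rule permutes_orbit_subset[OF p x])
  have "z \<in> orbit ?q x" if "z \<in> orbit p x" for z
    using that
  proof (induction rule: orbit.induct)
    case base
    have "x \<noteq> a" using x S(2) by auto
    show ?case
    proof (cases "p x = b")
      case True
      have "a \<in> orbit ?q x" using orbit.base[of ?q x] \<open>x \<noteq> a\<close> True unfolding q by simp
      from orbit.step[OF this] True show ?thesis unfolding q by simp
    next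
      case False
      then show ?thesis using orbit.base[of ?q x] \<open>x \<noteq> a\<close> unfolding q by simp
    qed
  next
    case (step z)
    have "z \<noteq> a" using sub step.hyps S(2) by auto
    show ?case
    proof (cases "p z = b")
      case True
      have "a \<in> orbit ?q x" using orbit.step[OF step.IH] \<open>z \<noteq> a\<close> True unfolding q by simp
      from orbit.step[OF this] True show ?thesis unfolding q by simp
    next
      case False
      then show ?thesis using orbit.step[OF step.IH] \<open>z \<noteq> a\<close> unfolding q by simp
    qed
  qed
  with * sub show ?thesis by blast
qed

lemma num_cycles_insert_point:
  assumes S: "finite S" "a \<notin> S" and p: "p permutes S" and b: "b \<in> insert a S"
  shows "num_cycles (insert a S) (transpose a b \<circ> p) = (if b = a then Suc (num_cycles S p) else num_cycles S p)"
proof (cases "b = a")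
  case True
  have "p a = a" using p S(2) by (simp add: permutes_not_in)
  then have "orbit p a = {a}" by (simp add: orbit_eq_singleton_iff)
  moreover have "{a} \<notin> orbit p ` S"
    using permutes_orbit_subset[OF p] S(2) by (metis image_iff insert_subset)
  ultimately show ?thesis using True S(1) by (simp add: num_cycles_def)
next
  case False
  then have bS: "b \<in> S" using b by simp
  let ?q = "transpose a b \<circ> p"
  have "?q permutes insert a S"
    using permutes_compose[OF permutes_subset[OF p] permutes_swap_id[of a "insert a S" b]] b by auto
  then have perm: "permutation ?q" "permutation p"
    using permutes_permutation S(1) p by (metis finite_insert, metis)
  have "?q a = b" using p S(2) by (simp add: permutes_not_in)
  then have "b \<in> orbit ?q a" using orbit.base[of ?q a] by simp
  then have "orbit ?q b = orbit ?q a" by (rule orbit_eq_of_mem[OF perm(1)])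
  then have img: "orbit ?q ` insert a S = orbit ?q ` S" using bS by (simp add: insert_absorb image_iff) blast
  \<comment> \<open>Every orbit of the composition meets \<open>S\<close> in an orbit of \<open>p\<close>.\<close>
  have "inj_on (\<lambda>C. C \<inter> S) (orbit ?q ` S)"
  proof (rule inj_onI, clarify)
    fix x y assume xy: "x \<in> S" "y \<in> S" and e: "orbit ?q x \<inter> S = orbit ?q y \<inter> S"
    have "y \<in> orbit ?q y" by (rule permutation_self_in_orbit[OF perm(1)])
    with e xy have "y \<in> orbit ?q x" by blast
    then show "orbit ?q x = orbit ?q y" using orbit_eq_of_mem[OF perm(1)] by simp
  qed
  then have "card (orbit ?q ` S) = card ((\<lambda>C. C \<inter> S) ` orbit ?q ` S)" by (simp add: card_image)
  also have "(\<lambda>C. C \<inter> S) ` orbit ?q ` S = orbit p ` S"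
    unfolding image_image by (intro image_cong refl orbit_insert_point[OF S p bS])
  finally show ?thesis unfolding num_cycles_def img by (simp only: False if_False)
qed

text \<open>A new point is either fixed or inserted into a cycle in front of one of the old points.\<close>

theorem card_permutations_num_cycles:
  "finite S \<Longrightarrow> card {p. p permutes S \<and> num_cycles S p = k} = stirling (card S) k"
proof (induction S arbitrary: k rule: finite_induct)
  case empty
  have "{p. p permutes {} \<and> num_cycles {} p = k} = (if k = 0 then {id} else {})"
    by (auto simp: num_cycles_def)
  then show ?case by (cases k) auto
next
  case (insert a S)
  define P where "P k = {p. p permutes S \<and> num_cycles S p = k}" for k
  let ?f = "\<lambda>(b, p). transpose a b \<circ> p"
  have fin: "finite (P k)" for k
    using finite_permutations[OF insert.hyps(1)] by (rule rev_finite_subset) (auto simp: P_def)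
  have inj: "inj_on ?f (insert a S \<times> {p. p permutes S})"
  proof (rule inj_onI, clarify)
    fix b p c q assume *: "p permutes S" "q permutes S" "transpose a b \<circ> p = transpose a c \<circ> q"
    have "p a = a" "q a = a" using * insert.hyps by (auto simp: permutes_not_in)
    with fun_cong[OF *(3), of a] have "b = c" by simp
    moreover have "p = transpose a b \<circ> (transpose a b \<circ> p)" "q = transpose a c \<circ> (transpose a c \<circ> q)"
      by (simp_all add: fun_eq_iff)
    ultimately show "b = c \<and> p = q" using *(3) by metis
  qed
  have "{p. p permutes insert a S \<and> num_cycles (insert a S) p = k}
      = ?f ` ({(b, p). b \<in> insert a S \<and> p permutes S \<and> num_cycles (insert a S) (transpose a b \<circ> p) = k})"
  proof (intro equalityI subsetI)
    fix x assume x: "x \<in> {p. p permutes insert a S \<and> num_cycles (insert a S) p = k}"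
    then have "x \<in> ?f ` {(b, p). b \<in> insert a S \<and> p \<in> {p. p permutes S}}"
      using permutes_insert[of a S] by auto
    then obtain b p where "b \<in> insert a S" "p permutes S" "x = transpose a b \<circ> p" by auto
    with x show "x \<in> ?f ` ({(b, p). b \<in> insert a S \<and> p permutes S \<and> num_cycles (insert a S) (transpose a b \<circ> p) = k})"
      by (intro image_eqI[of _ _ "(b, p)"]) auto
  next
    fix x assume "x \<in> ?f ` ({(b, p). b \<in> insert a S \<and> p permutes S \<and> num_cycles (insert a S) (transpose a b \<circ> p) = k})"
    then obtain b p where *: "b \<in> insert a S" "p permutes S" "x = transpose a b \<circ> p"
      "num_cycles (insert a S) x = k" by auto
    then have "x permutes insert a S"
      using permutes_compose[OF permutes_subset[OF *(2)] permutes_swap_id[of a "insert a S" b]] by auto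
    with *(4) show "x \<in> {p. p permutes insert a S \<and> num_cycles (insert a S) p = k}" by simp
  qed
  also have "{(b, p). b \<in> insert a S \<and> p permutes S \<and> num_cycles (insert a S) (transpose a b \<circ> p) = k}
      = {a} \<times> {p. p permutes S \<and> Suc (num_cycles S p) = k} \<union> S \<times> P k"
    using insert.hyps num_cycles_insert_point[OF insert.hyps(1,2), of _ a]
    by (auto simp: num_cycles_insert_point P_def split: if_splits)
  finally have e: "{p. p permutes insert a S \<and> num_cycles (insert a S) p = k}
      = ?f ` ({a} \<times> {p. p permutes S \<and> Suc (num_cycles S p) = k} \<union> S \<times> P k)" .
  have "card {p. p permutes insert a S \<and> num_cycles (insert a S) p = k}
      = card ({a} \<times> {p. p permutes S \<and> Suc (num_cycles S p) = k} \<union> S \<times> P k)"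
    unfolding e by (intro card_image inj_on_subset[OF inj]) (auto simp: P_def)
  also have "\<dots> = card ({a} \<times> {p. p permutes S \<and> Suc (num_cycles S p) = k}) + card (S \<times> P k)"
    using insert.hyps fin finite_permutations[OF insert.hyps(1)]
    by (intro card_Un_disjoint) (auto intro!: finite_cartesian_product)
  also have "\<dots> = card {p. p permutes S \<and> Suc (num_cycles S p) = k} + card S * stirling (card S) k"
    using insert.IH[of k] by (simp add: card_cartesian_product P_def)
  also have "\<dots> = stirling (card (insert a S)) k"
  proof (cases k)
    case 0
    then show ?thesis using insert.hyps by (cases "card S") auto
  next
    case (Suc k')
    then show ?thesis using insert.IH[of k'] insert.hyps by simp
  qed
  finally show ?case .
qed

section \<open>The basis indexed by permutations\<close>

text \<open>The products of left-normed brackets span, and their independence is inherited from the cohomology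
  through the comparison map.\<close>

lemma sym_Lie_basis:
  fixes I :: "'a set"
  assumes "finite I"
  shows "\<exists>B. module_basis (gr_val (sym_Lie :: ('a, 'k::comm_ring_1, _) graded_species_algebra) I (int n)) B
    \<and> finite B \<and> card B = stirling (card I) n"
proof -
  let ?M = "free_on (sym_words (Lie_species :: ('a, 'k, _) species) (int n) I) :: (_ \<Rightarrow>\<^sub>0 'k) set"
  let ?N = "sym_relations (Lie_species :: ('a, 'k, _) species) (int n) I"
  let ?e = "\<lambda>cs. gen (sym_cycles cs) :: _ \<Rightarrow>\<^sub>0 'k"
  have e: "?e cs \<in> ?M" if "cs \<in> cycle_lists n I" for cs
    using that by (intro gen_in_free_on sym_cycles_sym_words)
  have span: "\<exists>f. x - (\<Sum>cs\<in>cycle_lists n I. pm_scale (f cs) (?e cs)) \<in> ?N" if "x \<in> ?M" for x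
    using sym_cycles_express[OF assms that] by blast
  have indep: "f cs = 0" if "(\<Sum>cs\<in>cycle_lists n I. pm_scale (f cs) (?e cs)) \<in> ?N" "cs \<in> cycle_lists n I" for f cs
    using comparison_sym_relations[OF that(1)] that(2)
    by (intro sym_cycles_independent[OF assms, of f n]) (simp_all only: comparison_simps)
  have basis: "module_basis (quotient_module ?M ?N) ((\<lambda>cs. residue_class ?N (?e cs)) ` cycle_lists n I)"
    "inj_on (\<lambda>cs. residue_class ?N (?e cs)) (cycle_lists n I)"
    by (rule module_basis_quotient_module[OF subspace_free_on subspace_sym_relations finite_cycle_lists[OF assms]];
        rule e span indep; assumption)+
  show ?thesis
    unfolding sym_Lie_val
    using basis finite_cycle_lists[OF assms] card_cycle_lists[OF assms, of n]
    by (intro exI[of _ "(\<lambda>cs. sym_class (int n) I (?e cs)) ` cycle_lists n I"]) (simp add: card_image)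
qed

text \<open>In negative degrees there are no words at all.\<close>

lemma sym_Lie_basis_negative:
  fixes I :: "'a set"
  assumes "n < 0"
  shows "module_basis (gr_val (sym_Lie :: ('a, 'k::comm_ring_1, _) graded_species_algebra) I n) {}"
proof -
  let ?M = "free_on (sym_words (Lie_species :: ('a, 'k, _) species) n I) :: (_ \<Rightarrow>\<^sub>0 'k) set"
  let ?N = "sym_relations (Lie_species :: ('a, 'k, _) species) n I"
  have "?M = {0}" using assms by (auto simp: sym_words_negative free_on_def)
  then have "module_basis (quotient_module ?M ?N) ((\<lambda>w. residue_class ?N (gen w)) ` {})"
    by (intro module_basis_quotient_module(1) subspace_free_on subspace_sym_relations)
       (simp_all only: finite.emptyI empty_iff singleton_iff sum.empty diff_zero
         free_mod.subspace_0[OF subspace_sym_relations] simp_thms)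
  then show ?thesis by (simp add: sym_Lie_val)
qed

theorem theorem4p1:
  shows "(\<exists>\<Phi>. graded_species_algebra_iso
            (koszul_dual_L :: ('a, 'k::comm_ring_1, _) graded_species_algebra)
            (sym_desusp (Lie_species :: ('a, 'k, _) species)) \<Phi>)
    \<and> (\<forall>p q :: nat.
         let n = int p - int q;
             H = gr_val (koszul_dual_L :: (nat, 'k, _) graded_species_algebra) {1..p} n;
             S = gr_val (sym_desusp (Lie_species :: (nat, 'k, _) species)) {1..p} n
         in (\<exists>\<phi>. module_iso H S \<phi>)
          \<and> (\<exists>B b. module_basis S B
                \<and> bij_betw b {\<pi>. \<pi> permutes {1..p} \<and> int (num_cycles {1..p} \<pi>) = n} B)
          \<and> module_dim S = (if q \<le> p then stirling p (p - q) else 0))"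
proof (intro conjI allI)
  show "\<exists>\<Phi>. graded_species_algebra_iso
      (koszul_dual_L :: ('a, 'k, _) graded_species_algebra) (sym_desusp Lie_species) \<Phi>"
    by (rule ex_graded_species_algebra_iso)
next
  fix p q :: nat
  define n where "n = int p - int q"
  define S where "S = gr_val (sym_Lie :: (nat, 'k, _) graded_species_algebra) {1..p} n"
  let ?H = "gr_val (koszul_dual_L :: (nat, 'k, _) graded_species_algebra) {1..p} n"
  let ?P = "{\<pi>. \<pi> permutes {1..p} \<and> int (num_cycles {1..p} \<pi>) = n}"
  let ?d = "if q \<le> p then stirling p (p - q) else 0"
  have iso: "\<exists>\<phi>. module_iso ?H S \<phi>"
    unfolding S_def by (rule exI, rule module_iso_inverse[OF module_iso_cohomology_map]) simp
  have P: "finite ?P"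
    by (rule rev_finite_subset[OF finite_permutations[of "{1..p}"]]) auto
  have "\<exists>B. module_basis S B \<and> finite B \<and> card B = ?d \<and> card ?P = ?d"
  proof (cases "q \<le> p")
    case True
    then have n: "n = int (p - q)" by (simp add: n_def)
    have "card ?P = stirling p (p - q)"
      using card_permutations_num_cycles[of "{1..p}" "p - q"] by (simp add: n)
    then show ?thesis
      using sym_Lie_basis[of "{1..p}" "p - q", where ?'k = 'k] True unfolding S_def n by simp
  next
    case False
    then have "n < 0" by (simp add: n_def)
    then have P: "?P = {}" by auto
    have "module_basis S {}" unfolding S_def by (rule sym_Lie_basis_negative[OF \<open>n < 0\<close>])
    then show ?thesis
      using False unfolding P by (intro exI[of _ "{}"]) simp
  qed
  then obtain B where B: "module_basis S B" "finite B" "card B = ?d" "card ?P = ?d" by blast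
  \<comment> \<open>Both sets are counted by the same Stirling number, so no particular bijection has to be constructed.\<close>
  then obtain b where "bij_betw b ?P B"
    using finite_same_card_bij[OF P B(2)] by auto
  moreover have "module_dim S = ?d"
    using B unfolding S_def sym_Lie_val
    by (subst module_dim_quotient_module) (auto simp: subspace_free_on subspace_sym_relations)
  ultimately show "let n = int p - int q;
             H = gr_val (koszul_dual_L :: (nat, 'k, _) graded_species_algebra) {1..p} n;
             S = gr_val (sym_desusp (Lie_species :: (nat, 'k, _) species)) {1..p} n
         in (\<exists>\<phi>. module_iso H S \<phi>)
          \<and> (\<exists>B b. module_basis S B
                \<and> bij_betw b {\<pi>. \<pi> permutes {1..p} \<and> int (num_cycles {1..p} \<pi>) = n} B)
          \<and> module_dim S = (if q \<le> p then stirling p (p - q) else 0)"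
    using iso B(1) unfolding Let_def n_def[symmetric] S_def[symmetric] by blast
qed

end
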